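(* Let $\alpha<\beta$ be real and $T$ an operator function on $[\alpha,\beta]$ satisfying (A1)–(A3), continuous in the norm resolvent sense, with $T(\lambda)$ bounded from below for each $\lambda\in[\alpha,\beta]$. Assume $\alpha,\beta\in\rho(T)$ and $\sigma(T)\cap(\alpha,\beta)=\{\lambda_1,\dots,\lambda_n\}\subset\sigma_{dis}(T)$, where $\lambda_1\le\dots\le\lambda_n$ are repeated according to multiplicity ($\dim\ker T(\lambda)$). If $u_1,\dots,u_n$ are linearly independent vectors with $T(\lambda_j)u_j=0$, then $$\mathcal H=\mathcal L_{(-\infty,0)}(T(\alpha))\dotplus\mathrm{span}\{u_1,\dots,u_n\}\dotplus\mathcal L_{(0,\infty)}(T(\beta)).$$
   Context: $\dotplus$ denotes a direct sum of subspaces. For a self-adjoint operator $A$ with spectral measure $E$ and a Borel set $\Delta\subset\mathbb R$, $\mathcal L_\Delta(A):=\mathrm{ran}\,E(\Delta)$; the form of $A$ is $\mathfrak a[x,y]=\int\mu\,d\langle E(\mu)x,y\rangle$ on $\mathrm{dom}(|A|^{1/2})$, $\mathfrak a[x]:=\mathfrak a[x,x]$. For an operator function $T$: $\sigma(T)=\{\lambda:0\in\sigma(T(\lambda))\}$, $\rho(T)=\{\lambda:0\in\rho(T(\lambda))\}$, $\sigma_{ess}(T)=\{\lambda: T(\lambda)\text{ not Fredholm}\}$, $\sigma_{dis}(T)=\sigma(T)\setminus\sigma_{ess}(T)$. (A1) $T(\lambda)$ self-adjoint for each $\lambda$, with form $\mathfrak t(\lambda)$; (A2) $\mathrm{dom}\,\mathfrak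 t(\lambda)=:\mathcal D$ independent of $\lambda$; (A3) for each $x\in\mathcal D\setminus\{0\}$, $\lambda\mapsto\mathfrak t(\lambda)[x]$ is continuous, and if $\mathfrak t(\lambda_0)[x]=0$ then $\mathfrak t(\lambda)[x]>0$ for $\lambda<\lambda_0$ and $<0$ for $\lambda>\lambda_0$. *)

theory Defs
  imports "HOL-Analysis.Analysis"
begin

text \<open>
Setting. The (complex, separable or not) Hilbert space H is modelled as a real Hilbert
space 'a (class real_inner + complete_space) together with a complex structure J
(multiplication by the imaginary unit): J is linear, J (J x) = -x and J is orthogonal.
The complex inner product is inner x y + i * inner x (J y); its real part is the real
inner product. A (possibly unbounded) operator is a pair (D, A) of a domain and a map.
\<close>

type_synonym 'a op = "'a set \<times> ('a \<Rightarrow> 'a)"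

definition complex_structure :: "('a::real_inner \<Rightarrow> 'a) \<Rightarrow> bool" where
  "complex_structure J \<longleftrightarrow> linear J \<and> (\<forall>x. J (J x) = - x) \<and> (\<forall>x y. inner (J x) (J y) = inner x y)"

definition cspan :: "('a::real_vector \<Rightarrow> 'a) \<Rightarrow> 'a set \<Rightarrow> 'a set" where
  "cspan J S = span (S \<union> J ` S)"

definition cindep :: "('a::real_vector \<Rightarrow> 'a) \<Rightarrow> (nat \<Rightarrow> 'a) \<Rightarrow> nat \<Rightarrow> bool" where
  "cindep J u n \<longleftrightarrow> (\<forall>a b :: nat \<Rightarrow> real.
      (\<Sum>j<n. a j *\<^sub>R u j + b j *\<^sub>R J (u j)) = 0 \<longrightarrow> (\<forall>j<n. a j = 0 \<and> b j = 0))"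

definition cdim :: "('a::real_vector \<Rightarrow> 'a) \<Rightarrow> 'a set \<Rightarrow> nat" where
  "cdim J S = (LEAST k. \<exists>B. finite B \<and> card B = k \<and> cspan J B = S)"

definition fin_dim :: "'a::real_vector set \<Rightarrow> bool" where
  "fin_dim S \<longleftrightarrow> (\<exists>B. finite B \<and> span B = S)"

text \<open>Self-adjoint operator in the complex Hilbert space: complex linear, densely
defined (implied), and equal to its adjoint.\<close>
definition self_adjoint :: "('a::real_inner \<Rightarrow> 'a) \<Rightarrow> 'a op \<Rightarrow> bool" where
  "self_adjoint J T \<longleftrightarrow> (case T of (D, A) \<Rightarrow>
      subspace D \<and> (\<forall>x\<in>D. \<forall>y\<in>D. \<forall>c::real. A (x + c *\<^sub>R y) = A x + c *\<^sub>R A y)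
      \<and> (\<forall>x\<in>D. J x \<in> D \<and> A (J x) = J (A x))
      \<and> (\<forall>y z. (\<forall>x\<in>D. inner (A x) y = inner x z) \<longleftrightarrow> (y \<in> D \<and> z = A y)))"

definition op_ker :: "'a::real_vector op \<Rightarrow> 'a set" where
  "op_ker T = {x \<in> fst T. snd T x = 0}"

definition op_ran :: "'a::real_vector op \<Rightarrow> 'a set" where
  "op_ran T = snd T ` fst T"

definition orth_compl :: "'a::real_inner set \<Rightarrow> 'a set" where
  "orth_compl S = {y. \<forall>z\<in>S. inner z y = 0}"

definition zero_in_resolvent :: "'a::real_normed_vector op \<Rightarrow> bool" where
  "zero_in_resolvent T \<longleftrightarrow> bij_betw (snd T) (fst T) UNIV \<and>
      (\<exists>C. \<forall>x\<in>fst T. norm x \<le> C * norm (snd T x))"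

definition fredholm :: "'a::real_inner op \<Rightarrow> bool" where
  "fredholm T \<longleftrightarrow> fin_dim (op_ker T) \<and> closed (op_ran T) \<and> fin_dim (orth_compl (op_ran T))"

definition bounded_below :: "'a::real_inner op \<Rightarrow> bool" where
  "bounded_below T \<longleftrightarrow> (\<exists>c. \<forall>x\<in>fst T. inner (snd T x) x \<ge> c * (norm x)\<^sup>2)"

definition resolvent_i :: "('a::real_vector \<Rightarrow> 'a) \<Rightarrow> 'a op \<Rightarrow> 'a \<Rightarrow> 'a" where
  "resolvent_i J T y = (THE x. x \<in> fst T \<and> snd T x - J x = y)"

definition is_pvm :: "(real set \<Rightarrow> 'a::real_inner \<Rightarrow> 'a) \<Rightarrow> bool" where
  "is_pvm E \<longleftrightarrow>
     (\<forall>\<Delta>\<in>sets borel. bounded_linear (E \<Delta>) \<and> (\<forall>x. E \<Delta> (E \<Delta> x) = E \<Delta> x)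
         \<and> (\<forall>x y. inner (E \<Delta> x) y = inner x (E \<Delta> y)))
   \<and> E UNIV = id
   \<and> (\<forall>\<Delta>\<in>sets borel. \<forall>\<Delta>'\<in>sets borel. \<forall>x. E (\<Delta> \<inter> \<Delta>') x = E \<Delta> (E \<Delta>' x))
   \<and> (\<forall>F :: nat \<Rightarrow> real set. range F \<subseteq> sets borel \<longrightarrow> disjoint_family F \<longrightarrow>
         (\<forall>x. (\<lambda>n. E (F n) x) sums E (\<Union>(range F)) x))"

text \<open>The scalar measure  Delta |-> <E(Delta) x, x> = norm (E Delta x)^2.\<close>
definition spec_meas :: "(real set \<Rightarrow> 'a::real_normed_vector \<Rightarrow> 'a) \<Rightarrow> 'a \<Rightarrow> real measure" where
  "spec_meas E x = measure_of UNIV (sets borel) (\<lambda>\<Delta>. ennreal ((norm (E \<Delta> x))\<^sup>2))"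

text \<open>E is the spectral measure of T: T = integral of mu dE(mu). The domain is
{x. integral of mu^2 d<E x,x> finite}, and for x, y in the domain
Re <T x, y> = integral mu d Re<E(mu) x, y> (written via polarization); since the
domain is dense this determines T.\<close>
definition spectral_measure_of :: "'a::real_inner op \<Rightarrow> (real set \<Rightarrow> 'a \<Rightarrow> 'a) \<Rightarrow> bool" where
  "spectral_measure_of T E \<longleftrightarrow> is_pvm E
     \<and> fst T = {x. integrable (spec_meas E x) (\<lambda>\<mu>. \<mu>\<^sup>2)}
     \<and> (\<forall>x\<in>fst T. \<forall>y\<in>fst T. inner (snd T x) y =
          ((\<integral>\<mu>. \<mu> \<partial>spec_meas E (x + y)) - (\<integral>\<mu>. \<mu> \<partial>spec_meas E (x - y))) / 4)"

definition spec_subspace :: "(real set \<Rightarrow> 'a \<Rightarrow> 'a) \<Rightarrow> real set \<Rightarrow> 'a set" where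
  "spec_subspace E \<Delta> = range (E \<Delta>)"

text \<open>The form a[x] = integral mu d<E(mu)x,x> on dom |A|^{1/2}.\<close>
definition form_dom :: "(real set \<Rightarrow> 'a::real_normed_vector \<Rightarrow> 'a) \<Rightarrow> 'a set" where
  "form_dom E = {x. integrable (spec_meas E x) (\<lambda>\<mu>. \<mu>)}"

definition form_val :: "(real set \<Rightarrow> 'a::real_normed_vector \<Rightarrow> 'a) \<Rightarrow> 'a \<Rightarrow> real" where
  "form_val E x = (\<integral>\<mu>. \<mu> \<partial>spec_meas E x)"

definition direct_sum3_UNIV :: "'a::real_vector set \<Rightarrow> 'a set \<Rightarrow> 'a set \<Rightarrow> bool" where
  "direct_sum3_UNIV A B C \<longleftrightarrow> (\<forall>x. \<exists>a\<in>A. \<exists>b\<in>B. \<exists>c\<in>C. x = a + b + c)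
     \<and> (\<forall>a\<in>A. \<forall>b\<in>B. \<forall>c\<in>C. a + b + c = 0 \<longrightarrow> a = 0 \<and> b = 0 \<and> c = 0)"

end

theory Submission
  imports Defs
begin

text \<open>
  Write \<open>N\<^sub>l, Z\<^sub>l, P\<^sub>l\<close> for the negative, null and positive spectral subspaces of \<open>T l\<close> and \<open>t\<^sub>l\<close> for
  its form. By (A3) the cones \<open>t\<^sub>l[x] \<le> 0\<close> increase with \<open>l\<close>, and adding a vector of
  \<open>Z\<^sub>l\<close> to \<open>x\<close> does not change \<open>t\<^sub>l[x]\<close>, so \<open>N\<^sub>\<alpha> + span {u\<^sub>j | \<lambda>\<^sub>j \<le> l}\<close> is \<open>t\<^sub>l\<close>-nonpositive; this gives directness.

  For completeness one shows that this subspace together with \<open>P\<^sub>l\<close> is everything, moving \<open>l\<close> from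
  one eigenvalue to the next. The key is that \<open>N\<^sub>\<mu> + Z\<^sub>\<mu> + (Z\<^sub>\<mu>\<^sub>' + P\<^sub>\<mu>\<^sub>')\<close> is everything if \<open>(\<mu>, \<mu>')\<close> is
  free of spectrum. One moves down from \<open>\<mu>'\<close>. Steps to the left follow from norm resolvent continuity.
  That continuity does not control the spectral subspaces from the right, because spectrum of \<open>T l\<close>
  may a priori escape to minus infinity as \<open>l\<close> decreases to a limit; passing to the limit instead uses
  that a decreasing sequence of nonempty bounded closed convex sets in a Hilbert space has a common
  point.
  A maximal \<open>t\<^sub>l\<close>-nonpositive subspace can be exchanged for \<open>N\<^sub>l + Z\<^sub>l\<close> by a homotopy of graphs.
\<close>

subsection \<open>Hilbert space preliminaries\<close>

text \<open>\<open>range (E l {..<0})\<close> may be infinite dimensional, so dimensions cannot be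
  counted; completeness becomes surjectivity of a spectral projection restricted to a subspace,
  reached by successive approximation with halving residuals. Each \<open>T l\<close> supplies two
  constants: a lower bound \<open>- K l\<close> from semiboundedness and a gap \<open>g l\<close>
  around zero from the closed range, zero itself being possibly an eigenvalue. Neither is uniform in
  \<open>l\<close>, so the comparison of neighbouring operators uses only the constants of the fixed
  one. The other use of the Fredholm property is the finite-dimensional kernel: it gives the
  compactness that turns the strict sign in (A3) into a uniform inequality on a cone. The spectral
  measure is tied to \<open>T l\<close> only through quadratic forms, so operator bounds come from
  polarisation, and statements about the form domain from truncations to
  \<open>{- real n..real n}\<close>.\<close>

lemma norm_add_sqr_parallelogram:
  fixes x y :: "'a::real_inner"
  shows "(norm (x + y))\<^sup>2 + (norm (x - y))\<^sup>2 = 2 * (norm x)\<^sup>2 + 2 * (norm y)\<^sup>2"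
  by (simp add: power2_norm_eq_inner algebra_simps inner_commute)

text \<open>Stands in for weak compactness. Nearly shortest points form a Cauchy sequence: the
  minimal norms \<open>d k\<close> increase to a finite limit, and for \<open>k \<le> j\<close> the
  midpoint of \<open>x j\<close> and \<open>x k\<close> still lies in \<open>S k\<close>, so the
  parallelogram law bounds their distance.\<close>

lemma nested_closed_midconvex_nonempty:
  fixes S :: "nat \<Rightarrow> 'a::{real_inner, complete_space} set"
  assumes ne: "\<And>k. S k \<noteq> {}" and cl: "\<And>k. closed (S k)"
    and mid: "\<And>k x y. x \<in> S k \<Longrightarrow> y \<in> S k \<Longrightarrow> (1/2) *\<^sub>R (x + y) \<in> S k"
    and dec: "\<And>k. S (Suc k) \<subseteq> S k"
    and bdd: "\<And>x. x \<in> S 0 \<Longrightarrow> norm x \<le> B"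
  shows "\<exists>x. \<forall>k. x \<in> S k"
proof -
  define d where "d k = Inf (norm ` S k)" for k
  have anti: "S j \<subseteq> S k" if "k \<le> j" for j k
    using lift_Suc_antimono_le[of S, OF dec that] .
  have bb: "bdd_below (norm ` S k)" for k by (rule bdd_belowI[of _ 0]) auto
  have dle: "d k \<le> norm x" if "x \<in> S k" for k x
    unfolding d_def using that bb by (intro cInf_lower) auto
  have d0: "d k \<ge> 0" for k
    unfolding d_def using ne by (intro cInf_greatest) auto
  have dmono: "d k \<le> d j" if "k \<le> j" for k j
    unfolding d_def using that anti[OF that] ne bb by (intro cInf_superset_mono) auto
  have dB: "d k \<le> B" for k
  proof -
    obtain x where "x \<in> S k" using ne by blast
    then show ?thesis using dle[of x k] bdd[of x] anti[of 0 k] by fastforce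
  qed
  have "convergent d"
    by (rule Bseq_monoseq_convergent)
       (auto intro!: BseqI'[of _ B] simp: d0 dB monoseq_def dmono)
  then obtain L where L: "d \<longlonglongrightarrow> L" unfolding convergent_def by blast
  have "\<exists>x. x \<in> S k \<and> norm x < d k + inverse (real (Suc k))" for k
  proof -
    have "Inf (norm ` S k) < d k + inverse (real (Suc k))" unfolding d_def by simp
    then show ?thesis using ne[of k] cInf_lessD[of "norm ` S k"] by blast
  qed
  then obtain x where xS: "\<And>k. x k \<in> S k" and xn: "\<And>k. norm (x k) < d k + inverse (real (Suc k))"
    by metis
  have nx: "(\<lambda>k. norm (x k)) \<longlonglongrightarrow> L"
  proof (rule tendsto_sandwich[OF _ _ L])
    show "\<forall>\<^sub>F k in sequentially. d k \<le> norm (x k)" using dle[OF xS] by simp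
    show "\<forall>\<^sub>F k in sequentially. norm (x k) \<le> d k + inverse (real (Suc k))"
      using xn by (simp add: less_imp_le)
    show "(\<lambda>k. d k + inverse (real (Suc k))) \<longlonglongrightarrow> L"
      using tendsto_add[OF L LIMSEQ_inverse_real_of_nat] by simp
  qed
  have key: "(norm (x j - x k))\<^sup>2 \<le> 2 * (norm (x j))\<^sup>2 + 2 * (norm (x k))\<^sup>2 - 4 * (d k)\<^sup>2"
    if "k \<le> j" for j k
  proof -
    have "x j \<in> S k" using xS anti[OF that] by blast
    from dle[OF mid[OF this xS[of k]]] have "2 * d k \<le> norm (x j + x k)" by simp
    from power_mono[OF this, of 2] d0[of k] have "4 * (d k)\<^sup>2 \<le> (norm (x j + x k))\<^sup>2"
      by (simp add: power_mult_distrib)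
    with norm_add_sqr_parallelogram[of "x j" "x k"] show ?thesis by simp
  qed
  have "Cauchy x"
  proof (rule metric_CauchyI)
    fix e :: real assume e: "e > 0"
    \<comment> \<open>In \<open>key\<close> two errors enter with factor 2 and one with factor 4;
      eighths add up to exactly \<open>e\<^sup>2\<close>.\<close>
    have 1: "\<forall>\<^sub>F k in sequentially. \<bar>(norm (x k))\<^sup>2 - L\<^sup>2\<bar> < e\<^sup>2/8"
      using tendstoD[OF tendsto_power[OF nx, of 2], of "e\<^sup>2/8"] e by (simp add: dist_real_def)
    have 2: "\<forall>\<^sub>F k in sequentially. \<bar>(d k)\<^sup>2 - L\<^sup>2\<bar> < e\<^sup>2/8"
      using tendstoD[OF tendsto_power[OF L, of 2], of "e\<^sup>2/8"] e by (simp add: dist_real_def)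
    obtain M where M: "\<And>k. k \<ge> M \<Longrightarrow> \<bar>(norm (x k))\<^sup>2 - L\<^sup>2\<bar> < e\<^sup>2/8 \<and> \<bar>(d k)\<^sup>2 - L\<^sup>2\<bar> < e\<^sup>2/8"
      using eventually_conj[OF 1 2] unfolding eventually_sequentially by blast
    have half: "dist (x j) (x k) < e" if "k \<ge> M" "k \<le> j" for j k
    proof -
      have "(norm (x j - x k))\<^sup>2 < e\<^sup>2"
        using key[OF that(2)] M[of k] M[of j] that unfolding abs_less_iff by linarith
      then show ?thesis using e by (simp add: dist_norm power2_less_imp_less)
    qed
    show "\<exists>M. \<forall>m\<ge>M. \<forall>n\<ge>M. dist (x m) (x n) < e"
      using half by (metis dist_commute nle_le)
  qed
  then obtain l where l: "x \<longlonglongrightarrow> l" using Cauchy_convergent convergent_def by blast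
  have "l \<in> S k" for k
  proof (rule Lim_in_closed_set[OF cl _ _ l])
    show "\<forall>\<^sub>F j in sequentially. x j \<in> S k"
      using eventually_ge_at_top[of k] by eventually_elim (use xS anti in blast)
  qed simp
  then show ?thesis by blast
qed

lemma nonneg_quadratic_imp_linear_zero:
  fixes b c :: real
  assumes "\<And>r. 2 * r * b \<le> r\<^sup>2 * c" and "c \<ge> 0"
  shows "b = 0"
proof (rule ccontr)
  assume "b \<noteq> 0"
  \<comment> \<open>The divisor is \<open>c + 1\<close> since \<open>c\<close> may vanish; the test
    value \<open>r = q\<close> turns the hypothesis into
    \<open>q\<^sup>2 * (c + 2) \<le> 0\<close>.\<close>
  define q where "q = b / (c + 1)"
  have b: "b = q * (c + 1)" using assms(2) by (simp add: q_def)
  then have q: "q\<^sup>2 > 0" using \<open>b \<noteq> 0\<close> by auto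
  have "2 * q * (q * (c + 1)) \<le> q\<^sup>2 * c" using assms(1)[of q] b by simp
  then have "q\<^sup>2 * (c + 2) \<le> 0" by (simp add: power2_eq_square algebra_simps)
  then show False using q assms(2) by (simp add: mult_le_0_iff)
qed

text \<open>Minimising the semidefinite form of \<open>B\<close> at \<open>y - s\<close> over
  \<open>S\<close> gives the \<open>B\<close>-orthogonal projection of \<open>y\<close>; coercivity
  on \<open>S\<close> keeps the near-minimisers bounded. With \<open>B\<close> the identity this is
  the usual projection; in \<open>nonpos_extension\<close> it is minus the form of
  \<open>T l\<close> on its nonpositive subspace.\<close>

lemma coercive_projection:
  fixes B :: "'a::{real_inner, complete_space} \<Rightarrow> 'a"
  assumes B: "bounded_linear B" and sym: "\<And>x y. inner (B x) y = inner x (B y)"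
    and pos: "\<And>x. inner (B x) x \<ge> 0"
    and S: "subspace S" "closed S" and c: "c > 0" and coer: "\<And>s. s \<in> S \<Longrightarrow> c * (norm s)\<^sup>2 \<le> inner (B s) s"
  shows "\<exists>s\<in>S. \<forall>s'\<in>S. inner (B (y - s)) s' = 0"
proof -
  interpret B: bounded_linear B by fact
  define f where "f x = inner (B x) x" for x
  have f_add: "f (x + z) = f x + 2 * inner (B x) z + f z" for x z
    unfolding f_def by (simp add: B.add inner_add_left inner_add_right) (metis inner_commute sym)
  have f_scale: "f (r *\<^sub>R x) = r\<^sup>2 * f x" for r x
    unfolding f_def by (simp add: B.scaleR power2_eq_square)
  have par: "f (x + z) + f (x - z) = 2 * f x + 2 * f z" for x z
    using f_add[of x z] f_add[of x "-z"] f_scale[of "-1" z] by simp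
  have f0: "f x \<ge> 0" for x using pos by (simp add: f_def)
  define d where "d = Inf ((\<lambda>s. f (y - s)) ` S)"
  have bb: "bdd_below ((\<lambda>s. f (y - s)) ` S)" by (rule bdd_belowI[of _ 0]) (auto simp: f0)
  have neS: "S \<noteq> {}" using S(1) subspace_0 by blast
  have dle: "d \<le> f (y - s)" if "s \<in> S" for s unfolding d_def using bb that by (intro cInf_lower) auto
  define W where "W k = {s \<in> S. f (y - s) \<le> d + inverse (real (Suc k))}" for k
  have contf: "continuous_on UNIV (\<lambda>s. f (y - s))"
    unfolding f_def by (intro continuous_intros B.continuous_on)
  have "\<exists>s. \<forall>k. s \<in> W k"
  proof (rule nested_closed_midconvex_nonempty)
    show "W k \<noteq> {}" for k
    proof -
      have "Inf ((\<lambda>s. f (y - s)) ` S) < d + inverse (real (Suc k))" unfolding d_def by simp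
      then show ?thesis unfolding W_def using neS cInf_lessD[of "(\<lambda>s. f (y - s)) ` S"]
        by (smt (verit) Collect_empty_eq imageE image_is_empty)
    qed
    show "closed (W k)" for k
    proof -
      have "closed {s. f (y - s) \<le> d + inverse (real (Suc k))}"
        by (intro closed_Collect_le contf continuous_intros)
      moreover have "W k = S \<inter> {s. f (y - s) \<le> d + inverse (real (Suc k))}" by (auto simp: W_def)
      ultimately show ?thesis using S(2) by auto
    qed
    show "(1/2) *\<^sub>R (x + z) \<in> W k" if "x \<in> W k" "z \<in> W k" for k x z
    proof -
      have "y - (1/2) *\<^sub>R (x + z) = (1/2) *\<^sub>R ((y - x) + (y - z))"
        by (simp add: algebra_simps) (metis scaleR_half_double scaleR_right_distrib)
      then have "f (y - (1/2) *\<^sub>R (x + z)) = (1/4) * f ((y - x) + (y - z))"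
        by (simp only: f_scale) (simp add: power2_eq_square)
      also have "\<dots> \<le> (1/4) * (2 * f (y - x) + 2 * f (y - z))"
        using par[of "y - x" "y - z"] f0[of "(y - x) - (y - z)"] by simp
      also have "\<dots> \<le> d + inverse (real (Suc k))" using that by (simp add: W_def)
      finally show ?thesis using that S(1) unfolding W_def by (auto intro: subspace_scale subspace_add)
    qed
    show "W (Suc k) \<subseteq> W k" for k
    proof -
      have "inverse (real (Suc (Suc k))) \<le> inverse (real (Suc k))" by (intro le_imp_inverse_le) auto
      then show ?thesis unfolding W_def by (smt (verit) mem_Collect_eq subsetI)
    qed
    show "norm s \<le> sqrt ((2 * f y + 2 * (d + 1)) / c)" if "s \<in> W 0" for s
    proof -
      have "c * (norm s)\<^sup>2 \<le> f (y - (y - s))" using coer[of s] that by (simp add: W_def f_def)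
      also have "\<dots> \<le> 2 * f y + 2 * f (y - s)"
        using par[of y "y - s"] f0[of "y + (y - s)"] by simp
      also have "\<dots> \<le> 2 * f y + 2 * (d + 1)" using that by (simp add: W_def)
      finally have "(norm s)\<^sup>2 \<le> (2 * f y + 2 * (d + 1)) / c"
        using c by (simp add: field_simps)
      then show ?thesis by (rule real_le_rsqrt)
    qed
  qed
  then obtain s where s: "\<And>k. s \<in> W k" by blast
  have sS: "s \<in> S" using s[of 0] by (simp add: W_def)
  have fs: "f (y - s) \<le> d"
  proof (rule LIMSEQ_le_const)
    show "(\<lambda>k. d + inverse (real (Suc k))) \<longlonglongrightarrow> d"
      using tendsto_add[OF tendsto_const LIMSEQ_inverse_real_of_nat] by simp
    show "\<exists>N. \<forall>n\<ge>N. f (y - s) \<le> d + inverse (real (Suc n))" using s by (auto simp: W_def)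
  qed
  \<comment> \<open>First variation: moving from \<open>s\<close> in the direction \<open>s'\<close>
    cannot lower the minimum.\<close>
  have "inner (B (y - s)) s' = 0" if s': "s' \<in> S" for s'
  proof (rule nonneg_quadratic_imp_linear_zero)
    fix r :: real
    have "s + r *\<^sub>R s' \<in> S" using sS s' S(1) by (simp add: subspace_add subspace_scale)
    from dle[OF this] fs have "f (y - s) \<le> f ((y - s) + (- r) *\<^sub>R s')" by (simp add: algebra_simps)
    then show "2 * r * inner (B (y - s)) s' \<le> r\<^sup>2 * f s'"
      unfolding f_add f_scale by simp
  qed (rule f0)
  then show ?thesis using sS by blast
qed

lemma closed_subspace_orthogonal_witness:
  fixes S :: "'a::{real_inner, complete_space} set"
  assumes "subspace S" "closed S" "y \<notin> S"
  shows "\<exists>z. z \<noteq> 0 \<and> (\<forall>s\<in>S. inner z s = 0)"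
proof -
  have "\<exists>s\<in>S. \<forall>s'\<in>S. inner (y - s) s' = 0"
    by (rule coercive_projection[of "\<lambda>x. x" S 1, OF bounded_linear_ident])
       (use assms in \<open>auto simp: power2_norm_eq_inner\<close>)
  then show ?thesis using assms(3) by (metis eq_iff_diff_eq_0)
qed

text \<open>The library states summability tests for class \<open>banach\<close>, which the sort
  \<open>{real_inner, complete_space}\<close> does not imply.\<close>

lemma summable_norm_le_complete:
  fixes f :: "nat \<Rightarrow> 'a::{real_normed_vector, complete_space}"
  assumes g: "summable g" and le: "\<And>k. norm (f k) \<le> g k"
  shows "summable f"
proof -
  have ord: "dist (sum f {..<m}) (sum f {..<n}) \<le> dist (sum g {..<m}) (sum g {..<n})" if "m \<le> n" for m n
  proof -
    have "sum f {..<n} - sum f {..<m} = sum f {m..<n}" "sum g {..<n} - sum g {..<m} = sum g {m..<n}"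
      using sum_diff_nat_ivl[of 0 m n f] sum_diff_nat_ivl[of 0 m n g] that by (simp_all add: atLeast0LessThan)
    moreover have "norm (sum f {m..<n}) \<le> \<bar>sum g {m..<n}\<bar>" using sum_norm_le[of "{m..<n}" f g] le by fastforce
    ultimately show ?thesis unfolding dist_norm by (metis norm_minus_commute real_norm_def)
  qed
  have "dist (sum f {..<m}) (sum f {..<n}) \<le> dist (sum g {..<m}) (sum g {..<n})" for m n
    using ord[of m n] ord[of n m] by (metis dist_commute nle_le)
  moreover have "Cauchy (\<lambda>n. sum g {..<n})"
    using g by (intro convergent_Cauchy) (simp add: summable_iff_convergent)
  ultimately have "Cauchy (\<lambda>n. sum f {..<n})"
    unfolding Cauchy_def by (meson le_less_trans)
  then show ?thesis by (simp add: summable_iff_convergent Cauchy_convergent)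
qed

text \<open>Apply \<open>step\<close> again to each residual: it is halved and stays in
  \<open>Y\<close>, so the corrections are dominated by a geometric series, and their sum, which
  remains in the closed subspace \<open>N\<close>, is an exact preimage.\<close>

lemma approx_surj_imp_surj:
  fixes A :: "'a::{real_normed_vector, complete_space} \<Rightarrow> 'b::real_normed_vector"
  assumes A: "bounded_linear A" and N: "subspace N" "closed N"
    and step: "\<And>y. y \<in> Y \<Longrightarrow> \<exists>n\<in>N. norm n \<le> C * norm y \<and> y - A n \<in> Y \<and> norm (y - A n) \<le> norm y / 2"
    and y: "y \<in> Y"
  shows "\<exists>n\<in>N. A n = y"
proof -
  interpret A: bounded_linear A by fact
  obtain g where g: "\<And>y. y \<in> Y \<Longrightarrow> g y \<in> N \<and> norm (g y) \<le> C * norm y \<and> y - A (g y) \<in> Y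
      \<and> norm (y - A (g y)) \<le> norm y / 2"
    using step by metis
  define r where "r k = ((\<lambda>y. y - A (g y)) ^^ k) y" for k
  have r0: "r 0 = y" and rS: "r (Suc k) = r k - A (g (r k))" for k by (simp_all add: r_def)
  have rY: "r k \<in> Y" for k by (induction k) (use y g in \<open>auto simp: r0 rS\<close>)
  have rn: "norm (r k) \<le> norm y * (1/2) ^ k" for k
  proof (induction k)
    case (Suc k)
    then show ?case using g[OF rY[of k]] by (simp add: rS)
  qed (simp add: r0)
  have r_lim: "r \<longlonglongrightarrow> 0"
  proof (rule Lim_null_comparison)
    show "\<forall>\<^sub>F k in sequentially. norm (r k) \<le> norm y * (1/2) ^ k" using rn by simp
    show "(\<lambda>k. norm y * (1/2) ^ k) \<longlonglongrightarrow> 0"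
      using tendsto_mult[OF tendsto_const[of "norm y"] LIMSEQ_realpow_zero[of "1/2"]] by simp
  qed
  have gn: "norm (g (r k)) \<le> \<bar>C\<bar> * norm y * (1/2) ^ k" for k
  proof -
    have "norm (g (r k)) \<le> C * norm (r k)" using g[OF rY] by blast
    also have "\<dots> \<le> \<bar>C\<bar> * norm (r k)" by (intro mult_right_mono) auto
    also have "\<dots> \<le> \<bar>C\<bar> * (norm y * (1/2) ^ k)" using rn by (intro mult_left_mono) auto
    finally show ?thesis by (simp add: mult.assoc)
  qed
  have "summable (\<lambda>k. g (r k))"
    by (rule summable_norm_le_complete[of "\<lambda>k. \<bar>C\<bar> * norm y * (1/2) ^ k"])
       (use gn in \<open>auto intro!: summable_mult summable_geometric\<close>)
  then have sm: "(\<lambda>m. \<Sum>k<m. g (r k)) \<longlonglongrightarrow> (\<Sum>k. g (r k))" by (rule summable_LIMSEQ)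
  have part: "A (\<Sum>k<m. g (r k)) = y - r m" for m
    by (induction m) (simp_all add: r0 rS A.zero A.add)
  have "(\<lambda>m. A (\<Sum>k<m. g (r k))) \<longlonglongrightarrow> A (\<Sum>k. g (r k))" using sm by (rule A.tendsto)
  moreover have "(\<lambda>m. A (\<Sum>k<m. g (r k))) \<longlonglongrightarrow> y"
    unfolding part using tendsto_diff[OF tendsto_const r_lim] by simp
  ultimately have "A (\<Sum>k. g (r k)) = y" by (rule LIMSEQ_unique)
  moreover have "(\<Sum>k. g (r k)) \<in> N"
    by (rule Lim_in_closed_set[OF N(2) _ _ sm])
       (use g rY N(1) in \<open>auto intro!: subspace_sum always_eventually\<close>)
  ultimately show ?thesis by blast
qed

text \<open>Each generator contributes a compact segment, and Minkowski sums of compact sets are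
  compact.\<close>

lemma compact_coefficient_box:
  fixes C :: "'a::real_normed_vector set"
  assumes "finite C"
  shows "compact {\<Sum>c\<in>C. a c *\<^sub>R c | a. \<forall>c\<in>C. \<bar>a c\<bar> \<le> r}"
  using assms
proof (induction C rule: finite_induct)
  case empty
  then show ?case by simp
next
  case (insert v C)
  have "compact ((\<lambda>q. q *\<^sub>R v) ` {-r..r})"
    by (intro compact_continuous_image continuous_intros) auto
  from compact_sums[OF this insert.IH]
  have "compact {x + y |x y. x \<in> (\<lambda>q. q *\<^sub>R v) ` {-r..r} \<and> y \<in> {\<Sum>c\<in>C. a c *\<^sub>R c | a. \<forall>c\<in>C. \<bar>a c\<bar> \<le> r}}"
    (is "compact ?X") .
  also have "?X = {\<Sum>c\<in>insert v C. a c *\<^sub>R c | a. \<forall>c\<in>insert v C. \<bar>a c\<bar> \<le> r}" (is "_ = ?Y")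
  proof (intro subset_antisym subsetI)
    fix x assume "x \<in> ?X"
    then obtain q a where q: "q \<in> {-r..r}" "\<forall>c\<in>C. \<bar>a c\<bar> \<le> r" "x = q *\<^sub>R v + (\<Sum>c\<in>C. a c *\<^sub>R c)" by blast
    have "(\<Sum>c\<in>C. (a(v := q)) c *\<^sub>R c) = (\<Sum>c\<in>C. a c *\<^sub>R c)"
      using insert.hyps by (intro sum.cong) auto
    then have "x = (\<Sum>c\<in>insert v C. (a(v := q)) c *\<^sub>R c)" using insert.hyps q by simp
    moreover have "\<forall>c\<in>insert v C. \<bar>(a(v := q)) c\<bar> \<le> r" using q by (auto simp: abs_le_iff)
    ultimately show "x \<in> ?Y" by blast
  next
    fix x assume "x \<in> ?Y"
    then obtain a where a: "\<forall>c\<in>insert v C. \<bar>a c\<bar> \<le> r" "x = (\<Sum>c\<in>insert v C. a c *\<^sub>R c)" by blast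
    then have "x = a v *\<^sub>R v + (\<Sum>c\<in>C. a c *\<^sub>R c)" "a v \<in> {-r..r}" "\<forall>c\<in>C. \<bar>a c\<bar> \<le> r"
      using insert.hyps by (auto simp: abs_le_iff)
    then show "x \<in> ?X" by blast
  qed
  finally show ?case .
qed

lemma fin_dim_bounded_subseq:
  fixes Z :: "'a::real_inner set"
  assumes "fin_dim Z" "\<And>k. z k \<in> Z" "\<And>k. norm (z k) \<le> r"
  shows "\<exists>l f. strict_mono (f :: nat \<Rightarrow> nat) \<and> (z \<circ> f) \<longlonglongrightarrow> l"
proof -
  obtain B where B: "finite B" "span B = Z" using assms(1) by (auto simp: fin_dim_def)
  \<comment> \<open>Over an orthogonal generating set without zero, a coefficient is
    \<open>inner (z k) c\<close> divided by the square of \<open>norm c\<close>, so a norm bound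
    becomes a coefficient bound; \<open>m\<close> sums the individual bounds into one
    radius.\<close>
  obtain C0 where C0: "finite C0" "span C0 = Z" "pairwise orthogonal C0"
    using basis_orthogonal[OF B(1)] B(2) by metis
  define C where "C = C0 - {0}"
  have C: "finite C" "span C = Z" "pairwise orthogonal C" "0 \<notin> C"
    using C0 by (auto simp: C_def span_delete_0 intro: pairwise_subset)
  define m where "m = (\<Sum>c\<in>C. r / norm c)"
  have r0: "r \<ge> 0" using assms(3)[of 0] norm_ge_zero order_trans by blast
  let ?K = "{\<Sum>c\<in>C. a c *\<^sub>R c | a. \<forall>c\<in>C. \<bar>a c\<bar> \<le> m}"
  have "z k \<in> ?K" for k
  proof -
    obtain a where a: "z k = (\<Sum>c\<in>C. a c *\<^sub>R c)"
      using assms(2)[of k] C span_finite[OF C(1)] by auto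
    have "\<bar>a c\<bar> \<le> m" if c: "c \<in> C" for c
    proof -
      have "inner (z k) c = (\<Sum>b\<in>C. if b = c then a c * (norm c)\<^sup>2 else 0)"
        unfolding a inner_sum_left using C(3) c
        by (intro sum.cong) (auto simp: power2_norm_eq_inner pairwise_def orthogonal_def)
      then have "a c * (norm c)\<^sup>2 = inner (z k) c" using c C(1) by simp
      then have "\<bar>a c\<bar> * (norm c)\<^sup>2 \<le> norm (z k) * norm c"
        using Cauchy_Schwarz_ineq2[of "z k" c] by (metis abs_mult abs_of_nonneg zero_le_power2)
      also have "\<dots> \<le> r * norm c" using assms(3) by (simp add: mult_right_mono)
      finally have "\<bar>a c\<bar> \<le> r / norm c" using c C(4)
        by (cases "c = 0") (auto simp: field_simps power2_eq_square)
      also have "\<dots> \<le> m" unfolding m_def using c C(1) r0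
        by (intro member_le_sum) auto
      finally show ?thesis .
    qed
    then show ?thesis using a by blast
  qed
  then show ?thesis
    using compact_coefficient_box[OF C(1), of m] unfolding compact_def by blast
qed

subsection \<open>Projection-valued measures and their forms\<close>

locale pvm =
  fixes E :: "real set \<Rightarrow> 'a::real_inner \<Rightarrow> 'a"
  assumes pvm: "is_pvm E"
begin

lemma E_bounded_linear: "B \<in> sets borel \<Longrightarrow> bounded_linear (E B)"
  using pvm by (simp add: is_pvm_def)

lemma E_linear: "B \<in> sets borel \<Longrightarrow> linear (E B)"
  using E_bounded_linear by (rule bounded_linear.linear)

lemma E_idem: "B \<in> sets borel \<Longrightarrow> E B (E B x) = E B x"
  using pvm by (simp add: is_pvm_def)

lemma E_sym: "B \<in> sets borel \<Longrightarrow> inner (E B x) y = inner x (E B y)"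
  using pvm by (simp add: is_pvm_def)

lemma E_Int: "B \<in> sets borel \<Longrightarrow> C \<in> sets borel \<Longrightarrow> E B (E C x) = E (B \<inter> C) x"
  using pvm by (simp add: is_pvm_def)

lemma E_UNIV: "E UNIV x = x"
  using pvm by (simp add: is_pvm_def)

lemma E_sums:
  "range F \<subseteq> sets borel \<Longrightarrow> disjoint_family F \<Longrightarrow> (\<lambda>n. E (F n) x) sums E (\<Union>(range (F :: nat \<Rightarrow> _))) x"
  using pvm unfolding is_pvm_def by blast

lemma E_empty: "E {} x = 0"
proof -
  \<comment> \<open>A constant series converges only if its term is zero.\<close>
  have "summable (\<lambda>n::nat. E {} x)"
    using E_sums[of "\<lambda>_. {}" x] by (auto simp: disjoint_family_on_def sums_iff)
  then show ?thesis by (simp add: summable_const_iff)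
qed

lemma E_Un:
  assumes "B \<in> sets borel" "C \<in> sets borel" "B \<inter> C = {}"
  shows "E (B \<union> C) x = E B x + E C x"
proof -
  define F where "F n = (if n = 0 then B else if n = 1 then C else {})" for n :: nat
  have "B \<union> C = F 0 \<union> F 1" by (simp add: F_def)
  then have "\<Union>(range F) = B \<union> C" by (auto simp: F_def split: if_splits)
  moreover have "range F \<subseteq> sets borel" "disjoint_family F"
    using assms by (auto simp: disjoint_family_on_def F_def)
  ultimately have "(\<lambda>n. E (F n) x) sums E (B \<union> C) x" using E_sums[of F x] by simp
  moreover have "(\<lambda>n. E (F n) x) sums (\<Sum>n\<in>{0,1}. E (F n) x)"
    by (rule sums_finite) (auto simp: F_def E_empty)
  ultimately have "E (B \<union> C) x = (\<Sum>n\<in>{0,1}. E (F n) x)" by (rule sums_unique2)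
  then show ?thesis by (simp add: F_def)
qed

lemma E_Compl: "B \<in> sets borel \<Longrightarrow> E (- B) x = x - E B x"
  using E_Un[of B "- B" x] by (simp add: E_UNIV algebra_simps)

lemma E_mono: "B \<in> sets borel \<Longrightarrow> C \<in> sets borel \<Longrightarrow> B \<subseteq> C \<Longrightarrow> E B x = x \<Longrightarrow> E C x = x"
  using E_Int[of C B x] by (simp add: inf.absorb2)

lemma E_null_subset: "B \<in> sets borel \<Longrightarrow> C \<in> sets borel \<Longrightarrow> B \<subseteq> C \<Longrightarrow> E C x = 0 \<Longrightarrow> E B x = 0"
  using E_Int[of B C x] linear_0[OF E_linear[of B]] by (simp add: inf.absorb1)

lemma E_inner_self: "B \<in> sets borel \<Longrightarrow> inner (E B x) x = (norm (E B x))\<^sup>2"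
  using E_sym[of B "E B x" x] by (simp add: E_idem power2_norm_eq_inner)

lemma E_orth: "B \<in> sets borel \<Longrightarrow> C \<in> sets borel \<Longrightarrow> B \<inter> C = {} \<Longrightarrow> inner (E B x) (E C y) = 0"
  by (simp add: E_sym E_Int E_empty)

lemma norm_E_Un:
  assumes "B \<in> sets borel" "C \<in> sets borel" "B \<inter> C = {}"
  shows "(norm (E (B \<union> C) x))\<^sup>2 = (norm (E B x))\<^sup>2 + (norm (E C x))\<^sup>2"
  using E_orth[OF assms, of x x] by (simp add: E_Un assms power2_norm_eq_inner inner_add_left inner_add_right inner_commute[of "E C x" "E B x"])

lemma norm_E_split: "B \<in> sets borel \<Longrightarrow> (norm x)\<^sup>2 = (norm (E B x))\<^sup>2 + (norm (E (- B) x))\<^sup>2"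
  using norm_E_Un[of B "- B" x] by (simp add: E_UNIV)

lemma norm_E_le: "B \<in> sets borel \<Longrightarrow> norm (E B x) \<le> norm x"
  by (rule power2_le_imp_le) (use norm_E_split[of B x] in auto)

lemma subspace_range_E: "B \<in> sets borel \<Longrightarrow> subspace (range (E B))"
  by (simp add: E_linear linear_subspace_image)

lemma range_E_iff: "B \<in> sets borel \<Longrightarrow> x \<in> range (E B) \<longleftrightarrow> E B x = x"
  using E_idem[of B] by (auto intro: range_eqI[of x "E B" x])

lemma closed_range_E: "B \<in> sets borel \<Longrightarrow> closed (range (E B))"
proof -
  assume B: "B \<in> sets borel"
  have "range (E B) = {x. E B x = x}" using range_E_iff[OF B] by blast
  moreover have "closed {x. E B x = x}"
    by (intro closed_Collect_eq continuous_intros linear_continuous_on E_bounded_linear B)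
  ultimately show ?thesis by simp
qed

lemma sets_spec_meas [measurable_cong, simp]: "sets (spec_meas E x) = sets borel"
  using sets.sets_measure_of_eq[of "borel :: real measure"] by (simp add: spec_meas_def)

lemma space_spec_meas [simp]: "space (spec_meas E x) = UNIV"
  by (simp add: spec_meas_def)

lemma emeasure_spec_meas:
  assumes "B \<in> sets borel"
  shows "emeasure (spec_meas E x) B = ennreal ((norm (E B x))\<^sup>2)"
  unfolding spec_meas_def
proof (rule emeasure_measure_of_sigma)
  show "sigma_algebra UNIV (sets (borel :: real measure))"
    using sets.sigma_algebra_axioms[of "borel :: real measure"] by simp
  show "positive (sets borel) (\<lambda>B. ennreal ((norm (E B x))\<^sup>2))"
    by (simp add: positive_def E_empty)
  show "countably_additive (sets borel) (\<lambda>B. ennreal ((norm (E B x))\<^sup>2))"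
  proof (rule countably_additiveI)
    fix F :: "nat \<Rightarrow> real set"
    assume F: "range F \<subseteq> sets borel" "disjoint_family F" "\<Union>(range F) \<in> sets borel"
    have "(\<lambda>n. inner (E (F n) x) x) sums inner (E (\<Union>(range F)) x) x"
      using E_sums[OF F(1,2)] by (rule bounded_linear.sums[OF bounded_linear_inner_left])
    then have "(\<lambda>n. (norm (E (F n) x))\<^sup>2) sums (norm (E (\<Union>(range F)) x))\<^sup>2"
      using F(1,3) by (simp add: E_inner_self subset_eq)
    then show "(\<Sum>i. ennreal ((norm (E (F i) x))\<^sup>2)) = ennreal ((norm (E (\<Union>(range F)) x))\<^sup>2)"
      by (intro suminf_ennreal_eq) auto
  qed
qed fact

lemma finite_measure_spec_meas: "finite_measure (spec_meas E x)"
  by (rule finite_measureI) (simp add: emeasure_spec_meas)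

lemma measure_spec_meas: "B \<in> sets borel \<Longrightarrow> measure (spec_meas E x) B = (norm (E B x))\<^sup>2"
  by (simp add: measure_def emeasure_spec_meas)

text \<open>Passing to \<open>E B x\<close> cuts the scalar measure off outside \<open>B\<close>;
  the splitting of forms thereby reduces to integrals against one measure, that of
  \<open>x\<close>.\<close>

lemma spec_meas_E:
  assumes B: "B \<in> sets borel"
  shows "spec_meas E (E B x) = density (spec_meas E x) (\<lambda>s. ennreal (indicator B s))"
proof (rule measure_eqI)
  fix C assume "C \<in> sets (spec_meas E (E B x))"
  then have C: "C \<in> sets borel" by simp
  have "emeasure (density (spec_meas E x) (\<lambda>s. ennreal (indicator B s))) C
      = (\<integral>\<^sup>+s. indicator (C \<inter> B) s \<partial>spec_meas E x)"
    using B C by (subst emeasure_density) (auto intro!: nn_integral_cong simp: indicator_def simp del: nn_integral_indicator nn_integral_indicator')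
  also have "\<dots> = emeasure (spec_meas E x) (C \<inter> B)" using B C by (intro nn_integral_indicator) auto
  finally show "emeasure (spec_meas E (E B x)) C
      = emeasure (density (spec_meas E x) (\<lambda>s. ennreal (indicator B s))) C"
    using B C by (simp add: emeasure_spec_meas E_Int)
qed simp

lemma integrable_spec_meas_E:
  fixes f :: "real \<Rightarrow> real"
  assumes [measurable]: "B \<in> sets borel" "f \<in> borel_measurable borel"
  shows "integrable (spec_meas E (E B x)) f \<longleftrightarrow> integrable (spec_meas E x) (\<lambda>s. indicator B s * f s)"
  unfolding spec_meas_E[OF assms(1)] by (subst integrable_density) auto

lemma integral_spec_meas_E:
  fixes f :: "real \<Rightarrow> real"
  assumes [measurable]: "B \<in> sets borel" "f \<in> borel_measurable borel"
  shows "(\<integral>s. f s \<partial>spec_meas E (E B x)) = (\<integral>s. indicator B s * f s \<partial>spec_meas E x)"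
  unfolding spec_meas_E[OF assms(1)] by (subst integral_density) auto

lemma spec_meas_scaleR:
  "spec_meas E (c *\<^sub>R x) = density (spec_meas E x) (\<lambda>s. ennreal (c\<^sup>2))"
proof (rule measure_eqI)
  fix B assume "B \<in> sets (spec_meas E (c *\<^sub>R x))"
  then have B: "B \<in> sets borel" by simp
  then show "emeasure (spec_meas E (c *\<^sub>R x)) B = emeasure (density (spec_meas E x) (\<lambda>s. ennreal (c\<^sup>2))) B"
    by (subst emeasure_density_const)
       (auto simp: emeasure_spec_meas linear_scale[OF E_linear[OF B]] power_mult_distrib ennreal_mult)
qed simp

lemma form_val_scaleR: "form_val E (c *\<^sub>R x) = c\<^sup>2 * form_val E x"
  unfolding form_val_def spec_meas_scaleR by (subst integral_density) auto

lemma form_dom_scaleR: "x \<in> form_dom E \<Longrightarrow> c *\<^sub>R x \<in> form_dom E"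
  unfolding form_dom_def spec_meas_scaleR mem_Collect_eq by (subst integrable_density) auto

lemma form_val_uminus: "form_val E (- x) = form_val E x"
  using form_val_scaleR[of "-1" x] by simp

lemma form_val_0: "form_val E 0 = 0"
  using form_val_scaleR[of 0 0] by simp

lemma integrable_spec_meas_E_I:
  fixes f :: "real \<Rightarrow> real"
  assumes B: "B \<in> sets borel" and f: "f \<in> borel_measurable borel" and int: "integrable (spec_meas E x) f"
  shows "integrable (spec_meas E (E B x)) f"
proof -
  have "integrable (spec_meas E x) (\<lambda>s. indicator B s *\<^sub>R f s)"
    by (rule integrable_mult_indicator[OF _ int]) (use B in simp)
  then show ?thesis unfolding integrable_spec_meas_E[OF B f] by (simp only: real_scaleR_def)
qed

lemma form_dom_E:
  assumes "B \<in> sets borel" "x \<in> form_dom E"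
  shows "E B x \<in> form_dom E"
proof -
  have "integrable (spec_meas E (E B x)) (\<lambda>s. s)"
  proof (rule integrable_spec_meas_E_I[OF assms(1)])
    show "integrable (spec_meas E x) (\<lambda>s. s)" using assms(2) by (simp only: form_dom_def mem_Collect_eq)
  qed measurable
  then show ?thesis by (simp only: form_dom_def mem_Collect_eq)
qed

lemma form_val_split:
  assumes B: "B \<in> sets borel" and x: "x \<in> form_dom E"
  shows "form_val E x = form_val E (E B x) + form_val E (E (- B) x)"
proof -
  have int: "integrable (spec_meas E x) (\<lambda>s. indicator C s * s)" if "C \<in> sets borel" for C
    using integrable_mult_indicator[of C "spec_meas E x" "\<lambda>s. s"] x that by (auto simp: form_dom_def)
  have mB: "- B \<in> sets borel" using B by simp
  have "form_val E (E B x) + form_val E (E (- B) x)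
      = (\<integral>s. indicator B s * s \<partial>spec_meas E x) + (\<integral>s. indicator (- B) s * s \<partial>spec_meas E x)"
    unfolding form_val_def using integral_spec_meas_E[OF B, of "\<lambda>s. s"] integral_spec_meas_E[OF mB, of "\<lambda>s. s"] by simp
  also have "\<dots> = (\<integral>s. indicator B s * s + indicator (- B) s * s \<partial>spec_meas E x)"
    using int[OF B] int[OF mB] by simp
  also have "\<dots> = form_val E x" unfolding form_val_def
    by (intro Bochner_Integration.integral_cong) (auto split: split_indicator)
  finally show ?thesis by simp
qed

lemma AE_spec_meas:
  assumes "B \<in> sets borel" "E B x = x"
  shows "AE s in spec_meas E x. s \<in> B"
proof (rule AE_I)
  show "{s \<in> space (spec_meas E x). s \<notin> B} \<subseteq> - B" by auto
  show "emeasure (spec_meas E x) (- B) = 0" using assms by (subst emeasure_spec_meas) (auto simp: E_Compl)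
qed (use assms in auto)

lemma form_val_ge:
  assumes B: "B \<in> sets borel" "E B x = x" "B \<subseteq> {a..}" and x: "x \<in> form_dom E"
  shows "a * (norm x)\<^sup>2 \<le> form_val E x"
proof -
  interpret finite_measure "spec_meas E x" by (rule finite_measure_spec_meas)
  have "(\<integral>s. a \<partial>spec_meas E x) \<le> (\<integral>s. s \<partial>spec_meas E x)"
    by (rule integral_mono_AE) (use AE_spec_meas[OF B(1,2)] x B(3) in \<open>auto simp: form_dom_def\<close>)
  then show ?thesis by (simp add: form_val_def measure_spec_meas E_UNIV mult.commute)
qed

lemma form_val_le:
  assumes B: "B \<in> sets borel" "E B x = x" "B \<subseteq> {..a}" and x: "x \<in> form_dom E"
  shows "form_val E x \<le> a * (norm x)\<^sup>2"
proof -
  interpret finite_measure "spec_meas E x" by (rule finite_measure_spec_meas)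
  have "(\<integral>s. s \<partial>spec_meas E x) \<le> (\<integral>s. a \<partial>spec_meas E x)"
    by (rule integral_mono_AE) (use AE_spec_meas[OF B(1,2)] x B(3) in \<open>auto simp: form_dom_def\<close>)
  then show ?thesis by (simp add: form_val_def measure_spec_meas E_UNIV mult.commute)
qed

lemma integrable_sqr_bounded:
  assumes B: "B \<in> sets borel" "E B x = x" "B \<subseteq> {-r..r}"
  shows "integrable (spec_meas E x) (\<lambda>s. s\<^sup>2)"
proof -
  interpret finite_measure "spec_meas E x" by (rule finite_measure_spec_meas)
  show ?thesis
  proof (rule integrable_const_bound[where B = "r\<^sup>2"])
    show "AE s in spec_meas E x. norm (s\<^sup>2) \<le> r\<^sup>2"
      using AE_spec_meas[OF B(1,2)]
      by eventually_elim (use B(3) in \<open>auto simp: abs_le_square_iff[symmetric] abs_le_iff\<close>)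
  qed simp
qed

text \<open>Continuity from above of the finite measure \<open>spec_meas E x\<close>. For a
  self-adjoint operator the truncations lie in the operator domain, and identities proved there are
  carried to the form domain along them.\<close>

lemma E_trunc_tendsto: "(\<lambda>n. E {- real n..real n} x) \<longlonglongrightarrow> x"
proof -
  interpret finite_measure "spec_meas E x" by (rule finite_measure_spec_meas)
  have "(\<lambda>n. measure (spec_meas E x) (- {- real n..real n})) \<longlonglongrightarrow> measure (spec_meas E x) (\<Inter>n. - {- real n..real n})"
    by (rule finite_Lim_measure_decseq) (auto simp: decseq_def)
  moreover have "(\<Inter>n. - {- real n..real n}) = {}"
  proof -
    have "\<exists>n. s \<in> {- real n..real n}" for s
      using real_arch_simple[of "\<bar>s\<bar>"] by (simp add: abs_le_iff) (meson minus_le_iff)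
    then show ?thesis by (metis (no_types, lifting) ComplD INT_E UNIV_I equals0I)
  qed
  ultimately have "(\<lambda>n. (norm (x - E {- real n..real n} x))\<^sup>2) \<longlonglongrightarrow> 0"
    by (simp add: measure_spec_meas E_Compl)
  then have "(\<lambda>n. sqrt ((norm (x - E {- real n..real n} x))\<^sup>2)) \<longlonglongrightarrow> sqrt 0" by (rule tendsto_real_sqrt)
  then have "(\<lambda>n. x - E {- real n..real n} x) \<longlonglongrightarrow> 0" by (simp add: tendsto_norm_zero_iff)
  from tendsto_diff[OF tendsto_const[of x] this] show ?thesis by simp
qed

lemma form_val_trunc_tendsto:
  assumes x: "x \<in> form_dom E"
  shows "(\<lambda>n. form_val E (E {- real n..real n} x)) \<longlonglongrightarrow> form_val E x"
proof -
  have "(\<lambda>n. \<integral>s. indicator {- real n..real n} s * s \<partial>spec_meas E x) \<longlonglongrightarrow> (\<integral>s. s \<partial>spec_meas E x)"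
  proof (rule integral_dominated_convergence[where w = "\<lambda>s. \<bar>s\<bar>"])
    show "integrable (spec_meas E x) abs" using x by (auto simp: form_dom_def)
    show "AE s in spec_meas E x. (\<lambda>n. indicator {- real n..real n} s * s) \<longlonglongrightarrow> s"
    proof (rule AE_I2)
      fix s :: real
      obtain m where "\<bar>s\<bar> \<le> real m" using real_arch_simple by blast
      then have "\<forall>\<^sub>F n in sequentially. indicator {- real n..real n} s * s = s"
        by (intro eventually_sequentiallyI[of m]) (auto simp: indicator_def)
      then show "(\<lambda>n. indicator {- real n..real n} s * s) \<longlonglongrightarrow> s" by (rule tendsto_eventually)
    qed
  qed (auto split: split_indicator)
  then show ?thesis unfolding form_val_def by (simp add: integral_spec_meas_E)
qed

end

subsection \<open>Self-adjoint operators with a spectral measure\<close>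

locale spectral_op =
  fixes J :: "'a::{real_inner, complete_space} \<Rightarrow> 'a" and T :: "'a op"
    and E :: "real set \<Rightarrow> 'a \<Rightarrow> 'a"
  assumes J: "complex_structure J" and sa: "self_adjoint J T" and sp: "spectral_measure_of T E"

sublocale spectral_op \<subseteq> pvm E
  by unfold_locales (use sp in \<open>simp add: spectral_measure_of_def\<close>)

context spectral_op
begin

abbreviation "Dom \<equiv> fst T"
abbreviation "A \<equiv> snd T"

lemma self_adjointD:
  "subspace Dom" "x \<in> Dom \<Longrightarrow> y \<in> Dom \<Longrightarrow> A (x + c *\<^sub>R y) = A x + c *\<^sub>R A y"
  "x \<in> Dom \<Longrightarrow> J x \<in> Dom" "x \<in> Dom \<Longrightarrow> A (J x) = J (A x)"
  "(\<forall>x\<in>Dom. inner (A x) y = inner x z) \<longleftrightarrow> y \<in> Dom \<and> z = A y"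
  using sa by (auto simp: self_adjoint_def case_prod_beta)

lemmas subspace_dom = self_adjointD(1)

lemma dom_add: "x \<in> Dom \<Longrightarrow> y \<in> Dom \<Longrightarrow> x + y \<in> Dom"
  and dom_diff: "x \<in> Dom \<Longrightarrow> y \<in> Dom \<Longrightarrow> x - y \<in> Dom"
  and dom_scaleR: "x \<in> Dom \<Longrightarrow> c *\<^sub>R x \<in> Dom"
  and dom_0: "0 \<in> Dom"
  using subspace_dom by (auto intro: subspace_add subspace_diff subspace_scale subspace_0)

lemma A_add: "x \<in> Dom \<Longrightarrow> y \<in> Dom \<Longrightarrow> A (x + y) = A x + A y"
  using self_adjointD(2)[of x y 1] by simp

lemma A_0: "A 0 = 0"
  using self_adjointD(2)[of 0 0 1] dom_0 by simp

lemma A_scaleR: "x \<in> Dom \<Longrightarrow> A (c *\<^sub>R x) = c *\<^sub>R A x"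
  using self_adjointD(2)[of 0 x c] dom_0 A_0 by simp

lemma A_diff: "x \<in> Dom \<Longrightarrow> y \<in> Dom \<Longrightarrow> A (x - y) = A x - A y"
  using self_adjointD(2)[of x y "-1"] by simp

lemma A_sym: "x \<in> Dom \<Longrightarrow> y \<in> Dom \<Longrightarrow> inner (A x) y = inner x (A y)"
  using self_adjointD(5)[of y "A y"] by blast

lemma A_adjoint:
  assumes "\<And>x. x \<in> Dom \<Longrightarrow> inner (A x) y = inner x z"
  shows "y \<in> Dom" "A y = z"
  using self_adjointD(5)[of y z] assms by auto

text \<open>A vector \<open>z\<close> orthogonal to the domain satisfies the adjoint relation for
  the pair \<open>0\<close>, \<open>z\<close>, so self-adjointness itself gives
  \<open>A 0 = z\<close>.\<close>

lemma dom_dense: "(\<And>x. x \<in> Dom \<Longrightarrow> inner x z = 0) \<Longrightarrow> z = 0"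
  using A_adjoint(2)[of 0 z] A_0 by simp

lemma eq_by_dense: "(\<And>x. x \<in> Dom \<Longrightarrow> inner y x = inner z x) \<Longrightarrow> y = z"
  using dom_dense[of "y - z"] by (simp add: inner_diff_right inner_commute)

lemma dom_iff: "x \<in> Dom \<longleftrightarrow> integrable (spec_meas E x) (\<lambda>s. s\<^sup>2)"
  using sp by (simp add: spectral_measure_of_def)

lemma dom_subset_form_dom: "x \<in> Dom \<Longrightarrow> x \<in> form_dom E"
proof -
  assume x: "x \<in> Dom"
  interpret finite_measure "spec_meas E x" by (rule finite_measure_spec_meas)
  have "integrable (spec_meas E x) (\<lambda>s. 1 + s\<^sup>2)" using x by (auto simp: dom_iff)
  then show ?thesis unfolding form_dom_def mem_Collect_eq
  proof (rule Bochner_Integration.integrable_bound)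
    show "AE s in spec_meas E x. norm s \<le> norm (1 + s\<^sup>2)"
    proof (rule AE_I2)
      fix s :: real
      have "0 \<le> (\<bar>s\<bar> - 1)\<^sup>2" "(\<bar>s\<bar>)\<^sup>2 = s\<^sup>2" "0 \<le> s\<^sup>2" by simp_all
      then show "norm s \<le> norm (1 + s\<^sup>2)" by (simp add: power2_diff)
    qed
  qed simp
qed

lemma inner_A_polar:
  "x \<in> Dom \<Longrightarrow> y \<in> Dom \<Longrightarrow> inner (A x) y = (form_val E (x + y) - form_val E (x - y)) / 4"
  using sp by (simp add: spectral_measure_of_def form_val_def)

lemma form_val_dom: "x \<in> Dom \<Longrightarrow> form_val E x = inner (A x) x"
  using inner_A_polar[of x x] form_val_scaleR[of 2 x] by (simp add: form_val_0 scaleR_2)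

lemma dom_bounded: "B \<in> sets borel \<Longrightarrow> B \<subseteq> {-r..r} \<Longrightarrow> E B x \<in> Dom"
  unfolding dom_iff by (rule integrable_sqr_bounded[of B _ r]) (auto simp: E_idem)

lemma dom_E:
  assumes "B \<in> sets borel" "x \<in> Dom"
  shows "E B x \<in> Dom"
  unfolding dom_iff
proof (rule integrable_spec_meas_E_I[OF assms(1)])
  show "integrable (spec_meas E x) (\<lambda>s. s\<^sup>2)" using assms(2) by (simp only: dom_iff)
qed measurable

text \<open>Only forms relate \<open>A\<close> to \<open>E\<close>, so commutation goes through
  polarisation: \<open>E B x + y\<close> and \<open>E B x - y\<close> split into a \<open>B\<close>
  part, whose form is symmetric in \<open>x\<close> and \<open>y\<close>, and parts with the form of
  \<open>E (- B) y\<close>, which cancel. Hence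
  \<open>inner (A (E B x)) y = inner (A (E B y)) x\<close>, and symmetry of \<open>A\<close>
  finishes.\<close>

lemma A_E:
  assumes B: "B \<in> sets borel" and x: "x \<in> Dom"
  shows "A (E B x) = E B (A x)"
proof (rule eq_by_dense)
  fix y assume y: "y \<in> Dom"
  have mB: "- B \<in> sets borel" using B by simp
  note lin = linear_add[OF E_linear] linear_diff[OF E_linear]
  have z: "E (- B) (E B z) = 0" for z using B mB by (simp add: E_Int E_empty)
  have split1: "form_val E (E B v + w) = form_val E (E B (v + w)) + form_val E (E (- B) w)"
    if "v \<in> Dom" "w \<in> Dom" for v w
    using form_val_split[OF B, of "E B v + w"] that dom_subset_form_dom[OF dom_add[OF dom_E[OF B]]]
    by (simp add: lin B mB E_idem z)
  have split2: "form_val E (E B v - w) = form_val E (E B (v - w)) + form_val E (E (- B) w)"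
    if "v \<in> Dom" "w \<in> Dom" for v w
    using form_val_split[OF B, of "E B v - w"] that dom_subset_form_dom[OF dom_diff[OF dom_E[OF B]]]
    by (simp add: lin B mB E_idem z form_val_uminus)
  have c: "E B (y + x) = E B (x + y)" "form_val E (E B (y - x)) = form_val E (E B (x - y))"
    using form_val_uminus[of "E B (x - y)"] by (simp_all add: lin B add.commute)
  have "inner (A (E B x)) y = (form_val E (E B (x + y)) - form_val E (E B (x - y))) / 4"
    unfolding inner_A_polar[OF dom_E[OF B x] y] split1[OF x y] split2[OF x y] by simp
  moreover have "inner (A (E B y)) x = (form_val E (E B (x + y)) - form_val E (E B (x - y))) / 4"
    unfolding inner_A_polar[OF dom_E[OF B y] x] split1[OF y x] split2[OF y x] c by simp
  ultimately have "inner (A (E B x)) y = inner (A (E B y)) x" by simp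
  also have "\<dots> = inner (E B (A x)) y"
    using A_sym[OF dom_E[OF B y] x] B by (simp add: inner_commute E_sym)
  finally show "inner (A (E B x)) y = inner (E B (A x)) y" .
qed

lemma A_range_E: "B \<in> sets borel \<Longrightarrow> x \<in> Dom \<Longrightarrow> E B x = x \<Longrightarrow> E B (A x) = A x"
  using A_E[of B x] by simp

text \<open>The norm of a symmetric operator is read off its quadratic form: on the window the form
  of \<open>A - a\<close> is at most \<open>r * (norm v)\<^sup>2\<close> in modulus; polarise, and
  test against the multiple of \<open>A x - a *\<^sub>R x\<close> that has the norm of
  \<open>x\<close>.\<close>

lemma norm_A_shift_le:
  assumes B: "B \<in> sets borel" "B \<subseteq> {a - r..a + r}" and x: "E B x = x"
  shows "norm (A x - a *\<^sub>R x) \<le> r * norm x"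
\<comment> \<open>A negative \<open>r\<close> forces \<open>B = {}\<close> and so
  \<open>x = 0\<close>. Splitting off these cases gives \<open>r \<ge> 0\<close> and a nonzero
  divisor for \<open>q\<close>.\<close>
proof (cases "A x - a *\<^sub>R x = 0 \<or> B = {}")
  case True
  then show ?thesis
  proof
    assume z: "A x - a *\<^sub>R x = 0"
    show ?thesis
    proof (cases "r \<ge> 0")
      case False
      then have "B = {}" using B(2) by auto
      then show ?thesis using x by (simp add: E_empty A_0)
    qed (simp add: z)
  next
    assume "B = {}"
    then show ?thesis using x by (simp add: E_empty A_0)
  qed
next
  case False
  then have r: "r \<ge> 0" using B(2) by fastforce
  have Dom: "v \<in> Dom" if "E B v = v" for v
    using dom_bounded[OF B(1), of "\<bar>a\<bar> + r" v] B(2) that by (force simp: abs_if split: if_splits)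
  define S where "S v = A v - a *\<^sub>R v" for v
  have S_form: "\<bar>inner (S v) v\<bar> \<le> r * (norm v)\<^sup>2" if v: "E B v = v" for v
  proof -
    have "(a - r) * (norm v)\<^sup>2 \<le> form_val E v" "form_val E v \<le> (a + r) * (norm v)\<^sup>2"
      using B v dom_subset_form_dom[OF Dom[OF v]] by (auto intro!: form_val_ge form_val_le)
    then show ?thesis using form_val_dom[OF Dom[OF v]]
      by (simp add: S_def inner_diff_left power2_norm_eq_inner algebra_simps abs_le_iff)
  qed
  have polar: "2 * inner (S v) w \<le> r * ((norm v)\<^sup>2 + (norm w)\<^sup>2)" if v: "E B v = v" and w: "E B w = w" for v w
  proof -
    have vw: "E B (v + w) = v + w" "E B (v - w) = v - w"
      using v w by (simp_all add: linear_add linear_diff E_linear B)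
    have "4 * inner (S v) w = inner (S (v + w)) (v + w) - inner (S (v - w)) (v - w)"
      using A_sym[OF Dom[OF v] Dom[OF w]] inner_commute[of v w] inner_commute[of v "A w"]
      by (simp add: S_def A_add A_diff Dom v w inner_add_left inner_add_right inner_diff_left inner_diff_right algebra_simps)
    also have "\<dots> \<le> r * (norm (v + w))\<^sup>2 + r * (norm (v - w))\<^sup>2"
      using S_form[OF vw(1)] S_form[OF vw(2)] by (simp add: abs_le_iff)
    also have "\<dots> = r * (2 * (norm v)\<^sup>2 + 2 * (norm w)\<^sup>2)"
      unfolding distrib_left[symmetric] norm_add_sqr_parallelogram ..
    finally show ?thesis by (simp add: algebra_simps)
  qed
  have Sx: "E B (S x) = S x"
    using A_range_E[OF B(1) Dom[OF x] x] x by (simp add: S_def linear_diff linear_scale E_linear B)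
  have nz: "norm (S x) > 0" using False by (simp add: S_def)
  define q where "q = norm x / norm (S x)"
  have 1: "2 * inner (S x) (q *\<^sub>R S x) \<le> r * ((norm x)\<^sup>2 + (norm (q *\<^sub>R S x))\<^sup>2)"
    by (rule polar[OF x]) (simp add: linear_scale E_linear B Sx)
  have 2: "inner (S x) (q *\<^sub>R S x) = norm x * norm (S x)"
    using nz by (simp add: q_def power2_norm_eq_inner[symmetric] power2_eq_square)
  have 3: "norm (q *\<^sub>R S x) = norm x" using nz by (simp add: q_def)
  have "norm x * norm (S x) \<le> norm x * (r * norm x)"
    using 1 unfolding 2 3 by (simp add: power2_eq_square algebra_simps)
  moreover have "norm x > 0" using nz A_0 by (auto simp: S_def)
  ultimately show ?thesis by (simp add: S_def)
qed

lemma form_val_E_kernel: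
  assumes x: "x \<in> Dom" "A x = 0" and B: "B \<in> sets borel"
  shows "form_val E (E B x) = 0"
  using form_val_dom[OF dom_E[OF B x(1)]] A_E[OF B x(1)] x(2) linear_0[OF E_linear[OF B]] by simp

text \<open>A strictly positive function has vanishing integral only for the zero measure, and the
  total mass of \<open>spec_meas E x\<close> is \<open>(norm x)\<^sup>2\<close>.\<close>

lemma zero_of_pos_support:
  assumes B: "B \<in> sets borel" "B \<subseteq> {0<..}" and x: "x \<in> form_dom E" "E B x = x" and z: "form_val E x \<le> 0"
  shows "x = 0"
proof -
  have ae: "AE s in spec_meas E x. s \<in> B" by (rule AE_spec_meas) fact+
  have ge: "AE s in spec_meas E x. 0 \<le> s" using ae by eventually_elim (use B in auto)
  have int: "integrable (spec_meas E x) (\<lambda>s. s)" using x by (simp add: form_dom_def)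
  have "(\<integral>s. s \<partial>spec_meas E x) = 0"
    using z integral_nonneg_AE[OF ge] by (simp add: form_val_def)
  then have "AE s in spec_meas E x. s = 0"
    using integral_nonneg_eq_0_iff_AE[OF int ge] by simp
  with ae have "AE s in spec_meas E x. False" by eventually_elim (use B in auto)
  then have "emeasure (spec_meas E x) UNIV = 0"
    by (simp add: AE_iff_measurable[of UNIV])
  then show ?thesis by (simp add: emeasure_spec_meas E_UNIV)
qed

lemma zero_of_neg_support:
  assumes B: "B \<in> sets borel" "B \<subseteq> {..<0}" and x: "x \<in> form_dom E" "E B x = x" and z: "form_val E x \<ge> 0"
  shows "x = 0"
proof -
  have ae: "AE s in spec_meas E x. s \<in> B" by (rule AE_spec_meas) fact+
  have ge: "AE s in spec_meas E x. 0 \<le> - s" using ae by eventually_elim (use B in auto)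
  have int: "integrable (spec_meas E x) (\<lambda>s. - s)" using x by (simp add: form_dom_def)
  have "(\<integral>s. - s \<partial>spec_meas E x) = 0"
    using z integral_nonneg_AE[OF ge] by (simp add: form_val_def)
  then have "AE s in spec_meas E x. s = 0"
    using integral_nonneg_eq_0_iff_AE[OF int ge] by simp
  with ae have "AE s in spec_meas E x. False" by eventually_elim (use B in auto)
  then have "emeasure (spec_meas E x) UNIV = 0"
    by (simp add: AE_iff_measurable[of UNIV])
  then show ?thesis by (simp add: emeasure_spec_meas E_UNIV)
qed

text \<open>Spectral parts of a kernel vector stay in the kernel and have zero form, so those on
  either side of zero vanish; conversely the window \<open>{0}\<close> has radius zero in
  \<open>norm_A_shift_le\<close>.\<close>

lemma kernel_eq_range: "op_ker T = range (E {0})"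
proof (intro subset_antisym subsetI)
  fix x assume "x \<in> op_ker T"
  then have x: "x \<in> Dom" "A x = 0" by (auto simp: op_ker_def)
  have "E {0<..} x = 0"
    by (rule zero_of_pos_support[of "{0<..}"])
       (use form_val_E_kernel[OF x] dom_subset_form_dom[OF dom_E[OF _ x(1)]] in \<open>auto simp: E_idem\<close>)
  moreover have "E {..<0} x = 0"
    by (rule zero_of_neg_support[of "{..<0}"])
       (use form_val_E_kernel[OF x] dom_subset_form_dom[OF dom_E[OF _ x(1)]] in \<open>auto simp: E_idem\<close>)
  moreover have "E (- {0}) x = E {..<0} x + E {0<..} x"
  proof -
    have "- {0} = {..<0} \<union> {0::real<..}" by auto
    moreover have "{..<0} \<inter> {0::real<..} = {}" by auto
    ultimately show ?thesis using E_Un[of "{..<0}" "{0<..}" x] by simp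
  qed
  ultimately have "E (- {0}) x = 0" by simp
  then show "x \<in> range (E {0})" by (simp add: range_E_iff E_Compl)
next
  fix x assume "x \<in> range (E {0})"
  then have x: "E {0} x = x" by (simp add: range_E_iff)
  have "norm (A x - 0 *\<^sub>R x) \<le> 0 * norm x" by (rule norm_A_shift_le[of "{0}"]) (auto simp: x)
  moreover have "x \<in> Dom" using dom_bounded[of "{0}" 0 x] x by simp
  ultimately show "x \<in> op_ker T" by (simp add: op_ker_def)
qed

lemma spectral_lower_bound:
  assumes "bounded_below T"
  shows "\<exists>K>0. \<forall>x. E {..<-K} x = 0"
proof -
  obtain c where c: "\<And>x. x \<in> Dom \<Longrightarrow> c * (norm x)\<^sup>2 \<le> inner (A x) x"
    using assms by (auto simp: bounded_below_def)
  \<comment> \<open>The added 1 gives both \<open>- K < c\<close> strictly and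
    \<open>K > 0\<close>.\<close>
  define K where "K = \<bar>c\<bar> + 1"
  \<comment> \<open>The cut at \<open>-real n\<close> puts the vector in the domain, where the lower
    bound applies; letting \<open>n\<close> grow removes it.\<close>
  have null: "E {-real n..<-K} x = 0" for n x
  proof (rule ccontr)
    define v where "v = E {-real n..<-K} x"
    assume "E {-real n..<-K} x \<noteq> 0"
    then have v0: "(norm v)\<^sup>2 > 0" by (simp add: v_def)
    have v: "v \<in> Dom" unfolding v_def by (rule dom_bounded[of _ "real n + K"]) (auto simp: K_def)
    have "form_val E v \<le> -K * (norm v)\<^sup>2"
      by (rule form_val_le[of "{-real n..<-K}"]) (use v dom_subset_form_dom in \<open>auto simp: v_def E_idem\<close>)
    then have "c * (norm v)\<^sup>2 \<le> -K * (norm v)\<^sup>2" using c[OF v] form_val_dom[OF v] by simp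
    then have "c \<le> -K" using v0 by (simp only: mult_le_cancel_right_pos)
    then show False by (simp add: K_def)
  qed
  have "E {..<-K} x = 0" for x
  proof (rule LIMSEQ_unique)
    show "(\<lambda>n. E {- real n..real n} (E {..<-K} x)) \<longlonglongrightarrow> E {..<-K} x" by (rule E_trunc_tendsto)
    have "{- real n..real n} \<inter> {..<-K} = {-real n..<-K}" for n by (auto simp: K_def)
    then show "(\<lambda>n. E {- real n..real n} (E {..<-K} x)) \<longlonglongrightarrow> 0"
      by (simp add: E_Int null)
  qed
  moreover have "K > 0" by (simp add: K_def)
  ultimately show ?thesis by blast
qed

text \<open>If every dyadic shell around zero carried a unit vector \<open>v k\<close>, then \<open>\<Sum>k. A (v k)\<close> would lie in
  the closed range, but a preimage would have all the \<open>v k\<close> as orthogonal components.\<close>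

lemma spectral_gap:
  assumes cl: "closed (op_ran T)"
  shows "\<exists>g>0. \<forall>x. E ({-g<..<g} - {0}) x = 0"
proof -
  define S where "S k = {s::real. (1/2)^(Suc k) \<le> \<bar>s\<bar> \<and> \<bar>s\<bar> < (1/2)^k}" for k :: nat
  have S_eq: "S k = {s. (1/2)^(Suc k) \<le> \<bar>s\<bar>} \<inter> {s. \<bar>s\<bar> < (1/2)^k}" for k by (auto simp: S_def)
  have S: "S k \<in> sets borel" for k
    unfolding S_eq by (intro sets.Int borel_closed borel_open closed_Collect_le open_Collect_less continuous_intros)
  have pw: "(1/2)^j \<le> (1/2::real)^k" if "k \<le> j" for j k :: nat
    using that by (intro power_decreasing) auto
  have disj: "S j \<inter> S k = {}" if "j \<noteq> k" for j k
  proof -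
    have "S j \<inter> S k = {}" if "j < k" for j k
    proof -
      have h: "(1/2)^k \<le> (1/2::real)^(Suc j)" using that by (intro pw) simp
      have "s \<notin> S j \<inter> S k" for s
        unfolding S_def Int_iff mem_Collect_eq using h by linarith
      then show ?thesis by blast
    qed
    then show ?thesis using that by (metis Int_commute nat_neq_iff)
  qed
  have dfam: "disjoint_family S" using disj by (auto simp: disjoint_family_on_def)
  have "\<exists>v. E (S k) v = v \<and> norm v \<le> 1 \<and> ((\<exists>x. E (S k) x \<noteq> 0) \<longrightarrow> norm v = 1)" for k
  proof (cases "\<exists>x. E (S k) x \<noteq> 0")
    case True
    then obtain x where x: "E (S k) x \<noteq> 0" by blast
    then show ?thesis
      by (intro exI[of _ "(1 / norm (E (S k) x)) *\<^sub>R E (S k) x"])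
         (auto simp: linear_scale E_linear S E_idem)
  next
    case False
    then show ?thesis by (intro exI[of _ 0]) auto
  qed
  then obtain v where v: "\<And>k. E (S k) (v k) = v k" "\<And>k. norm (v k) \<le> 1"
    "\<And>k x. E (S k) x \<noteq> 0 \<Longrightarrow> norm (v k) = 1" by metis
  have Sb: "S k \<subseteq> {0 - (1/2)^k..0 + (1/2)^k}" for k by (auto simp: S_def)
  have vd: "v k \<in> Dom" for k using dom_bounded[OF S, of k "(1/2)^k" "v k"] Sb v(1)[of k] by simp
  have An: "norm (A (v k)) \<le> (1/2)^k" for k
  proof -
    have "norm (A (v k)) \<le> (1/2)^k * norm (v k)" using norm_A_shift_le[OF S Sb v(1)[of k]] by simp
    also have "\<dots> \<le> (1/2)^k" using v(2)[of k] by (simp add: mult_left_le)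
    finally show ?thesis .
  qed
  have "summable (\<lambda>k. A (v k))"
    by (rule summable_norm_le_complete[of "\<lambda>k. (1/2)^k"]) (use An in auto)
  then have sm: "(\<lambda>m. \<Sum>k<m. A (v k)) \<longlonglongrightarrow> (\<Sum>k. A (v k))" and summ: "summable (\<lambda>k. A (v k))"
    by (auto intro: summable_LIMSEQ)
  have part: "(\<Sum>k<m. v k) \<in> Dom \<and> A (\<Sum>k<m. v k) = (\<Sum>k<m. A (v k))" for m
    by (induction m) (auto simp: dom_0 A_0 A_add dom_add vd)
  have "(\<Sum>k. A (v k)) \<in> op_ran T"
  proof (rule Lim_in_closed_set[OF cl _ _ sm])
    show "\<forall>\<^sub>F m in sequentially. (\<Sum>k<m. A (v k)) \<in> op_ran T"
      by (intro always_eventually allI) (metis part op_ran_def image_eqI)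
  qed simp
  then obtain x where x: "x \<in> Dom" "A x = (\<Sum>k. A (v k))" by (auto simp: op_ran_def)
  have Ex: "E (S k) x = v k" for k
  proof -
    have "E (S k) (A x) = (\<Sum>j. E (S k) (A (v j)))"
      unfolding x(2) by (rule bounded_linear.suminf[OF E_bounded_linear[OF S] summ])
    also have "\<dots> = (\<Sum>j\<in>{k}. E (S k) (A (v j)))"
    proof (rule suminf_finite)
      fix j assume "j \<notin> {k}"
      have "E (S k) (E (S j) (A (v j))) = 0" using \<open>j \<notin> {k}\<close> disj[of k j] by (simp add: E_Int S E_empty)
      then show "E (S k) (A (v j)) = 0" using A_range_E[OF S vd v(1)] by simp
    qed simp
    also have "\<dots> = A (v k)" using A_range_E[OF S vd v(1)] by simp
    finally have "A (E (S k) x - v k) = 0" using x(1) vd by (simp add: A_diff dom_E S A_E)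
    moreover have "E (S k) x - v k \<in> Dom" using x(1) vd by (intro dom_diff dom_E S)
    ultimately have "E {0} (E (S k) x - v k) = E (S k) x - v k"
      using kernel_eq_range range_E_iff[of "{0}"] by (auto simp: op_ker_def)
    moreover have "E (S k) (E (S k) x - v k) = E (S k) x - v k"
      by (simp add: linear_diff E_linear S E_idem v(1))
    \<comment> \<open>A vector in the spectral ranges of the disjoint sets \<open>{0}\<close> and
      \<open>S k\<close> is zero.\<close>
    ultimately have "E (S k) x - v k = E ({0} \<inter> S k) (E (S k) x - v k)"
      using E_Int[of "{0}" "S k" "E (S k) x - v k"] S by simp
    also have "{0} \<inter> S k = {}" by (auto simp: S_def not_le)
    finally show ?thesis by (simp add: E_empty)
  qed
  \<comment> \<open>Components of one vector over disjoint shells are summable, so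
    \<open>v k\<close> tends to zero. It has norm 1 on every shell that is not null, hence all but
    finitely many shells are null.\<close>
  have "(\<lambda>k. E (S k) x) sums E (\<Union>(range S)) x" by (rule E_sums[OF _ dfam]) (use S in auto)
  then have "(\<lambda>k. E (S k) x) \<longlonglongrightarrow> 0" by (intro summable_LIMSEQ_zero) (rule sums_summable)
  then have "(\<lambda>k. v k) \<longlonglongrightarrow> 0" unfolding Ex .
  from tendstoD[OF this, of 1] obtain m where m: "\<And>k. k \<ge> m \<Longrightarrow> norm (v k) < 1"
    by (auto simp: eventually_sequentially)
  have null: "E (S k) y = 0" if "k \<ge> m" for k y using v(3)[of k y] m[OF that] by auto
  let ?g = "(1/2)^m :: real"
  have "E ({-?g<..<?g} - {0}) y = 0" for y
  proof -
    have "{-?g<..<?g} - {0} \<subseteq> \<Union>(range (\<lambda>k. S (k + m)))"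
    proof
      fix s assume s: "s \<in> {-?g<..<?g} - {0}"
      then obtain n where n: "(1/2)^n < \<bar>s\<bar>" using real_arch_pow_inv[of "\<bar>s\<bar>" "1/2"] by auto
      \<comment> \<open>The first dyadic power not above \<open>\<bar>s\<bar>\<close>; the shell
        containing \<open>s\<close> has index \<open>p - 1\<close>.\<close>
      define p where "p = (LEAST n. (1/2)^n \<le> \<bar>s\<bar>)"
      have p: "(1/2)^p \<le> \<bar>s\<bar>" unfolding p_def by (rule LeastI[of _ n]) (use n in simp)
      have pm: "p > m"
      proof (rule ccontr)
        assume "\<not> p > m"
        then have "?g \<le> (1/2)^p" by (intro pw) simp
        moreover have "\<bar>s\<bar> < ?g" using s by (simp add: abs_less_iff)
        ultimately show False using p by linarith
      qed
      then obtain q where q: "p = Suc q" "q \<ge> m" using less_iff_Suc_add by fastforce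
      have "\<not> (1/2)^q \<le> \<bar>s\<bar>" using not_less_Least[of q "\<lambda>n. (1/2)^n \<le> \<bar>s\<bar>"] q by (simp add: p_def)
      then have "s \<in> S q" using p q by (simp add: S_def)
      then have "s \<in> S ((q - m) + m)" using q by simp
      then show "s \<in> \<Union>(range (\<lambda>k. S (k + m)))" by blast
    qed
    moreover have "E (\<Union>(range (\<lambda>k. S (k + m)))) y = 0"
    proof -
      have "(\<lambda>k. E (S (k + m)) y) sums E (\<Union>(range (\<lambda>k. S (k + m)))) y"
        by (rule E_sums) (use S disj in \<open>auto simp: disjoint_family_on_def\<close>)
      then have "(\<lambda>k. 0) sums E (\<Union>(range (\<lambda>k. S (k + m)))) y" by (simp add: null)
      then show ?thesis using sums_unique2 sums_zero by blast
    qed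
    moreover have "\<Union>(range (\<lambda>k. S (k + m))) \<in> sets borel" using S by blast
    moreover have "{-?g<..<?g} - {0} \<in> sets borel" by simp
    ultimately show ?thesis using E_null_subset[of "{-?g<..<?g} - {0}" "\<Union>(range (\<lambda>k. S (k + m)))" y] by blast
  qed
  then show ?thesis by (intro exI[of _ ?g]) auto
qed

section \<open>The resolvent at the imaginary unit\<close>

lemma complex_structureD: "linear J" "J (J x) = - x" "inner (J x) (J y) = inner x y"
  using J by (auto simp: complex_structure_def)

lemma J_skew: "inner (J x) y = - inner x (J y)"
  using complex_structureD(3)[of "J x" y] complex_structureD(2) by (simp add: inner_commute)

lemma norm_J: "norm (J x) = norm x"
  using complex_structureD(3)[of x x] by (simp add: norm_eq_sqrt_inner)

lemma bounded_linear_J: "bounded_linear J"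
  using complex_structureD(1) by (intro linear_conv_bounded_linear[THEN iffD1] bounded_linear_intro[of _ 1])
    (auto simp: linear_add linear_scale norm_J)

text \<open>\<open>J\<close> is skew and commutes with \<open>A\<close>, so the value equals its own
  negative. In complex terms the quadratic form of \<open>A\<close> is real.\<close>

lemma inner_A_J: "x \<in> Dom \<Longrightarrow> inner (A x) (J x) = 0"
  using A_sym[of x "J x"] self_adjointD(3,4)[of x] J_skew[of x "A x"] by (simp add: inner_commute)

lemma norm_A_minus_J: "x \<in> Dom \<Longrightarrow> (norm (A x - J x))\<^sup>2 = (norm (A x))\<^sup>2 + (norm x)\<^sup>2"
  using inner_A_J[of x] inner_commute[of "J x" "A x"]
  by (simp add: power2_norm_eq_inner inner_diff_left inner_diff_right complex_structureD(3))

lemma norm_le_A_minus_J: "x \<in> Dom \<Longrightarrow> norm x \<le> norm (A x - J x)"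
  by (rule power2_le_imp_le) (simp_all add: norm_A_minus_J)

lemma A_minus_J_diff: "x \<in> Dom \<Longrightarrow> y \<in> Dom \<Longrightarrow> A (x - y) - J (x - y) = (A x - J x) - (A y - J y)"
  by (simp add: A_diff linear_diff[OF complex_structureD(1)])

text \<open>The range of \<open>A - J\<close> is closed, by \<open>norm_le_A_minus_J\<close> and the
  closedness of \<open>A\<close>. A vector \<open>z\<close> orthogonal to it satisfies the adjoint
  relation with \<open>- J z\<close>, so \<open>A z = - J z\<close>, which \<open>inner_A_J\<close>
  excludes unless \<open>z = 0\<close>.\<close>

lemma surj_A_minus_J: "\<exists>x\<in>Dom. A x - J x = y"
proof (rule ccontr)
  define S where "S = (\<lambda>x. A x - J x) ` Dom"
  assume "\<not> (\<exists>x\<in>Dom. A x - J x = y)"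
  then have yS: "y \<notin> S" by (auto simp: S_def)
  have sub: "subspace S"
  proof (rule subspaceI)
    show "0 \<in> S" unfolding S_def by (rule image_eqI[of _ _ 0]) (simp_all add: A_0 dom_0 linear_0 complex_structureD)
    show "a + b \<in> S" if ab: "a \<in> S" "b \<in> S" for a b
    proof -
      obtain x z where xz: "x \<in> Dom" "z \<in> Dom" "a = A x - J x" "b = A z - J z" using ab unfolding S_def by blast
      then show ?thesis unfolding S_def
        by (intro image_eqI[of _ _ "x + z"]) (simp_all add: A_add dom_add linear_add complex_structureD)
    qed
    show "c *\<^sub>R a \<in> S" if ab: "a \<in> S" for c a
    proof -
      obtain x where xz: "x \<in> Dom" "a = A x - J x" using ab unfolding S_def by blast
      then show ?thesis unfolding S_def
        by (intro image_eqI[of _ _ "c *\<^sub>R x"]) (simp_all add: A_scaleR dom_scaleR linear_scale complex_structureD scaleR_diff_right)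
    qed
  qed
  have "closed S"
    unfolding closed_sequential_limits
  proof (intro allI impI, elim conjE)
    fix f l assume f: "\<forall>n. f n \<in> S" and l: "f \<longlonglongrightarrow> l"
    then obtain x where x: "\<And>n. x n \<in> Dom" "\<And>n. f n = A (x n) - J (x n)" unfolding S_def image_iff by metis
    have "Cauchy f" using l by (rule LIMSEQ_imp_Cauchy)
    have "Cauchy x"
    proof (rule metric_CauchyI)
      fix e :: real assume "e > 0"
      then obtain M where M: "\<forall>m\<ge>M. \<forall>n\<ge>M. dist (f m) (f n) < e" using \<open>Cauchy f\<close> metric_CauchyD by blast
      have "dist (x m) (x n) \<le> dist (f m) (f n)" for m n
        using norm_le_A_minus_J[OF dom_diff[OF x(1) x(1)]] A_minus_J_diff[OF x(1) x(1)]
        by (simp add: dist_norm x(2))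
      then show "\<exists>M. \<forall>m\<ge>M. \<forall>n\<ge>M. dist (x m) (x n) < e" using M by (meson le_less_trans)
    qed
    then obtain z where z: "x \<longlonglongrightarrow> z" using Cauchy_convergent convergent_def by blast
    have Ax: "(\<lambda>n. A (x n)) \<longlonglongrightarrow> l + J z"
      using tendsto_add[OF l bounded_linear.tendsto[OF bounded_linear_J z]] by (simp add: x(2))
    have adj: "inner (A w) z = inner w (l + J z)" if w: "w \<in> Dom" for w
    proof (rule LIMSEQ_unique)
      show "(\<lambda>n. inner (A w) (x n)) \<longlonglongrightarrow> inner (A w) z" by (intro tendsto_intros z)
      show "(\<lambda>n. inner (A w) (x n)) \<longlonglongrightarrow> inner w (l + J z)"
        unfolding A_sym[OF w x(1)] by (intro tendsto_intros Ax)
    qed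
    show "l \<in> S" unfolding S_def
      using A_adjoint[OF adj] by (intro image_eqI[of _ _ z]) auto
  qed
  from closed_subspace_orthogonal_witness[OF sub this yS]
  obtain z where z: "z \<noteq> 0" "\<And>s. s \<in> S \<Longrightarrow> inner z s = 0" by blast
  have adj: "inner (A x) z = inner x (- J z)" if "x \<in> Dom" for x
    using z(2)[of "A x - J x"] that J_skew[of x z]
    by (auto simp: S_def inner_diff_right inner_commute)
  have "z \<in> Dom" "A z = - J z" using A_adjoint[OF adj] by auto
  then show False using inner_A_J[of z] complex_structureD(3)[of z z] z(1) by simp
qed

lemma ex1_resolvent: "\<exists>!x. x \<in> Dom \<and> A x - J x = y"
proof -
  have "x = z" if "x \<in> Dom" "z \<in> Dom" "A x - J x = A z - J z" for x z
    using norm_le_A_minus_J[OF dom_diff[OF that(1,2)]] A_minus_J_diff[OF that(1,2)] that(3) by simp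
  then show ?thesis using surj_A_minus_J[of y] by metis
qed

lemma resolvent_i: "resolvent_i J T y \<in> Dom" "A (resolvent_i J T y) - J (resolvent_i J T y) = y"
  using theI'[OF ex1_resolvent[of y]] by (auto simp: resolvent_i_def)

lemma resolvent_i_eq: "x \<in> Dom \<Longrightarrow> A x - J x = y \<Longrightarrow> resolvent_i J T y = x"
  using ex1_resolvent[of y] resolvent_i[of y] by blast

lemma bounded_linear_resolvent_i: "bounded_linear (resolvent_i J T)"
proof (rule bounded_linear_intro[of _ 1])
  fix x y :: 'a and r :: real
  show "resolvent_i J T (x + y) = resolvent_i J T x + resolvent_i J T y"
    by (rule resolvent_i_eq)
       (use resolvent_i[of x] resolvent_i[of y] in \<open>auto simp: dom_add A_add linear_add complex_structureD algebra_simps\<close>)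
  show "resolvent_i J T (r *\<^sub>R x) = r *\<^sub>R resolvent_i J T x"
    by (rule resolvent_i_eq)
       (use resolvent_i[of x] in \<open>auto simp: dom_scaleR A_scaleR linear_scale complex_structureD scaleR_diff_right[symmetric]\<close>)
  show "norm (resolvent_i J T x) \<le> norm x * 1"
    using norm_le_A_minus_J[OF resolvent_i(1)[of x]] resolvent_i(2)[of x] by simp
qed

end

subsection \<open>Semibounded operators with a spectral gap at zero\<close>

text \<open>The gap spares the point zero, which may be an eigenvalue. \<open>g_le_K\<close> makes
  \<open>K - g\<close>, the norm bound for \<open>A + K\<close> on the range of
  \<open>E {..<0}\<close>, nonnegative.\<close>

locale gapped_op = spectral_op +
  fixes K g :: real
  assumes K_pos: "K > 0" and lower: "\<And>x. E {..<-K} x = 0"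
    and g_pos: "g > 0" and g_le_K: "g \<le> K" and gap: "\<And>x. E ({-g<..<g} - {0}) x = 0"
begin

lemma E_mod_null:
  assumes B: "B \<in> sets borel" and C: "C \<in> sets borel"
    and BC: "B - C \<subseteq> {..<-K} \<union> ({-g<..<g} - {0})" "C - B \<subseteq> {..<-K} \<union> ({-g<..<g} - {0})"
  shows "E B x = E C x"
proof -
  have null: "E D x = 0" if D: "D \<in> sets borel" "D \<subseteq> {..<-K} \<union> ({-g<..<g} - {0})" for D
  proof -
    have "E (D \<inter> {..<-K}) x = 0" "E (D - {..<-K}) x = 0"
      using lower[of x] gap[of x] D
      by (auto intro: E_null_subset[of _ "{..<-K}"] E_null_subset[of _ "{-g<..<g} - {0}"])
    moreover have "(D \<inter> {..<-K}) \<union> (D - {..<-K}) = D" by blast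
    ultimately show ?thesis using E_Un[of "D \<inter> {..<-K}" "D - {..<-K}" x] D(1) by auto
  qed
  have "E (B \<inter> C) x + E (B - C) x = E B x"
  proof -
    have "(B \<inter> C) \<union> (B - C) = B" "(B \<inter> C) \<inter> (B - C) = {}" by auto
    then show ?thesis using E_Un[of "B \<inter> C" "B - C" x] B C by simp
  qed
  moreover have "E (B \<inter> C) x + E (C - B) x = E C x"
  proof -
    have "(B \<inter> C) \<union> (C - B) = C" "(B \<inter> C) \<inter> (C - B) = {}" by auto
    then show ?thesis using E_Un[of "B \<inter> C" "C - B" x] B C by simp
  qed
  ultimately show ?thesis using null[of "B - C"] null[of "C - B"] B C BC by simp
qed

lemma E_neg_eq: "E {..<0} x = E {-K..-g} x"
  by (rule E_mod_null) (use g_pos g_le_K in auto)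

lemma E_nonpos_eq: "E {..0} x = E {-K..0} x"
  by (rule E_mod_null) (use K_pos in auto)

lemma E_pos_eq: "E {0<..} x = E {g..} x"
  by (rule E_mod_null) (use g_pos in auto)

lemma E_decomp: "x = E {..<0} x + E {0..} x" "E {0..} x = E {0} x + E {0<..} x"
  "E {..0} x = E {..<0} x + E {0} x" "x = E {..0} x + E {0<..} x"
proof -
  have s: "- {..<0::real} = {0..}" "{0::real..} = {0} \<union> {0<..}" "{..0::real} = {..<0} \<union> {0}" "- {..0::real} = {0<..}"
    by auto
  show "x = E {..<0} x + E {0..} x" using E_Compl[of "{..<0}" x] s by simp
  show "E {0..} x = E {0} x + E {0<..} x" unfolding s(2) by (rule E_Un) auto
  show "E {..0} x = E {..<0} x + E {0} x" unfolding s(3) by (rule E_Un) auto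
  show "x = E {..0} x + E {0<..} x" using E_Compl[of "{..0}" x] s by simp
qed

lemma dom_neg: "E {..<0} x \<in> Dom"
  unfolding E_neg_eq using g_pos K_pos by (intro dom_bounded[of _ K]) auto

lemma dom_nonpos: "E {..0} x \<in> Dom"
  unfolding E_nonpos_eq using K_pos by (intro dom_bounded[of _ K]) auto

lemma dom_ker: "E {0} x \<in> Dom"
  by (rule dom_bounded[of _ 0]) auto

lemma form_val_neg: "form_val E (E {..<0} x) \<le> - g * (norm (E {..<0} x))\<^sup>2"
  by (rule form_val_le[of "{-K..-g}"])
     (use dom_subset_form_dom[OF dom_neg] in \<open>auto simp: E_neg_eq E_idem\<close>)

lemma form_val_nonpos: "form_val E (E {..0} x) \<le> 0"
  using form_val_le[of "{..0}" "E {..0} x" 0] dom_subset_form_dom[OF dom_nonpos] by (simp add: E_idem)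

lemma form_val_ker: "form_val E (E {0} x) = 0"
  using form_val_le[of "{0}" "E {0} x" 0] form_val_ge[of "{0}" "E {0} x" 0] dom_subset_form_dom[OF dom_ker]
  by (simp add: E_idem)

lemma form_val_pos: "x \<in> form_dom E \<Longrightarrow> g * (norm (E {0<..} x))\<^sup>2 \<le> form_val E (E {0<..} x)"
  by (rule form_val_ge[of "{g..}"]) (auto simp: E_pos_eq E_idem form_dom_E)

lemma form_val_nonneg: "x \<in> form_dom E \<Longrightarrow> 0 \<le> form_val E (E {0..} x)"
  using form_val_ge[of "{0..}" "E {0..} x" 0] by (simp add: E_idem form_dom_E)

lemma E_lower: "E {-K..} x = x"
proof -
  have "E {-K..} x = E UNIV x" by (rule E_mod_null) auto
  then show ?thesis by (simp add: E_UNIV)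
qed

lemma form_val_lower: "x \<in> form_dom E \<Longrightarrow> - K * (norm x)\<^sup>2 \<le> form_val E x"
  by (rule form_val_ge[of "{-K..}"]) (auto simp: E_lower)

lemma form_val_split2: "x \<in> form_dom E \<Longrightarrow> form_val E x = form_val E (E {..0} x) + form_val E (E {0<..} x)"
proof -
  assume x: "x \<in> form_dom E"
  have "- {..0::real} = {0<..}" by auto
  then show ?thesis using form_val_split[of "{..0}" x] x by simp
qed

lemma form_val_split3: "x \<in> form_dom E \<Longrightarrow> form_val E x = form_val E (E {..<0} x) + form_val E (E {0<..} x)"
proof -
  assume x: "x \<in> form_dom E"
  have s: "- {..<0::real} = {0..}" "{0} \<inter> {0::real..} = {0}" "- {0} \<inter> {0::real..} = {0<..}" by auto
  have "form_val E (E {0..} x) = form_val E (E {0} x) + form_val E (E {0<..} x)"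
    using form_val_split[of "{0}" "E {0..} x"] x s by (simp add: form_dom_E E_Int)
  then show ?thesis using form_val_split[of "{..<0}" x] x s by (simp add: form_val_ker)
qed

text \<open>The gap bounds the form of the positive part from below, the sign condition bounds it by
  minus the form of the negative part, and \<open>K\<close> bounds the latter. The kernel component
  does not enter the form and stays uncontrolled.\<close>

lemma nonpos_cone_estimate:
  assumes "x \<in> form_dom E" "form_val E x \<le> 0"
  shows "g * (norm (E {0<..} x))\<^sup>2 \<le> K * (norm (E {..<0} x))\<^sup>2"
  using form_val_pos[OF assms(1)] form_val_split3[OF assms(1)] assms(2)
    form_val_lower[OF dom_subset_form_dom[OF dom_neg]] by (smt (verit) mult_minus_left)

section \<open>Spectral truncation and closedness of the form\<close>

lemma form_val_trunc_le:
  assumes x: "x \<in> form_dom E" and n: "K \<le> real n"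
  shows "form_val E (E {- real n..real n} x) \<le> form_val E x"
proof -
  let ?B = "- {- real n..real n} :: real set"
  \<comment> \<open>Since \<open>K \<le> real n\<close>, only spectrum above \<open>real n\<close>
    is cut off.\<close>
  have "0 * (norm (E ?B x))\<^sup>2 \<le> form_val E (E ?B x)"
  proof (rule form_val_ge[of "{real n<..}"])
    have "E {real n<..} (E ?B x) = E {real n<..} x" by (subst E_Int) (auto intro: arg_cong2[of _ _ x x E])
    also have "\<dots> = E ?B x" by (rule E_mod_null) (use n in auto)
    finally show "E {real n<..} (E ?B x) = E ?B x" .
  qed (use x in \<open>auto intro: form_dom_E\<close>)
  then show ?thesis using form_val_split[of "{- real n..real n}" x] x by simp
qed

text \<open>Monotone convergence: the spectrum lies above \<open>- K\<close>, so once
  \<open>K \<le> real n\<close> a larger window only adds a nonnegative integrand. The index shift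
  \<open>m\<close> starts the sequence there.\<close>

lemma form_dom_criterion:
  assumes le: "\<And>n. K \<le> real n \<Longrightarrow> form_val E (E {- real n..real n} x) \<le> c"
  shows "x \<in> form_dom E" "form_val E x \<le> c"
proof -
  define m where "m = nat \<lceil>K\<rceil>"
  have m: "K \<le> real (n + m)" for n by (simp add: m_def) linarith
  define f where "f n s = indicator {- real (n + m)..real (n + m)} s * s" for n and s :: real
  have int: "integrable (spec_meas E x) (f n)" for n
  proof -
    have "E {- real (n + m)..real (n + m)} x \<in> form_dom E"
      by (rule dom_subset_form_dom, rule dom_bounded[of _ "real (n + m)"]) auto
    then show ?thesis unfolding f_def form_dom_def mem_Collect_eq by (subst (asm) integrable_spec_meas_E) auto
  qed
  have val: "(\<integral>s. f n s \<partial>spec_meas E x) = form_val E (E {- real (n + m)..real (n + m)} x)" for n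
    unfolding f_def form_val_def by (subst integral_spec_meas_E) auto
  have ae: "AE s in spec_meas E x. mono (\<lambda>n. f n s)"
    using AE_spec_meas[OF borel_closed[OF closed_atLeast] E_lower]
  proof eventually_elim
    case (elim s)
    show ?case
    proof (rule monoI)
      fix i j :: nat assume "i \<le> j"
      then show "f i s \<le> f j s" using elim m[of i] by (auto simp: f_def indicator_def)
    qed
  qed
  have lim: "AE s in spec_meas E x. (\<lambda>n. f n s) \<longlonglongrightarrow> s"
  proof (rule AE_I2)
    fix s :: real
    obtain N where "\<bar>s\<bar> \<le> real N" using real_arch_simple by blast
    then have "\<forall>\<^sub>F n in sequentially. f n s = s"
      by (intro eventually_sequentiallyI[of N]) (auto simp: indicator_def f_def)
    then show "(\<lambda>n. f n s) \<longlonglongrightarrow> s" by (rule tendsto_eventually)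
  qed
  have "incseq (\<lambda>n. \<integral>s. f n s \<partial>spec_meas E x)"
  proof (rule incseq_SucI, rule integral_mono_AE[OF int int])
    fix n show "AE s in spec_meas E x. f n s \<le> f (Suc n) s"
      using ae by eventually_elim (rule incseq_SucD)
  qed
  then obtain l where l: "(\<lambda>n. \<integral>s. f n s \<partial>spec_meas E x) \<longlonglongrightarrow> l" "\<forall>n. (\<integral>s. f n s \<partial>spec_meas E x) \<le> l"
    using incseq_convergent[of "\<lambda>n. \<integral>s. f n s \<partial>spec_meas E x" c] le[OF m] unfolding val by blast
  have "(\<lambda>s. s) \<in> borel_measurable (spec_meas E x)" by measurable
  note conv = integrable_monotone_convergence[OF int ae lim l(1) this] integral_monotone_convergence[OF int ae lim l(1) this]
  show "x \<in> form_dom E" using conv(1) by (simp add: form_dom_def)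
  have "l \<le> c" by (rule LIMSEQ_le_const2[OF l(1)]) (use le[OF m] val in auto)
  then show "form_val E x \<le> c" using conv(2) by (simp add: form_val_def)
qed

lemma trunc_dom: "E {- real n..real n} x \<in> Dom"
  by (rule dom_bounded[of _ "real n"]) auto

lemma trunc_parallelogram:
  "form_val E (E {- real n..real n} (x + y)) + form_val E (E {- real n..real n} (x - y))
    = 2 * form_val E (E {- real n..real n} x) + 2 * form_val E (E {- real n..real n} y)"
proof -
  define a b where "a = E {- real n..real n} x" and "b = E {- real n..real n} y"
  have ab: "a \<in> Dom" "b \<in> Dom" by (simp_all add: a_def b_def trunc_dom)
  have "E {- real n..real n} (x + y) = a + b" "E {- real n..real n} (x - y) = a - b"
    by (simp_all add: a_def b_def linear_add linear_diff E_linear)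
  moreover have "form_val E (a + b) + form_val E (a - b) = 2 * form_val E a + 2 * form_val E b"
    using ab by (simp add: form_val_dom dom_add dom_diff A_add A_diff inner_add_left inner_add_right
        inner_diff_left inner_diff_right)
  ultimately show ?thesis by (simp add: a_def b_def)
qed

text \<open>By the parallelogram identity for truncations: semiboundedness keeps the form of the
  difference above a constant, so that of the sum is bounded uniformly in \<open>n\<close>.\<close>

lemma form_dom_add:
  assumes x: "x \<in> form_dom E" and y: "y \<in> form_dom E"
  shows "x + y \<in> form_dom E"
proof (rule form_dom_criterion(1))
  fix n assume n: "K \<le> real n"
  have "- K * (norm (x - y))\<^sup>2 \<le> - K * (norm (E {- real n..real n} (x - y)))\<^sup>2"
    using K_pos power_mono[OF norm_E_le[of "{- real n..real n}" "x - y"], of 2] by simp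
  also have "\<dots> \<le> form_val E (E {- real n..real n} (x - y))"
    by (rule form_val_lower, rule dom_subset_form_dom, rule trunc_dom)
  finally show "form_val E (E {- real n..real n} (x + y))
      \<le> 2 * form_val E x + 2 * form_val E y + K * (norm (x - y))\<^sup>2"
    using trunc_parallelogram[of n x y] form_val_trunc_le[OF x n] form_val_trunc_le[OF y n] by simp
qed

lemma subspace_form_dom: "subspace (form_dom E)"
  by (rule subspaceI)
     (use dom_subset_form_dom[OF dom_0] in \<open>auto intro: form_dom_add form_dom_scaleR\<close>)

lemma form_dom_diff: "x \<in> form_dom E \<Longrightarrow> y \<in> form_dom E \<Longrightarrow> x - y \<in> form_dom E"
  using subspace_form_dom by (rule subspace_diff)

lemma form_val_parallelogram:
  assumes x: "x \<in> form_dom E" and y: "y \<in> form_dom E"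
  shows "form_val E (x + y) + form_val E (x - y) = 2 * form_val E x + 2 * form_val E y"
proof (rule LIMSEQ_unique)
  show "(\<lambda>n. form_val E (E {- real n..real n} (x + y)) + form_val E (E {- real n..real n} (x - y)))
      \<longlonglongrightarrow> form_val E (x + y) + form_val E (x - y)"
    by (intro tendsto_intros form_val_trunc_tendsto form_dom_add form_dom_diff x y)
  show "(\<lambda>n. form_val E (E {- real n..real n} (x + y)) + form_val E (E {- real n..real n} (x - y)))
      \<longlonglongrightarrow> 2 * form_val E x + 2 * form_val E y"
    unfolding trunc_parallelogram by (intro tendsto_intros form_val_trunc_tendsto x y)
qed

text \<open>The mixed form value is given by the operator as soon as one argument lies in
  \<open>Dom\<close>; truncation puts both arguments there.\<close>

lemma form_val_add_dom:
  assumes x: "x \<in> Dom" and y: "y \<in> form_dom E"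
  shows "form_val E (y + x) = form_val E y + form_val E x + 2 * inner (A x) y"
proof (rule LIMSEQ_unique)
  have xD: "x \<in> form_dom E" using x by (rule dom_subset_form_dom)
  let ?E = "\<lambda>n. E {- real n..real n}"
  show "(\<lambda>n. form_val E (?E n (y + x))) \<longlonglongrightarrow> form_val E (y + x)"
    by (intro form_val_trunc_tendsto form_dom_add xD y)
  have "form_val E (?E n (y + x)) = form_val E (?E n y) + form_val E (?E n x) + 2 * inner (?E n (A x)) y" for n
  proof -
    have "inner (A (?E n y)) (?E n x) = inner (A (?E n x)) (?E n y)"
      using A_sym[OF trunc_dom trunc_dom] by (simp add: inner_commute)
    moreover have "inner (A (?E n x)) (?E n y) = inner (?E n (A x)) y"
      using x by (simp add: A_E E_sym E_idem)
    ultimately show ?thesis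
      by (simp add: linear_add[OF E_linear] form_val_dom trunc_dom dom_add A_add inner_add_left inner_add_right)
  qed
  then show "(\<lambda>n. form_val E (?E n (y + x))) \<longlonglongrightarrow> form_val E y + form_val E x + 2 * inner (A x) y"
    by (auto intro!: tendsto_intros form_val_trunc_tendsto xD y E_trunc_tendsto)
qed

text \<open>A truncated form is norm continuous, since \<open>A\<close> is bounded on the window,
  and lies below the full form; so the bound \<open>c\<close> passes to the limit for every
  truncation.\<close>

lemma form_val_lsc:
  assumes X: "\<And>k. X k \<in> form_dom E" "\<And>k. form_val E (X k) \<le> c" and lim: "X \<longlonglongrightarrow> x"
  shows "x \<in> form_dom E" "form_val E x \<le> c"
proof -
  have le: "form_val E (E {- real n..real n} x) \<le> c" if n: "K \<le> real n" for n
  proof -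
    let ?E = "E {- real n..real n}"
    have val: "form_val E (?E y) = inner (A (?E y)) (?E y)" for y by (rule form_val_dom[OF trunc_dom])
    have "bounded_linear (\<lambda>y. A (?E y))"
    proof (rule bounded_linear_intro[of _ "real n"])
      show "A (?E (a + b)) = A (?E a) + A (?E b)" for a b
        by (simp add: linear_add[OF E_linear] A_add trunc_dom)
      show "A (?E (r *\<^sub>R a)) = r *\<^sub>R A (?E a)" for r a
        by (simp add: linear_scale[OF E_linear] A_scaleR trunc_dom)
      show "norm (A (?E a)) \<le> norm a * real n" for a
      proof -
        have "norm (A (?E a) - 0 *\<^sub>R ?E a) \<le> real n * norm (?E a)"
          by (rule norm_A_shift_le[of "{- real n..real n}"]) (auto simp: E_idem)
        also have "\<dots> \<le> real n * norm a" by (intro mult_left_mono norm_E_le) auto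
        finally show ?thesis by (simp add: mult.commute)
      qed
    qed
    then have "(\<lambda>k. form_val E (?E (X k))) \<longlonglongrightarrow> form_val E (?E x)"
      unfolding val by (intro tendsto_inner bounded_linear.tendsto[OF _ lim] E_bounded_linear) auto
    then show ?thesis
      by (rule LIMSEQ_le_const2) (use form_val_trunc_le[OF X(1) n] X(2) order_trans in blast)
  qed
  show "x \<in> form_dom E" "form_val E x \<le> c" using form_dom_criterion[OF le] by auto
qed

lemma norm_nonpos_part_ge:
  assumes "x \<in> form_dom E" "form_val E x \<le> 0"
  shows "(norm x)\<^sup>2 \<le> (1 + K / g) * (norm (E {..0} x))\<^sup>2"
proof -
  have s: "- {..0::real} = {0<..}" "{..0::real} = {..<0} \<union> {0}" by auto
  have "(norm (E {..<0} x))\<^sup>2 \<le> (norm (E {..0} x))\<^sup>2"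
    unfolding s(2) by (subst norm_E_Un) auto
  then have "g * (norm (E {0<..} x))\<^sup>2 \<le> K * (norm (E {..0} x))\<^sup>2"
    using nonpos_cone_estimate[OF assms] K_pos mult_left_mono order_trans less_imp_le by meson
  then have "(norm (E {0<..} x))\<^sup>2 \<le> (K / g) * (norm (E {..0} x))\<^sup>2"
    using g_pos by (simp add: field_simps)
  then show ?thesis using norm_E_split[of "{..0}" x] s by (simp add: algebra_simps)
qed

end

text \<open>With \<open>F = E' {0..}\<close>, \<open>G = E {..<0}\<close> and \<open>\<xi> = \<parallel>F G\<parallel>\<close>, the gap makes \<open>A + K\<close> of norm at most \<open>K - g\<close> on
  the range of \<open>G\<close> while \<open>A' + K \<ge> K\<close> on the range of \<open>F\<close>; comparing the two through the resolvents
  gives \<open>K \<xi> \<le> (K - g) \<xi> + O(e)\<close>. No lower bound for \<open>T'\<close> enters.\<close>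

lemma neg_subspaces_close:
  assumes m: "gapped_op J T E K g" and n: "spectral_op J T' E'"
    and e: "e \<ge> 0" "\<And>y. norm (resolvent_i J T' y - resolvent_i J T y) \<le> e * norm y"
    and small: "2 * (1 + 2 * K) * (1 + K) * e \<le> g"
    and y: "E {..<0} y = y"
  shows "norm (E' {0..} y) \<le> norm y / 2"
proof -
  interpret m: gapped_op J T E K g by fact
  interpret n: spectral_op J T' E' by fact
  define F where "F = E' {0..}"
  define G where "G = E {..<0}"
  have F: "bounded_linear F" and G: "bounded_linear G"
    unfolding F_def G_def by (simp_all add: n.E_bounded_linear m.E_bounded_linear)
  have FG: "bounded_linear (F \<circ> G)" using bounded_linear_compose[OF F G] by (simp add: comp_def)
  define \<xi> where "\<xi> = onorm (F \<circ> G)"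
  have \<xi>0: "\<xi> \<ge> 0" unfolding \<xi>_def by (rule onorm_pos_le[OF FG])
  have \<xi>: "norm (F z) \<le> \<xi> * norm z" if "G z = z" for z
    using onorm[OF FG, of z] that by (simp add: \<xi>_def)
  \<comment> \<open>\<open>1 + K\<close> bounds \<open>A - J\<close> on the range of
    \<open>G\<close>.\<close>
  define e' where "e' = e * (1 + K)"
  have e'0: "e' \<ge> 0" using e(1) m.K_pos by (simp add: e'_def)
  have main: "K * norm (F z) \<le> (\<xi> * (K - g) + (1 + 2 * K) * e') * norm z" if Gz: "G z = z" for z
  proof -
    have z: "z \<in> m.Dom" using m.dom_neg[of z] Gz by (simp add: G_def)
    \<comment> \<open>The resolvent of \<open>T\<close> turns \<open>z'\<close> back into
      \<open>z\<close>, while that of \<open>T'\<close> yields a nearby \<open>r\<close> lying in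
      the domain of \<open>T'\<close>.\<close>
    define z' where "z' = m.A z - J z"
    define r where "r = resolvent_i J T' z'"
    have Ez: "E {-K..-g} z = z" using Gz m.E_neg_eq[of z] by (simp add: G_def)
    have Az: "norm (m.A z) \<le> K * norm z"
      using m.norm_A_shift_le[of "{-K..-g}" 0 K z] Ez m.K_pos m.g_pos by auto
    have AKz: "norm (m.A z + K *\<^sub>R z) \<le> (K - g) * norm z"
      using m.norm_A_shift_le[of "{-K..-g}" "-K" "K - g" z] Ez m.g_le_K by auto
    have "norm z' \<le> norm (m.A z) + norm (J z)" unfolding z'_def by (rule norm_triangle_ineq4)
    also have "\<dots> \<le> (1 + K) * norm z" using Az by (simp add: m.norm_J algebra_simps)
    finally have nz': "norm z' \<le> (1 + K) * norm z" .
    have "resolvent_i J T z' = z" by (rule m.resolvent_i_eq[OF z]) (simp add: z'_def)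
    then have "norm (r - z) \<le> e * norm z'" using e(2)[of z'] by (simp add: r_def)
    also have "\<dots> \<le> e' * norm z" using mult_left_mono[OF nz' e(1)] by (simp add: e'_def mult.assoc)
    finally have rz: "norm (r - z) \<le> e' * norm z" .
    have r: "r \<in> n.Dom" "n.A r - J r = z'" unfolding r_def by (rule n.resolvent_i)+
    have Ar: "n.A r + K *\<^sub>R r = (m.A z + K *\<^sub>R z) + (J (r - z) + K *\<^sub>R (r - z))"
      using r(2) by (simp add: z'_def linear_diff[OF m.complex_structureD(1)] algebra_simps)
    have Fsym: "inner (F a) b = inner a (F b)" and Fid: "F (F a) = F a" for a b
      by (simp_all add: F_def n.E_sym n.E_idem)
    have FD: "F r \<in> n.Dom" using n.dom_E[OF _ r(1), of "{0..}"] by (simp add: F_def)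
    \<comment> \<open>\<open>F r\<close> has nonnegative form for \<open>T'\<close>; this supplies
      the full factor \<open>K\<close> on the left-hand side.\<close>
    have "0 * (norm (F r))\<^sup>2 \<le> form_val E' (F r)"
      by (rule n.form_val_ge[of "{0..}"]) (use n.dom_subset_form_dom[OF FD] in \<open>auto simp: F_def n.E_idem\<close>)
    then have "0 \<le> inner (n.A (F r)) (F r)" using n.form_val_dom[OF FD] by simp
    also have "\<dots> = inner (n.A r) (F r)"
      using n.A_E[OF _ r(1), of "{0..}"] Fsym Fid by (simp add: F_def)
    finally have "K * (norm (F r))\<^sup>2 \<le> inner (n.A r + K *\<^sub>R r) (F r)"
      using Fsym[of r "F r"] Fid[of r] by (simp add: inner_add_left power2_norm_eq_inner)
    also have "\<dots> = inner (F (m.A z + K *\<^sub>R z)) (F r) + inner (J (r - z) + K *\<^sub>R (r - z)) (F r)"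
      unfolding Ar using Fsym[of "m.A z + K *\<^sub>R z" "F r"] Fid[of r] by (simp only: inner_add_left)
    also have "\<dots> \<le> norm (F (m.A z + K *\<^sub>R z)) * norm (F r) + norm (J (r - z) + K *\<^sub>R (r - z)) * norm (F r)"
      by (intro add_mono norm_cauchy_schwarz)
    finally have *: "K * norm (F r) * norm (F r) \<le> (norm (F (m.A z + K *\<^sub>R z)) + norm (J (r - z) + K *\<^sub>R (r - z))) * norm (F r)"
      by (simp only: power2_eq_square mult.assoc distrib_right)
    have Fr: "K * norm (F r) \<le> norm (F (m.A z + K *\<^sub>R z)) + norm (J (r - z) + K *\<^sub>R (r - z))"
    proof (cases "F r = 0")
      case False
      then show ?thesis using mult_right_le_imp_le[OF *] by simp
    qed simp
    \<comment> \<open>\<open>A + K\<close> preserves the range of \<open>G\<close>, so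
      \<open>\<xi>\<close> bounds \<open>F\<close> on the image as well and the estimate closes on
      itself.\<close>
    have "G (m.A z + K *\<^sub>R z) = m.A z + K *\<^sub>R z"
      using m.A_range_E[OF _ z, of "{..<0}"] Gz G
      by (simp add: G_def linear_add[OF m.E_linear] linear_scale[OF m.E_linear])
    then have "norm (F (m.A z + K *\<^sub>R z)) \<le> \<xi> * norm (m.A z + K *\<^sub>R z)" by (rule \<xi>)
    also have "\<dots> \<le> \<xi> * ((K - g) * norm z)" using AKz \<xi>0 by (rule mult_left_mono)
    finally have 1: "norm (F (m.A z + K *\<^sub>R z)) \<le> \<xi> * (K - g) * norm z" by simp
    have "norm (J (r - z) + K *\<^sub>R (r - z)) \<le> norm (r - z) + K * norm (r - z)"
      using norm_triangle_ineq[of "J (r - z)" "K *\<^sub>R (r - z)"] m.K_pos by (simp add: m.norm_J)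
    also have "\<dots> = (1 + K) * norm (r - z)" by (simp add: algebra_simps)
    also have "\<dots> \<le> (1 + K) * (e' * norm z)" using rz m.K_pos by (intro mult_left_mono) auto
    finally have 2: "norm (J (r - z) + K *\<^sub>R (r - z)) \<le> (1 + K) * (e' * norm z)" .
    have "norm (F z) \<le> norm (F r) + norm (F (z - r))"
      using norm_triangle_ineq[of "F r" "F (z - r)"] linear_diff[OF bounded_linear.linear[OF F], of z r] by simp
    also have "norm (F (z - r)) \<le> norm (z - r)" unfolding F_def by (rule n.norm_E_le) simp
    finally have "norm (F z) \<le> norm (F r) + e' * norm z" using rz by (simp add: norm_minus_commute)
    then have "K * norm (F z) \<le> K * norm (F r) + K * (e' * norm z)"
      using mult_left_mono[of "norm (F z)" "norm (F r) + e' * norm z" K] m.K_pos by (simp add: algebra_simps)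
    then show ?thesis using Fr 1 2 by (simp add: algebra_simps)
  qed
  \<comment> \<open>The error factor \<open>1 + 2 * K\<close> is \<open>1 + K\<close> from comparing
    \<open>T' r\<close> with \<open>T z\<close>, plus \<open>K\<close> from replacing
    \<open>F r\<close> by \<open>F z\<close>. Absorbing \<open>\<xi> * (K - g)\<close> leaves
    \<open>\<xi> * g\<close>, and \<open>small\<close> then gives
    \<open>\<xi> \<le> 1/2\<close>.\<close>
  have "\<xi> \<le> (\<xi> * (K - g) + (1 + 2 * K) * e') / K"
    unfolding \<xi>_def
  proof (rule onorm_bound)
    show "0 \<le> (onorm (F \<circ> G) * (K - g) + (1 + 2 * K) * e') / K"
      using \<xi>0 m.K_pos m.g_le_K e'0 by (simp add: \<xi>_def)
    fix x
    have "K * norm (F (G x)) \<le> (\<xi> * (K - g) + (1 + 2 * K) * e') * norm (G x)"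
      by (rule main) (simp add: G_def m.E_idem)
    also have "\<dots> \<le> (\<xi> * (K - g) + (1 + 2 * K) * e') * norm x"
      using \<xi>0 m.K_pos m.g_le_K e'0 by (intro mult_left_mono) (auto simp: G_def m.norm_E_le)
    finally show "norm ((F \<circ> G) x) \<le> (onorm (F \<circ> G) * (K - g) + (1 + 2 * K) * e') / K * norm x"
      using m.K_pos by (simp add: \<xi>_def field_simps)
  qed
  then have "\<xi> * g \<le> (1 + 2 * K) * e'" using m.K_pos by (simp add: field_simps)
  then have "2 * (\<xi> * g) \<le> g" using small by (simp add: e'_def algebra_simps)
  then have "\<xi> \<le> 1/2" using m.g_pos by (simp add: field_simps)
  then have "\<xi> * norm y \<le> 1/2 * norm y" by (intro mult_right_mono) auto
  moreover have "norm (F y) \<le> \<xi> * norm y" by (rule \<xi>) (simp add: G_def y)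
  ultimately show ?thesis by (simp add: F_def)
qed

subsection \<open>Families with monotone forms\<close>

definition covers :: "'a::real_vector set \<Rightarrow> 'a set \<Rightarrow> bool" where
  "covers M R \<longleftrightarrow> (\<forall>x. \<exists>m\<in>M. \<exists>r\<in>R. x = m + r)"

text \<open>Turns completeness into surjectivity of \<open>E B\<close> on \<open>M\<close>, to which
  approximation arguments apply: vectors with the same \<open>E B\<close> part differ by an element
  of the range of \<open>E (- B)\<close>.\<close>

lemma (in pvm) covers_iff:
  assumes B: "B \<in> sets borel"
  shows "covers M (range (E (- B))) \<longleftrightarrow> (\<forall>y. E B y = y \<longrightarrow> (\<exists>m\<in>M. E B m = y))"
proof (intro iffI allI impI)
  fix y assume c: "covers M (range (E (- B)))" and y: "E B y = y"
  obtain m v where m: "m \<in> M" "y = m + E (- B) v" using c unfolding covers_def by blast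
  have "E B y = E B m" using B m(2) by (simp add: linear_add[OF E_linear] E_Int E_empty)
  then show "\<exists>m\<in>M. E B m = y" using m(1) y by auto
next
  assume h: "\<forall>y. E B y = y \<longrightarrow> (\<exists>m\<in>M. E B m = y)"
  show "covers M (range (E (- B)))" unfolding covers_def
  proof
    fix x
    obtain m where m: "m \<in> M" "E B m = E B x" using h E_idem[OF B, of x] by blast
    have "E (- B) (x - m) = x - m" using m(2) B by (simp add: E_Compl linear_diff[OF E_linear])
    then have "x = m + E (- B) (x - m)" by simp
    then show "\<exists>m\<in>M. \<exists>r\<in>range (E (- B)). x = m + r" using m(1) by blast
  qed
qed

lemma (in pvm) covers_nonneg_iff:
  "covers M (range (E {0..})) \<longleftrightarrow> (\<forall>y. E {..<0} y = y \<longrightarrow> (\<exists>m\<in>M. E {..<0} m = y))"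
  using covers_iff[of "{..<0}" M] by (simp add: Compl_lessThan)

lemma (in pvm) covers_pos_iff:
  "covers M (range (E {0<..})) \<longleftrightarrow> (\<forall>y. E {..0} y = y \<longrightarrow> (\<exists>m\<in>M. E {..0} m = y))"
  using covers_iff[of "{..0}" M] by (simp add: Compl_atMost)

locale op_family =
  fixes J :: "'a::{real_inner, complete_space} \<Rightarrow> 'a" and T :: "real \<Rightarrow> 'a op"
    and E :: "real \<Rightarrow> real set \<Rightarrow> 'a \<Rightarrow> 'a" and \<alpha> \<beta> :: real and K g :: "real \<Rightarrow> real"
  assumes gapped: "\<And>l. l \<in> {\<alpha>..\<beta>} \<Longrightarrow> gapped_op J (T l) (E l) (K l) (g l)"
    and fin_dim_ker: "\<And>l. l \<in> {\<alpha>..\<beta>} \<Longrightarrow> fin_dim (range (E l {0}))"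
    and form_dom_const: "\<And>l. l \<in> {\<alpha>..\<beta>} \<Longrightarrow> form_dom (E l) = form_dom (E \<alpha>)"
    and form_cont: "\<And>x. x \<in> form_dom (E \<alpha>) \<Longrightarrow> x \<noteq> 0 \<Longrightarrow> continuous_on {\<alpha>..\<beta>} (\<lambda>l. form_val (E l) x)"
    and form_sign: "\<And>x l0 l. x \<in> form_dom (E \<alpha>) \<Longrightarrow> x \<noteq> 0 \<Longrightarrow> l0 \<in> {\<alpha>..\<beta>} \<Longrightarrow> form_val (E l0) x = 0 \<Longrightarrow>
        l \<in> {\<alpha>..\<beta>} \<Longrightarrow> (l < l0 \<longrightarrow> form_val (E l) x > 0) \<and> (l > l0 \<longrightarrow> form_val (E l) x < 0)"
    and norm_resolvent_cont: "\<And>l0. l0 \<in> {\<alpha>..\<beta>} \<Longrightarrow>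
        ((\<lambda>l. onorm (\<lambda>y. resolvent_i J (T l) y - resolvent_i J (T l0) y)) \<longlongrightarrow> 0) (at l0 within {\<alpha>..\<beta>})"
begin

abbreviation "t l \<equiv> form_val (E l)"
abbreviation "D \<equiv> form_dom (E \<alpha>)"

text \<open>If \<open>t l x < 0\<close> and the form were nonnegative at \<open>l'\<close>, it would
  vanish in between, and (A3) at that zero would make \<open>t l x\<close> positive.\<close>

lemma form_neg_after:
  assumes l: "l \<in> {\<alpha>..\<beta>}" "l' \<in> {\<alpha>..\<beta>}" "l < l'" and x: "x \<in> D" "x \<noteq> 0" and le: "t l x \<le> 0"
  shows "t l' x < 0"
proof (cases "t l x = 0")
  case True
  then show ?thesis using form_sign[OF x l(1) True l(2)] l(3) by simp
next
  case False
  show ?thesis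
  proof (rule ccontr)
    assume "\<not> t l' x < 0"
    moreover have "continuous_on {l..l'} (\<lambda>l. t l x)"
      by (rule continuous_on_subset[OF form_cont[OF x]]) (use l in auto)
    ultimately obtain c where c: "l \<le> c" "c \<le> l'" "t c x = 0"
      using IVT'[of "\<lambda>l. t l x" l 0 l'] le l(3) by auto
    then have "c \<in> {\<alpha>..\<beta>}" "l < c" using l False by (auto simp: less_le)
    then show False using form_sign[OF x _ c(3) l(1)] le by auto
  qed
qed

lemma form_nonpos_mono:
  assumes "l \<in> {\<alpha>..\<beta>}" "l' \<in> {\<alpha>..\<beta>}" "l \<le> l'" "x \<in> D" "t l x \<le> 0"
  shows "t l' x \<le> 0"
proof (cases "x = 0 \<or> l = l'")
  case True
  interpret gapped_op J "T l'" "E l'" "K l'" "g l'" using assms(2) by (rule gapped)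
  show ?thesis using True assms(5) form_val_0 by auto
next
  case False
  then show ?thesis using form_neg_after[of l l' x] assms by auto
qed

lemma form_pos_before:
  assumes "l \<in> {\<alpha>..\<beta>}" "l' \<in> {\<alpha>..\<beta>}" "l < l'" "x \<in> D" "x \<noteq> 0" "t l' x \<ge> 0"
  shows "t l x > 0"
  using form_neg_after[of l l' x] assms by (meson not_le)

lemma nonpos_range_cone:
  assumes l: "l \<in> {\<alpha>..\<beta>}" "l' \<in> {\<alpha>..\<beta>}" "l \<le> l'" and x: "x \<in> range (E l {..0})"
  shows "x \<in> D" "t l' x \<le> 0"
proof -
  interpret gapped_op J "T l" "E l" "K l" "g l" using l by (intro gapped)
  obtain y where y: "x = E l {..0} y" using x by blast
  show D: "x \<in> D" using dom_subset_form_dom[OF dom_nonpos, of y] y unfolding form_dom_const[OF l(1)] by simp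
  show "t l' x \<le> 0" using form_nonpos_mono[OF l D] form_val_nonpos y by simp
qed

text \<open>For \<open>y\<close> negative at \<open>m\<close>, the vector
  \<open>E l {..<0} y\<close> misses \<open>y\<close> by \<open>E l {0..} y\<close>, at most half of
  its norm by \<open>neg_subspaces_close\<close>; this feeds \<open>approx_surj_imp_surj\<close>.
  The constants are those of \<open>m\<close>, so the radius is independent of \<open>l\<close>;
  exchanging \<open>l\<close> and \<open>m\<close> would require control of \<open>K l\<close> and
  \<open>g l\<close>.\<close>

lemma covers_nonpos_nonneg_near:
  assumes m: "m \<in> {\<alpha>..\<beta>}"
  shows "\<exists>\<eta>>0. \<forall>l\<in>{\<alpha>..\<beta>}. \<bar>l - m\<bar> < \<eta> \<longrightarrow> covers (range (E l {..0})) (range (E m {0..}))"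
proof -
  interpret m: gapped_op J "T m" "E m" "K m" "g m" using m by (rule gapped)
  \<comment> \<open>Chosen to make the condition \<open>small\<close> of
    \<open>neg_subspaces_close\<close> an equality.\<close>
  define e where "e = g m / (2 * (1 + 2 * K m) * (1 + K m))"
  have e: "e > 0" "2 * (1 + 2 * K m) * (1 + K m) * e \<le> g m"
    using m.K_pos m.g_pos by (auto simp: e_def)
  have "\<forall>\<^sub>F l in at m within {\<alpha>..\<beta>}. \<bar>onorm (\<lambda>y. resolvent_i J (T l) y - resolvent_i J (T m) y)\<bar> < e"
    using tendstoD[OF norm_resolvent_cont[OF m] e(1)] by (simp add: dist_real_def)
  then obtain d where d: "d > 0" "\<And>l. l \<in> {\<alpha>..\<beta>} \<Longrightarrow> l \<noteq> m \<Longrightarrow> dist l m < d \<Longrightarrow>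
      \<bar>onorm (\<lambda>y. resolvent_i J (T l) y - resolvent_i J (T m) y)\<bar> < e"
    unfolding eventually_at by blast
  have "covers (range (E l {..0})) (range (E m {0..}))" if l: "l \<in> {\<alpha>..\<beta>}" "\<bar>l - m\<bar> < d" for l
  proof (cases "l = m")
    case True
    show ?thesis unfolding m.covers_nonneg_iff True
    proof (intro allI impI)
      fix y assume y: "E m {..<0} y = y"
      have "E m {..0} y = y" by (rule m.E_mono[of "{..<0}"]) (use y in auto)
      then show "\<exists>x\<in>range (E m {..0}). E m {..<0} x = y" using y by (metis rangeI)
    qed
  next
    case False
    interpret l: gapped_op J "T l" "E l" "K l" "g l" using l by (intro gapped)
    have bl: "bounded_linear (\<lambda>y. resolvent_i J (T l) y - resolvent_i J (T m) y)"
      by (intro bounded_linear_sub l.bounded_linear_resolvent_i m.bounded_linear_resolvent_i)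
    have res: "norm (resolvent_i J (T l) y - resolvent_i J (T m) y) \<le> e * norm y" for y
    proof -
      have "norm (resolvent_i J (T l) y - resolvent_i J (T m) y)
          \<le> onorm (\<lambda>y. resolvent_i J (T l) y - resolvent_i J (T m) y) * norm y" by (rule onorm[OF bl])
      also have "\<dots> \<le> e * norm y" using d(2)[OF l(1) False] l(2)
        by (intro mult_right_mono) (auto simp: dist_real_def)
      finally show ?thesis .
    qed
    have close: "norm (E l {0..} y) \<le> norm y / 2" if "E m {..<0} y = y" for y
      by (rule neg_subspaces_close[OF m.gapped_op_axioms l.spectral_op_axioms _ res e(2) that]) (use e in simp)
    show ?thesis unfolding m.covers_nonneg_iff
    proof (intro allI impI)
      fix y assume y: "E m {..<0} y = y"
      have "\<exists>n\<in>range (E l {..<0}). E m {..<0} n = y"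
      proof (rule approx_surj_imp_surj[where Y = "{y. E m {..<0} y = y}" and C = 1])
        show "bounded_linear (E m {..<0})" by (simp add: m.E_bounded_linear)
        show "subspace (range (E l {..<0}))" "closed (range (E l {..<0}))"
          by (simp_all add: l.subspace_range_E l.closed_range_E)
        fix y assume "y \<in> {y. E m {..<0} y = y}"
        then have y: "E m {..<0} y = y" by simp
        have "y - E l {..<0} y = E l {0..} y" using l.E_decomp(1)[of y] by (simp add: algebra_simps)
        then have r: "y - E m {..<0} (E l {..<0} y) = E m {..<0} (E l {0..} y)"
          using y linear_diff[OF m.E_linear[of "{..<0}"], of y "E l {..<0} y"] by simp
        show "\<exists>n\<in>range (E l {..<0}). norm n \<le> 1 * norm y \<and> y - E m {..<0} n \<in> {y. E m {..<0} y = y}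
            \<and> norm (y - E m {..<0} n) \<le> norm y / 2"
        proof (rule bexI[of _ "E l {..<0} y"], intro conjI)
          show "norm (E l {..<0} y) \<le> 1 * norm y" by (simp add: l.norm_E_le)
          show "y - E m {..<0} (E l {..<0} y) \<in> {y. E m {..<0} y = y}" unfolding r by (simp add: m.E_idem)
          show "norm (y - E m {..<0} (E l {..<0} y)) \<le> norm y / 2"
            unfolding r using m.norm_E_le[of "{..<0}" "E l {0..} y"] close[OF y] by simp
        qed simp
      qed (use y in simp)
      then obtain n where n: "n \<in> range (E l {..<0})" "E m {..<0} n = y" by blast
      have "E l {..0} n = n" by (rule l.E_mono[of "{..<0}"]) (use n(1) l.range_E_iff in auto)
      then show "\<exists>x\<in>range (E l {..0}). E m {..<0} x = y" using n(2) by (metis rangeI)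
    qed
  qed
  then show ?thesis using d(1) by blast
qed

text \<open>Compactness. Unit vectors of the cone at \<open>l\<close> with negative parts at
  \<open>m\<close> tending to zero also have positive parts tending to zero, by
  \<open>nonpos_cone_estimate\<close>; their kernel parts converge along a subsequence because the
  kernel is finite dimensional. The limit is a unit vector in the kernel of \<open>T m\<close>,
  still in the cone at \<open>l\<close> by lower semicontinuity, against
  \<open>form_neg_after\<close>.\<close>

lemma cone_bound:
  assumes l: "l \<in> {\<alpha>..\<beta>}" "m \<in> {\<alpha>..\<beta>}" "l < m"
  shows "\<exists>c>0. \<forall>x\<in>D. t l x \<le> 0 \<longrightarrow> c * norm x \<le> norm (E m {..<0} x)"
proof (rule ccontr)
  assume neg: "\<not> ?thesis"
  interpret l: gapped_op J "T l" "E l" "K l" "g l" using l by (intro gapped)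
  interpret m: gapped_op J "T m" "E m" "K m" "g m" using l by (intro gapped)
  have Dl: "form_dom (E l) = D" and Dm: "form_dom (E m) = D" using l form_dom_const by blast+
  have "\<exists>x. x \<in> D \<and> t l x \<le> 0 \<and> norm x = 1 \<and> norm (E m {..<0} x) < inverse (real (Suc k))" for k
  proof -
    obtain x where x: "x \<in> D" "t l x \<le> 0" "norm (E m {..<0} x) < inverse (real (Suc k)) * norm x"
      using neg by (metis inverse_positive_iff_positive not_le of_nat_0_less_iff zero_less_Suc)
    have nx: "norm x > 0" using x(3) by (metis less_irrefl mult_zero_right norm_ge_zero norm_zero order.strict_trans1 zero_less_norm_iff)
    define v where "v = (1 / norm x) *\<^sub>R x"
    have "v \<in> D" using l.form_dom_scaleR x(1) by (simp add: v_def Dl)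
    moreover have "t l v \<le> 0" using x(2) by (simp add: v_def l.form_val_scaleR mult_nonneg_nonpos)
    moreover have "norm v = 1" using nx by (simp add: v_def)
    moreover have "norm (E m {..<0} v) < inverse (real (Suc k))"
      using nx x(3) by (simp add: v_def linear_scale[OF m.E_linear] field_simps)
    ultimately show ?thesis by blast
  qed
  then obtain X where X: "\<And>k. X k \<in> D" "\<And>k. t l (X k) \<le> 0" "\<And>k. norm (X k) = 1"
    "\<And>k. norm (E m {..<0} (X k)) < inverse (real (Suc k))" by metis
  obtain z f where f: "strict_mono (f :: nat \<Rightarrow> nat)" and z: "((\<lambda>k. E m {0} (X k)) \<circ> f) \<longlonglongrightarrow> z"
    using fin_dim_bounded_subseq[OF fin_dim_ker[OF l(2)], of "\<lambda>k. E m {0} (X k)" 1]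
      m.norm_E_le[of "{0}"] X(3) by (metis borel_singleton rangeI sets.empty_sets)
  have neg0: "(\<lambda>k. E m {..<0} (X k)) \<longlonglongrightarrow> 0"
    by (rule Lim_null_comparison[OF _ LIMSEQ_inverse_real_of_nat]) (use X(4) in \<open>auto simp: less_imp_le\<close>)
  have "norm (E m {0<..} (X k)) \<le> sqrt (K m / g m) * norm (E m {..<0} (X k))" for k
  proof -
    have "t m (X k) \<le> 0" by (rule form_nonpos_mono[of l]) (use l X in auto)
    then have "(norm (E m {0<..} (X k)))\<^sup>2 \<le> (K m / g m) * (norm (E m {..<0} (X k)))\<^sup>2"
      using m.nonpos_cone_estimate[of "X k"] X(1) Dm m.g_pos by (simp add: field_simps)
    then show ?thesis by (metis real_le_rsqrt real_sqrt_mult real_sqrt_abs abs_norm_cancel)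
  qed
  then have pos0: "(\<lambda>k. E m {0<..} (X k)) \<longlonglongrightarrow> 0"
    by (intro Lim_null_comparison[OF always_eventually tendsto_mult_right_zero[OF tendsto_norm_zero[OF neg0]]]) blast
  have sum: "(\<lambda>k. E m {..<0} (X k) + E m {0<..} (X k)) \<longlonglongrightarrow> 0" using tendsto_add[OF neg0 pos0] by simp
  have "X k = E m {0} (X k) + (E m {..<0} (X k) + E m {0<..} (X k))" for k
    using m.E_decomp(1)[of "X k"] m.E_decomp(2)[of "X k"] by (simp add: algebra_simps)
  then have "X \<circ> f = (\<lambda>k. ((\<lambda>k. E m {0} (X k)) \<circ> f) k + ((\<lambda>k. E m {..<0} (X k) + E m {0<..} (X k)) \<circ> f) k)"
    unfolding comp_def by blast
  then have lim: "(X \<circ> f) \<longlonglongrightarrow> z"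
    using tendsto_add[OF z LIMSEQ_subseq_LIMSEQ[OF sum f]] by simp
  have zl: "z \<in> D" "t l z \<le> 0"
    using l.form_val_lsc[of "X \<circ> f" 0 z] X lim by (auto simp: Dl)
  have nz: "norm z = 1" using tendsto_norm[OF lim] X(3) by (simp add: comp_def LIMSEQ_const_iff)
  have "z \<in> range (E m {0})"
    by (rule Lim_in_closed_set[OF m.closed_range_E _ _ z]) auto
  then have "t m z = 0" using m.form_val_ker by auto
  moreover have "t m z < 0" by (rule form_neg_after[OF l zl(1) _ zl(2)]) (use nz in auto)
  ultimately show False by simp
qed

text \<open>Write a limit as \<open>m + p\<close>: lower semicontinuity gives \<open>p\<close>
  nonpositive form although it lies in the positive spectral subspace, so \<open>p = 0\<close>.
  Closedness of \<open>M\<close> is what \<open>approx_surj_imp_surj\<close> requires.\<close>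

lemma maximal_nonpos_closed:
  assumes l: "l \<in> {\<alpha>..\<beta>}" and M: "subspace M" "\<And>x. x \<in> M \<Longrightarrow> x \<in> D \<and> t l x \<le> 0"
    and cov: "covers M (range (E l {0<..}))"
  shows "closed M"
  unfolding closed_sequential_limits
proof (intro allI impI, elim conjE)
  interpret gapped_op J "T l" "E l" "K l" "g l" using l by (intro gapped)
  have Dl: "form_dom (E l) = D" using l form_dom_const by blast+
  fix X x assume X: "\<forall>n. X n \<in> M" and lim: "X \<longlonglongrightarrow> x"
  obtain m p where m: "m \<in> M" "p \<in> range (E l {0<..})" "x = m + p" using cov unfolding covers_def by blast
  have "(\<lambda>n. X n - m) \<longlonglongrightarrow> p" using tendsto_diff[OF lim tendsto_const[of m]] m(3) by simp
  moreover have "X n - m \<in> D \<and> t l (X n - m) \<le> 0" for n using X m(1) M by (meson subspace_diff)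
  ultimately have p: "p \<in> D" "t l p \<le> 0"
    using form_val_lsc[of "\<lambda>n. X n - m" 0 p] Dl by auto
  have "E l {0<..} p = p" using m(2) range_E_iff by auto
  then have "g l * (norm p)\<^sup>2 \<le> 0" using form_val_pos[of p] p Dl by simp
  then have "p = 0" using g_pos by (simp add: mult_le_0_iff)
  then show "x \<in> M" using m by simp
qed

text \<open>\<open>M\<close> is a graph over \<open>N\<^sub>l + Z\<^sub>l\<close>. Scaling its \<open>P\<^sub>l\<close>-component by \<open>s \<in> [0, 1]\<close> stays in the nonpositive
  cone, on which the projection onto \<open>N\<^sub>m\<close> is bounded below uniformly, so surjectivity propagates in
  finitely many Neumann steps from \<open>s = 0\<close> to \<open>s = 1\<close>.\<close>

lemma covers_transfer:
  assumes l: "l \<in> {\<alpha>..\<beta>}" "m \<in> {\<alpha>..\<beta>}" "l < m"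
    and M: "subspace M" "\<And>x. x \<in> M \<Longrightarrow> x \<in> D \<and> t l x \<le> 0"
    and cov: "covers M (range (E l {0<..}))" "covers (range (E l {..0})) (range (E m {0..}))"
  shows "covers M (range (E m {0..}))"
proof -
  interpret l: gapped_op J "T l" "E l" "K l" "g l" using l by (intro gapped)
  interpret m: gapped_op J "T m" "E m" "K m" "g m" using l by (intro gapped)
  have Dl: "form_dom (E l) = D" using l form_dom_const by blast+
  have cl: "closed M" by (rule maximal_nonpos_closed[OF l(1) M cov(1)])
  obtain c where c: "c > 0" "\<And>x. x \<in> D \<Longrightarrow> t l x \<le> 0 \<Longrightarrow> c * norm x \<le> norm (E m {..<0} x)"
    using cone_bound[OF l] by blast
  define Q where "Q = E m {..<0}"
  define Q1 where "Q1 = E l {..0}"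
  have Q: "bounded_linear Q" and Q1: "bounded_linear Q1"
    unfolding Q_def Q1_def by (simp_all add: m.E_bounded_linear l.E_bounded_linear)
  interpret Q: bounded_linear Q by fact
  interpret Q1: bounded_linear Q1 by fact
  define \<kappa> where "\<kappa> = sqrt (1 + K l / g l)"
  have \<kappa>0: "\<kappa> \<ge> 0" using l.K_pos l.g_pos by (simp add: \<kappa>_def)
  have \<kappa>: "norm x \<le> \<kappa> * norm (Q1 x)" if "x \<in> M" for x
  proof -
    have "(norm x)\<^sup>2 \<le> (1 + K l / g l) * (norm (Q1 x))\<^sup>2"
      using l.norm_nonpos_part_ge[of x] M(2)[OF that] Dl by (simp add: Q1_def)
    then show ?thesis unfolding \<kappa>_def by (metis real_le_rsqrt real_sqrt_mult real_sqrt_abs abs_norm_cancel)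
  qed
  \<comment> \<open>Norm bound for preimages under \<open>Q\<close> after \<open>h s\<close>, the
    same for all \<open>s\<close>.\<close>
  define C where "C = \<kappa> / c"
  have C0: "C \<ge> 0" using \<kappa>0 c by (simp add: C_def)
  define h where "h s x = Q1 x + s *\<^sub>R (x - Q1 x)" for s x
  have bl: "bounded_linear (\<lambda>x. Q (h s x))" for s
    unfolding h_def by (intro bounded_linear_compose[OF Q] bounded_linear_add Q1
        bounded_linear_const_scaleR bounded_linear_sub bounded_linear_ident)
  have Q1r: "x - Q1 x = E l {0<..} x" for x using l.E_decomp(4)[of x] by (simp add: Q1_def algebra_simps)
  have disj: "{..0} \<inter> {0::real<..} = {}" "{0::real<..} \<inter> {..0} = {}" by auto
  have hQ1: "Q1 (h s x) = Q1 x" "E l {0<..} (h s x) = s *\<^sub>R E l {0<..} x" for s x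
    by (simp_all add: h_def Q1r Q1.add Q1.scaleR linear_add[OF l.E_linear] linear_scale[OF l.E_linear])
       (simp_all add: Q1_def l.E_Int disj l.E_idem l.E_empty)
  \<comment> \<open>The form of the scaled positive part carries the factor
    \<open>s\<^sup>2 \<le> 1\<close>, so the total form does not increase.\<close>
  have lowb: "c * norm (Q1 x) \<le> norm (Q (h s x))" if s: "0 \<le> s" "s \<le> 1" and x: "x \<in> M" for s x
  proof -
    have xD: "x \<in> D" "t l x \<le> 0" using M(2)[OF x] by auto
    have "Q1 x \<in> form_dom (E l)" "s *\<^sub>R E l {0<..} x \<in> form_dom (E l)"
      using xD(1) unfolding Q1_def Dl[symmetric] by (auto intro!: l.form_dom_scaleR l.form_dom_E)
    then have hD: "h s x \<in> D" unfolding h_def Q1r Dl[symmetric] by (rule l.form_dom_add)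
    have pos: "0 \<le> t l (E l {0<..} x)"
      using l.form_val_pos[of x] xD(1) Dl l.g_pos
      by (metis less_imp_le mult_nonneg_nonneg order_trans zero_le_power2)
    have "t l (h s x) = t l (Q1 x) + s\<^sup>2 * t l (E l {0<..} x)"
      using l.form_val_split2[of "h s x"] hD Dl hQ1[of s x] by (simp add: Q1_def l.form_val_scaleR)
    also have "\<dots> \<le> t l (Q1 x) + 1 * t l (E l {0<..} x)"
      using pos s by (intro add_left_mono mult_right_mono) (auto simp: power_le_one)
    also have "\<dots> = t l x" using l.form_val_split2[of x] xD(1) Dl by (simp add: Q1_def)
    finally have "c * norm (h s x) \<le> norm (Q (h s x))" using c(2)[OF hD] xD(2) by (simp add: Q_def)
    moreover have "norm (Q1 x) \<le> norm (h s x)"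
      using l.norm_E_le[of "{..0}" "h s x"] hQ1(1)[of s x] by (simp add: Q1_def)
    ultimately show ?thesis using c(1) by (meson less_imp_le mult_left_mono order_trans)
  qed
  define P where "P s \<longleftrightarrow> (\<forall>y. Q y = y \<longrightarrow> (\<exists>x\<in>M. Q (h s x) = y))" for s
  \<comment> \<open>At \<open>s = 0\<close> the map is \<open>Q\<close> after \<open>Q1\<close>, and
    the two covering hypotheses make each factor surjective.\<close>
  have P0: "P 0" unfolding P_def
  proof (intro allI impI)
    fix y assume y: "Q y = y"
    then obtain v where v: "v \<in> range (E l {..0})" "Q v = y"
      using cov(2) unfolding m.covers_nonneg_iff Q_def by blast
    have "E l {..0} v = v" using v(1) l.range_E_iff[of "{..0}"] by simp
    then obtain x where x: "x \<in> M" "E l {..0} x = v" using cov(1) unfolding l.covers_pos_iff by blast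
    then show "\<exists>x\<in>M. Q (h 0 x) = y" using v(2) by (auto simp: h_def Q1_def)
  qed
  \<comment> \<open>A preimage for \<open>s\<close> is an approximate preimage for
    \<open>s'\<close>, with residual at most \<open>\<bar>s - s'\<bar> * C\<close> times the norm of
    \<open>y\<close>.\<close>
  have step: "P s'" if s: "0 \<le> s" "s \<le> 1" and s': "\<bar>s - s'\<bar> * C \<le> 1/2" and Ps: "P s" for s s'
    unfolding P_def
  proof (intro allI impI)
    fix y assume y: "Q y = y"
    show "\<exists>x\<in>M. Q (h s' x) = y"
    proof (rule approx_surj_imp_surj[OF bl M(1) cl, where Y = "{y. Q y = y}" and C = C])
      fix y assume "y \<in> {y. Q y = y}"
      then have y: "Q y = y" by simp
      then obtain x where x: "x \<in> M" "Q (h s x) = y" using Ps unfolding P_def by blast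
      have "c * norm (Q1 x) \<le> norm y" using lowb[OF s x(1)] x(2) by simp
      then have "norm (Q1 x) \<le> norm y / c" using c(1) by (simp add: field_simps)
      then have "\<kappa> * norm (Q1 x) \<le> \<kappa> * (norm y / c)" using \<kappa>0 by (rule mult_left_mono)
      then have nx: "norm x \<le> C * norm y" using \<kappa>[OF x(1)] by (simp add: C_def)
      have "h s x - h s' x = (s - s') *\<^sub>R E l {0<..} x" by (simp add: h_def Q1r scaleR_diff_left)
      then have r: "y - Q (h s' x) = Q ((s - s') *\<^sub>R E l {0<..} x)" using x(2) Q.diff[of "h s x" "h s' x"] by simp
      have "norm (y - Q (h s' x)) \<le> norm ((s - s') *\<^sub>R E l {0<..} x)"
        unfolding r unfolding Q_def by (rule m.norm_E_le) simp
      also have "\<dots> \<le> \<bar>s - s'\<bar> * norm x" using l.norm_E_le[of "{0<..}" x] by (simp add: mult_left_mono)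
      also have "\<dots> \<le> \<bar>s - s'\<bar> * (C * norm y)" using nx by (simp add: mult_left_mono)
      also have "\<dots> \<le> 1/2 * norm y" using mult_right_mono[OF s' norm_ge_zero[of y]] by (simp only: mult.assoc)
      finally have "norm (y - Q (h s' x)) \<le> norm y / 2" by simp
      moreover have "y - Q (h s' x) \<in> {y. Q y = y}" unfolding r by (simp add: Q_def m.E_idem)
      ultimately show "\<exists>x\<in>M. norm x \<le> C * norm y \<and> y - Q (h s' x) \<in> {y. Q y = y} \<and> norm (y - Q (h s' x)) \<le> norm y / 2"
        using nx x(1) by blast
    qed (use y in simp)
  qed
  \<comment> \<open>The step length \<open>1 / N\<close> needs \<open>C / N \<le> 1/2\<close>; the
    extra 1 keeps \<open>N\<close> positive when \<open>C = 0\<close>.\<close>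
  obtain N :: nat where N: "2 * C + 1 \<le> real N" using real_arch_simple by blast
  have N0: "real N > 0" using N C0 by linarith
  have "P (real k / real N)" if "k \<le> N" for k
    using that
  proof (induction k)
    case 0
    then show ?case using P0 by simp
  next
    case (Suc k)
    show ?case
    proof (rule step[of "real k / real N"])
      have "\<bar>real k / real N - real (Suc k) / real N\<bar> = 1 / real N"
        using N0 by (simp add: diff_divide_distrib[symmetric])
      then show "\<bar>real k / real N - real (Suc k) / real N\<bar> * C \<le> 1/2"
        using N N0 by (simp add: field_simps)
    qed (use Suc N0 in auto)
  qed
  from this[of N] have "P 1" using N0 by simp
  moreover have "h 1 x = x" for x by (simp add: h_def)
  ultimately show ?thesis unfolding m.covers_nonneg_iff P_def Q_def by simp
qed

end

section \<open>Crossing a parameter interval free of spectrum\<close>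

context op_family
begin

text \<open>Nonpositivity is required on the whole coset of \<open>N\<^sub>l\<^sub>0 + Z\<^sub>l\<^sub>0\<close>: unlike \<open>t\<^sub>l\<close>-orthogonality, this
  condition is inherited by larger \<open>l\<close>, and in the limit \<open>l \<rightarrow> l0\<close> it forces \<open>y - w\<close> into \<open>N\<^sub>l\<^sub>0 + Z\<^sub>l\<^sub>0\<close>.
  The witness is built from \<open>N\<^sub>l\<^sub>0 + Z\<^sub>l\<^sub>0\<close> plus its \<open>t\<^sub>l\<close>-orthogonal complement \<open>X\<close> in \<open>N\<^sub>l\<close>.\<close>

lemma nonpos_extension:
  assumes l: "l0 \<in> {\<alpha>..\<beta>}" "l \<in> {\<alpha>..\<beta>}" "m \<in> {\<alpha>..\<beta>}" "l0 < l" "l < m"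
    and ker: "\<And>x. E l {0} x = 0" and cov: "covers (range (E l {..0})) (range (E m {0..}))"
  shows "\<exists>w\<in>range (E m {0..}). \<forall>v\<in>range (E l0 {..0}). y - w + v \<in> D \<and> t l (y - w + v) \<le> 0"
proof -
  interpret l0: gapped_op J "T l0" "E l0" "K l0" "g l0" using l by (intro gapped)
  interpret l: gapped_op J "T l" "E l" "K l" "g l" using l by (intro gapped)
  have Dl: "form_dom (E l) = D" using l form_dom_const by blast
  define L where "L = range (E l0 {..0})"
  have L: "subspace L" "closed L" by (simp_all add: L_def l0.subspace_range_E l0.closed_range_E)
  have Lc: "v \<in> D" "t l v \<le> 0" if "v \<in> L" for v
    using nonpos_range_cone[of l0 l v] l that by (auto simp: L_def)
  define Q where "Q = E l {..0}"
  \<comment> \<open>With trivial kernel, \<open>Q\<close> projects onto the strictly negative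
    subspace, where the gap gives definiteness.\<close>
  have Qneg: "Q x = E l {..<0} x" for x using l.E_decomp(3)[of x] ker[of x] by (simp add: Q_def)
  have Qdom: "Q x \<in> l.Dom" for x by (simp add: Q_def l.dom_nonpos)
  have Qlin: "linear Q" by (simp add: Q_def l.E_linear)
  have Qid: "Q (Q x) = Q x" for x by (simp add: Q_def l.E_idem)
  have Qsym: "inner (Q x) z = inner x (Q z)" for x z by (simp add: Q_def l.E_sym)
  have QA: "Q (l.A (Q x)) = l.A (Q x)" for x
    using l.A_range_E[of "{..0}" "Q x"] Qdom Qid by (simp add: Q_def)
  \<comment> \<open>Minus \<open>T l\<close> cut down to the range of \<open>Q\<close>: bounded,
    symmetric, nonnegative and defined everywhere.\<close>
  define B where "B x = - l.A (Q x)" for x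
  have bl: "bounded_linear B"
  proof (rule bounded_linear_intro[of _ "K l"])
    show "B (x + z) = B x + B z" for x z by (simp add: B_def linear_add[OF Qlin] l.A_add Qdom)
    show "B (r *\<^sub>R x) = r *\<^sub>R B x" for r x by (simp add: B_def linear_scale[OF Qlin] l.A_scaleR Qdom)
    show "norm (B x) \<le> norm x * K l" for x
    proof -
      have "E l {-K l..0} (Q x) = Q x" using l.E_nonpos_eq[of "Q x"] Qid by (simp add: Q_def)
      then have "norm (l.A (Q x) - 0 *\<^sub>R Q x) \<le> K l * norm (Q x)"
        by (rule l.norm_A_shift_le[rotated 2]) (use l.K_pos in auto)
      also have "\<dots> \<le> K l * norm x" using l.K_pos l.norm_E_le[of "{..0}" x] by (simp add: Q_def)
      finally show ?thesis by (simp add: B_def mult.commute)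
    qed
  qed
  have Bsym: "inner (B x) z = inner x (B z)" for x z
  proof -
    have "inner (l.A (Q x)) z = inner (l.A (Q x)) (Q z)" using Qsym[of "l.A (Q x)" z] QA by simp
    also have "\<dots> = inner (Q x) (l.A (Q z))" by (rule l.A_sym[OF Qdom Qdom])
    also have "\<dots> = inner x (l.A (Q z))" using Qsym[of x "l.A (Q z)"] QA by simp
    finally show ?thesis by (simp add: B_def)
  qed
  have Bform: "inner (B x) x = - t l (Q x)" for x
    using Qsym[of "l.A (Q x)" x] QA[of x] l.form_val_dom[OF Qdom] by (simp add: B_def)
  \<comment> \<open>The gap bounds minus the form of \<open>Q v\<close> below by \<open>g l\<close>
    times its squared norm; \<open>norm_nonpos_part_ge\<close> costs the factor
    \<open>1 + K l / g l\<close> in passing from \<open>Q v\<close> to \<open>v\<close>.\<close>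
  define c where "c = g l / (1 + K l / g l)"
  have c: "c > 0" using l.K_pos l.g_pos by (auto simp: c_def intro!: divide_pos_pos add_pos_pos)
  have coer: "c * (norm v)\<^sup>2 \<le> inner (B v) v" if v: "v \<in> L" for v
  proof -
    have "(norm v)\<^sup>2 \<le> (1 + K l / g l) * (norm (Q v))\<^sup>2"
      using l.norm_nonpos_part_ge[of v] Lc[OF v] Dl by (simp add: Q_def)
    then have "c * (norm v)\<^sup>2 \<le> c * ((1 + K l / g l) * (norm (Q v))\<^sup>2)" using c by (simp add: mult_left_mono)
    also have "\<dots> = g l * (norm (Q v))\<^sup>2"
    proof -
      have "1 + K l / g l > 0" using l.K_pos l.g_pos by (intro add_pos_pos) auto
      then show ?thesis by (simp add: c_def)
    qed
    also have "\<dots> \<le> - t l (Q v)" using l.form_val_neg[of v] by (simp add: Qneg)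
    finally show ?thesis by (simp add: Bform)
  qed
  have pos: "0 \<le> inner (B x) x" for x using l.form_val_nonpos[of x] by (simp add: Bform Q_def)
  define X where "X = {x. Q x = x \<and> (\<forall>v\<in>L. inner (l.A x) v = 0)}"
  have Xdom: "x \<in> l.Dom" if "x \<in> X" for x using Qdom[of x] that by (simp add: X_def)
  have X: "subspace X"
  proof (rule subspaceI)
    show "0 \<in> X" by (simp add: X_def linear_0[OF Qlin] l.A_0)
    show "a + b \<in> X" if "a \<in> X" "b \<in> X" for a b
      using that Xdom by (simp add: X_def linear_add[OF Qlin] l.A_add inner_add_left)
    show "r *\<^sub>R a \<in> X" if "a \<in> X" for r a
      using that Xdom by (simp add: X_def linear_scale[OF Qlin] l.A_scaleR)
  qed
  define M where "M = {v + x | v x. v \<in> L \<and> x \<in> X}"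
  have M: "subspace M" unfolding M_def by (rule subspace_sums[OF L(1) X])
  have Mc: "z \<in> D \<and> t l z \<le> 0" if zM: "z \<in> M" for z
  proof -
    obtain v x where z: "v \<in> L" "x \<in> X" "z = v + x" using zM unfolding M_def by blast
    have "t l z = t l v + t l x + 2 * inner (l.A x) v"
      unfolding z(3) by (rule l.form_val_add_dom[OF Xdom[OF z(2)]]) (use Lc[OF z(1)] Dl in simp)
    moreover have "inner (l.A x) v = 0" using z by (simp add: X_def)
    moreover have "t l x \<le> 0" using l.form_val_nonpos[of x] z(2) by (simp add: X_def Q_def)
    moreover have "z \<in> D"
      using l.form_dom_add[of v x] Lc[OF z(1)] l.dom_subset_form_dom[OF Xdom[OF z(2)]] Dl z(3) by simp
    ultimately show ?thesis using Lc[OF z(1)] by simp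
  qed
  have "covers M (range (E l {0<..}))" unfolding l.covers_pos_iff Q_def[symmetric]
  proof (intro allI impI)
    fix n assume n: "Q n = n"
    \<comment> \<open>\<open>v\<close> need not lie in the range of \<open>Q\<close>; the correction
      \<open>Q (n - v)\<close> does, and it belongs to \<open>X\<close> because \<open>B\<close>
      depends on the \<open>Q\<close> part only.\<close>
    obtain v where v: "v \<in> L" "\<And>v'. v' \<in> L \<Longrightarrow> inner (B (n - v)) v' = 0"
      using coercive_projection[OF bl Bsym pos L c coer, of n] by blast
    have "Q (n - v) \<in> X" using v(2) by (auto simp: X_def Qid B_def)
    then have "v + Q (n - v) \<in> M" using v(1) by (auto simp: M_def)
    moreover have "Q (v + Q (n - v)) = n"
      by (simp add: linear_add[OF Qlin] linear_diff[OF Qlin] Qid n)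
    ultimately show "\<exists>m\<in>M. Q m = n" by blast
  qed
  from covers_transfer[OF l(2,3,5) M Mc this cov]
  obtain z w where zw: "z \<in> M" "w \<in> range (E m {0..})" "y = z + w" unfolding covers_def by blast
  have "y - w + v \<in> D \<and> t l (y - w + v) \<le> 0" if v: "v \<in> range (E l0 {..0})" for v
  proof (rule Mc)
    have "v + 0 \<in> M" using v X subspace_0 unfolding M_def L_def by blast
    then have "z + v \<in> M" using zw(1) M by (simp add: subspace_add)
    then show "y - w + v \<in> M" using zw(3) by simp
  qed
  then show ?thesis using zw(2) by blast
qed

text \<open>\<open>S k\<close> holds the components \<open>w\<close> of \<open>y\<close> admissible
  at \<open>\<nu> k\<close>. The sets decrease because the cones shrink with \<open>\<nu> k\<close>,
  and are bounded because \<open>cone_bound\<close> for \<open>\<nu> 0 < m\<close> controls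
  \<open>y - w\<close> by its negative part at \<open>m\<close>, which is that of \<open>y\<close>.
  A common point satisfies the coset condition at \<open>l0\<close> by continuity of the
  forms.\<close>

lemma covers_right_closed:
  assumes l: "l0 \<in> {\<alpha>..\<beta>}" "m \<in> {\<alpha>..\<beta>}"
    and \<nu>: "\<And>k. \<nu> k \<in> {\<alpha>..\<beta>}" "\<And>k. l0 < \<nu> k" "\<And>k. \<nu> k < m" "\<And>k. \<nu> (Suc k) \<le> \<nu> k" "\<nu> \<longlonglongrightarrow> l0"
    and ker: "\<And>k x. E (\<nu> k) {0} x = 0"
    and cov: "\<And>k. covers (range (E (\<nu> k) {..0})) (range (E m {0..}))"
  shows "covers (range (E l0 {..0})) (range (E m {0..}))"
  unfolding covers_def
proof
  fix y
  interpret l0: gapped_op J "T l0" "E l0" "K l0" "g l0" using l by (intro gapped)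
  interpret m: gapped_op J "T m" "E m" "K m" "g m" using l by (intro gapped)
  have Dm: "form_dom (E m) = D" using l form_dom_const by blast
  have D0: "form_dom (E l0) = D" using l form_dom_const by blast
  define L where "L = range (E l0 {..0})"
  have L0: "0 \<in> L" unfolding L_def by (intro subspace_0 l0.subspace_range_E) simp
  define S where "S k = {w. w \<in> range (E m {0..}) \<and> (\<forall>v\<in>L. y - w + v \<in> D \<and> t (\<nu> k) (y - w + v) \<le> 0)}" for k
  obtain c where c: "c > 0" "\<And>x. x \<in> D \<Longrightarrow> t (\<nu> 0) x \<le> 0 \<Longrightarrow> c * norm x \<le> norm (E m {..<0} x)"
    using cone_bound[OF \<nu>(1) l(2) \<nu>(3)] by blast
  have disj: "{..<0} \<inter> {0::real..} = {}" by auto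
  have "\<exists>w. \<forall>k. w \<in> S k"
  proof (rule nested_closed_midconvex_nonempty)
    show "S k \<noteq> {}" for k
      using nonpos_extension[OF l(1) \<nu>(1) l(2) \<nu>(2,3) ker cov, of y] by (auto simp: S_def L_def)
    show "closed (S k)" for k
      unfolding closed_sequential_limits
    proof (intro allI impI, elim conjE)
      interpret n: gapped_op J "T (\<nu> k)" "E (\<nu> k)" "K (\<nu> k)" "g (\<nu> k)" by (rule gapped[OF \<nu>(1)])
      have Dn: "form_dom (E (\<nu> k)) = D" by (rule form_dom_const[OF \<nu>(1)])
      fix W w assume W: "\<forall>n. W n \<in> S k" and lim: "W \<longlonglongrightarrow> w"
      have "w \<in> range (E m {0..})"
        by (rule Lim_in_closed_set[OF m.closed_range_E _ _ lim]) (use W in \<open>auto simp: S_def\<close>)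
      moreover have "y - w + v \<in> D \<and> t (\<nu> k) (y - w + v) \<le> 0" if v: "v \<in> L" for v
      proof -
        have "(\<lambda>n. y - W n + v) \<longlonglongrightarrow> y - w + v" by (intro tendsto_intros lim)
        then show ?thesis using n.form_val_lsc[of "\<lambda>n. y - W n + v" 0 "y - w + v"] W v
          by (simp add: S_def Dn)
      qed
      ultimately show "w \<in> S k" by (simp add: S_def)
    qed
    show "(1/2) *\<^sub>R (w + w') \<in> S k" if w: "w \<in> S k" "w' \<in> S k" for k w w'
    proof -
      interpret n: gapped_op J "T (\<nu> k)" "E (\<nu> k)" "K (\<nu> k)" "g (\<nu> k)" by (rule gapped[OF \<nu>(1)])
      have Dn: "form_dom (E (\<nu> k)) = D" by (rule form_dom_const[OF \<nu>(1)])
      have sub: "subspace (range (E m {0..}))" by (simp add: m.subspace_range_E)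
      have ww: "w \<in> range (E m {0..})" "w' \<in> range (E m {0..})" using w by (auto simp: S_def)
      have "y - (1/2) *\<^sub>R (w + w') + v \<in> D \<and> t (\<nu> k) (y - (1/2) *\<^sub>R (w + w') + v) \<le> 0" if v: "v \<in> L" for v
      proof -
        define a b where "a = y - w + v" and "b = y - w' + v"
        have ab: "a \<in> D" "b \<in> D" "t (\<nu> k) a \<le> 0" "t (\<nu> k) b \<le> 0"
          using w v by (auto simp: S_def a_def b_def)
        have eq: "y - (1/2) *\<^sub>R (w + w') + v = (1/2) *\<^sub>R (a + b)"
        proof -
          have "2 *\<^sub>R (y - (1/2) *\<^sub>R (w + w') + v) = a + b"
            by (simp add: a_def b_def scaleR_2 algebra_simps)
          then show ?thesis by (metis one_add_one scaleR_half_double scaleR_2)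
        qed
        have abD: "a - b \<in> D" using n.form_dom_diff ab Dn by simp
        \<comment> \<open>The cone is not convex, but the difference of two candidates lies in the
          nonnegative subspace at \<open>m\<close>, so its form is nonnegative at the earlier
          \<open>\<nu> k\<close>, and the parallelogram law bounds the form of the sum.\<close>
        have "a - b \<in> range (E m {0..})" using subspace_diff[OF sub ww(2,1)] by (simp add: a_def b_def)
        then have "E m {0..} (a - b) = a - b" using m.range_E_iff by simp
        then have "0 \<le> t m (a - b)" using m.form_val_nonneg[of "a - b"] abD Dm by simp
        then have "0 \<le> t (\<nu> k) (a - b)"
          using form_pos_before[OF \<nu>(1) l(2) \<nu>(3) abD] n.form_val_0 by (cases "a - b = 0") (auto simp: less_imp_le)
        then have "t (\<nu> k) (a + b) \<le> 0"
          using n.form_val_parallelogram[of a b] ab Dn by simp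
        moreover have "(1/2) *\<^sub>R (a + b) \<in> D" using n.form_dom_scaleR[OF n.form_dom_add[of a b]] ab Dn by simp
        ultimately show ?thesis unfolding eq n.form_val_scaleR by (simp add: mult_nonneg_nonpos)
      qed
      moreover have "(1/2) *\<^sub>R (w + w') \<in> range (E m {0..})"
        by (intro subspace_scale[OF sub] subspace_add[OF sub] ww)
      ultimately show ?thesis by (simp add: S_def)
    qed
    show "S (Suc k) \<subseteq> S k" for k
      using form_nonpos_mono[OF \<nu>(1) \<nu>(1) \<nu>(4)] by (auto simp: S_def)
    show "norm w \<le> norm y + norm y / c" if "w \<in> S 0" for w
    proof -
      have w: "w \<in> range (E m {0..})" "y - w \<in> D" "t (\<nu> 0) (y - w) \<le> 0"
        using that L0 by (auto simp: S_def dest: bspec[of _ _ 0])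
      have "E m {..<0} w = 0" using w(1) disj by (auto simp: m.E_Int m.E_empty)
      then have "c * norm (y - w) \<le> norm (E m {..<0} y)"
        using c(2)[OF w(2,3)] by (simp add: linear_diff[OF m.E_linear])
      also have "\<dots> \<le> norm y" by (rule m.norm_E_le) simp
      finally have "norm (y - w) \<le> norm y / c" using c(1) by (simp add: field_simps)
      moreover have "norm w \<le> norm y + norm (y - w)" using norm_triangle_sub[of w y] by (simp add: norm_minus_commute)
      ultimately show ?thesis by simp
    qed
  qed
  then obtain w where w: "\<And>k. w \<in> S k" by blast
  define z where "z = y - w"
  have z: "z + v \<in> D" "t l0 (z + v) \<le> 0" if v: "v \<in> L" for v
  proof -
    show zD: "z + v \<in> D" using w[of 0] v by (simp add: S_def z_def)
    show "t l0 (z + v) \<le> 0"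
    proof (cases "z + v = 0")
      case True
      then show ?thesis by (simp add: l0.form_val_0)
    next
      case False
      have "(\<lambda>k. t (\<nu> k) (z + v)) \<longlonglongrightarrow> t l0 (z + v)"
        by (rule continuous_on_tendsto_compose[OF form_cont[OF zD False] \<nu>(5) l(1)]) (use \<nu>(1) in auto)
      then show ?thesis
        by (rule LIMSEQ_le_const2) (use w v in \<open>auto simp: S_def z_def\<close>)
    qed
  qed
  \<comment> \<open>This coset element leaves only the positive part of \<open>z\<close>, whose form
    is then nonpositive, so it vanishes.\<close>
  have "- E l0 {..0} z \<in> L" unfolding L_def by (intro subspace_neg l0.subspace_range_E) auto
  note z1 = z[OF this]
  have eq: "z + - E l0 {..0} z = E l0 {0<..} z" using l0.E_decomp(4)[of z] by (simp add: algebra_simps)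
  have "g l0 * (norm (E l0 {0<..} (E l0 {0<..} z)))\<^sup>2 \<le> t l0 (E l0 {0<..} (E l0 {0<..} z))"
    by (rule l0.form_val_pos) (use z1(1) eq D0 in simp)
  then have "g l0 * (norm (E l0 {0<..} z))\<^sup>2 \<le> 0" using z1(2) eq by (simp add: l0.E_idem)
  then have "E l0 {0<..} z = 0" using l0.g_pos by (simp add: mult_le_0_iff)
  then have "z = E l0 {..0} z" using l0.E_decomp(4)[of z] by simp
  then have "z \<in> range (E l0 {..0})" by (rule range_eqI)
  moreover have "w \<in> range (E m {0..})" using w[of 0] by (simp add: S_def)
  moreover have "y = z + w" by (simp add: z_def)
  ultimately show "\<exists>m'\<in>range (E l0 {..0}). \<exists>r\<in>range (E m {0..}). y = m' + r" by blast
qed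

text \<open>Continuous induction downwards, with \<open>a\<close> the infimum reached.
  \<open>covers_right_closed\<close> makes \<open>a\<close> good; were \<open>a\<close> above
  \<open>m0\<close>, \<open>covers_nonpos_nonneg_near\<close> at \<open>a\<close> followed by
  \<open>covers_transfer\<close> would carry goodness to its left. Both end points may be
  eigenvalues, so each summand includes its kernel.\<close>

lemma covers_regular_interval:
  assumes m: "m0 \<in> {\<alpha>..\<beta>}" "m1 \<in> {\<alpha>..\<beta>}" "m0 < m1"
    and ker: "\<And>l x. m0 < l \<Longrightarrow> l < m1 \<Longrightarrow> E l {0} x = 0"
  shows "covers (range (E m0 {..0})) (range (E m1 {0..}))"
proof -
  define G where "G l \<longleftrightarrow> covers (range (E l {..0})) (range (E m1 {0..}))" for l
  \<comment> \<open>\<open>l' < m1\<close> leaves out the end point, so \<open>m1\<close> lies in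
    \<open>W\<close> vacuously.\<close>
  define W where "W = {l \<in> {m0..m1}. \<forall>l'. l \<le> l' \<and> l' < m1 \<longrightarrow> G l'}"
  define a where "a = Inf W"
  have in_dom: "l \<in> {\<alpha>..\<beta>}" if "m0 \<le> l" "l \<le> m1" for l using that m by auto
  have m1W: "m1 \<in> W" using m by (auto simp: W_def)
  have bdd: "bdd_below W" by (rule bdd_belowI[of _ m0]) (auto simp: W_def)
  have a_le: "a \<le> l" if "l \<in> W" for l unfolding a_def using that bdd by (rule cInf_lower)
  have m0a: "m0 \<le> a" unfolding a_def by (rule cInf_greatest) (use m1W in \<open>auto simp: W_def\<close>)
  have am1: "a \<le> m1" using a_le[OF m1W] .
  have above: "G l" if "a < l" "l < m1" for l
  proof -
    have "W \<noteq> {}" using m1W by auto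
    then have "\<exists>l'\<in>W. l' < l" using \<open>a < l\<close> unfolding a_def by (rule cInf_lessD)
    then show ?thesis using \<open>l < m1\<close> by (auto simp: W_def)
  qed
  have "a \<noteq> m1"
  proof
    assume "a = m1"
    obtain \<eta> where \<eta>: "\<eta> > 0" "\<And>l. l \<in> {\<alpha>..\<beta>} \<Longrightarrow> \<bar>l - m1\<bar> < \<eta> \<Longrightarrow> G l"
      using covers_nonpos_nonneg_near[OF m(2)] unfolding G_def by blast
    let ?l = "max m0 (m1 - \<eta>/2)"
    have "?l \<in> W" using \<eta> m by (auto simp: W_def abs_if intro!: \<eta>(2) in_dom)
    then show False using a_le[of ?l] \<open>a = m1\<close> \<eta>(1) m(3) by auto
  qed
  then have am: "a < m1" using am1 by simp
  have Ga: "G a"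
    unfolding G_def
  proof (rule covers_right_closed)
    \<comment> \<open>The double \<open>Suc\<close> starts the sequence at the midpoint, strictly
      below \<open>m1\<close>.\<close>
    let ?\<nu> = "\<lambda>k. a + (m1 - a) * inverse (real (Suc (Suc k)))"
    have inv: "0 < inverse (real (Suc (Suc k)))" "inverse (real (Suc (Suc k))) < 1" for k
      using one_less_inverse_iff[of "inverse (real (Suc (Suc k)))"] by auto
    show lt: "a < ?\<nu> k" for k using am inv[of k] by simp
    show lt2: "?\<nu> k < m1" for k
    proof -
      have "(m1 - a) * inverse (real (Suc (Suc k))) < (m1 - a) * 1"
        using am inv(2)[of k] by (intro mult_strict_left_mono) auto
      from add_strict_left_mono[OF this, of a] show ?thesis by (simp del: of_nat_Suc)
    qed
    show "?\<nu> k \<in> {\<alpha>..\<beta>}" for k using lt[of k] lt2[of k] m0a by (intro in_dom) auto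
    show "?\<nu> (Suc k) \<le> ?\<nu> k" for k
      using am by (intro add_left_mono mult_left_mono le_imp_inverse_le) auto
    have "(\<lambda>k. inverse (real (Suc (Suc k)))) \<longlonglongrightarrow> 0" using LIMSEQ_Suc[OF LIMSEQ_inverse_real_of_nat] .
    then show "?\<nu> \<longlonglongrightarrow> a"
      using tendsto_add[OF tendsto_const[of a] tendsto_mult_left[of _ 0 sequentially "m1 - a"]] by simp
    show "E (?\<nu> k) {0} x = 0" for k x by (rule ker) (use lt[of k] lt2[of k] m0a in auto)
    show "covers (range (E (?\<nu> k) {..0})) (range (E m1 {0..}))" for k
      using above[OF lt lt2] by (simp add: G_def)
  qed (use m0a am m in_dom in auto)
  have "a = m0"
  proof (rule ccontr)
    assume "a \<noteq> m0"
    then have a: "m0 < a" "a \<in> {\<alpha>..\<beta>}" using m0a am in_dom[of a] by auto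
    interpret a: gapped_op J "T a" "E a" "K a" "g a" using a by (intro gapped)
    \<comment> \<open>With trivial kernel at \<open>a\<close> the nonnegative and positive subspaces
      coincide; \<open>covers_transfer\<close> asks for the latter.\<close>
    have "E a {0..} x = E a {0<..} x" for x using a.E_decomp(2)[of x] ker[OF a(1) am] by simp
    then have Ra: "range (E a {0..}) = range (E a {0<..})" by auto
    obtain \<eta> where \<eta>: "\<eta> > 0" "\<And>l. l \<in> {\<alpha>..\<beta>} \<Longrightarrow> \<bar>l - a\<bar> < \<eta> \<Longrightarrow> covers (range (E l {..0})) (range (E a {0<..}))"
      using covers_nonpos_nonneg_near[OF a(2)] unfolding Ra by blast
    let ?l = "max m0 (a - \<eta>/2)"
    have Gl: "G l" if l: "?l \<le> l" "l < a" for l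
    proof -
      have lI: "l \<in> {\<alpha>..\<beta>}" using l am by (intro in_dom) auto
      interpret l: gapped_op J "T l" "E l" "K l" "g l" using lI by (rule gapped)
      show ?thesis unfolding G_def
      proof (rule covers_transfer[OF a(2) m(2) am])
        show "subspace (range (E l {..0}))" by (simp add: l.subspace_range_E)
        show "x \<in> D \<and> t a x \<le> 0" if "x \<in> range (E l {..0})" for x
          using nonpos_range_cone[OF lI a(2) _ that] l by simp
        show "covers (range (E l {..0})) (range (E a {0<..}))"
          using \<eta> lI l by (intro \<eta>(2)) auto
        show "covers (range (E a {..0})) (range (E m1 {0..}))" using Ga by (simp add: G_def)
      qed
    qed
    have "?l \<in> W"
    proof -
      have "G l'" if "?l \<le> l'" "l' < m1" for l'
        using Gl[of l'] above[of l'] Ga that by (cases l' a rule: linorder_cases) auto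
      then show ?thesis using a am \<eta>(1) by (auto simp: W_def)
    qed
    then show False using a_le[of ?l] a(1) \<eta>(1) by auto
  qed
  then show ?thesis using Ga by (simp add: G_def)
qed

end

section \<open>Complex spans and multiplicities\<close>

lemma cindep_independent:
  fixes J :: "'a::real_vector \<Rightarrow> 'a"
  assumes ind: "cindep J u n" and I: "I \<subseteq> {..<n}"
  shows "independent (u ` I \<union> J ` u ` I)" "card (u ` I \<union> J ` u ` I) = 2 * card I"
proof -
  have fin: "finite I" using I finite_subset by blast
  have indD: "a j = 0 \<and> b j = 0" if "(\<Sum>j<n. a j *\<^sub>R u j + b j *\<^sub>R J (u j)) = 0" "j < n" for a b j
    using ind that unfolding cindep_def by blast
  have delta: "(\<Sum>j<n. (if j = i then r else 0) *\<^sub>R f j) = r *\<^sub>R f i" if "i < n" for i r and f :: "nat \<Rightarrow> 'a"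
  proof -
    have "(\<Sum>j<n. (if j = i then r else 0) *\<^sub>R f j) = (\<Sum>j<n. if j = i then r *\<^sub>R f j else 0)"
      by (intro sum.cong) auto
    then show ?thesis using that by simp
  qed
  \<comment> \<open>Images are sets, so a repeated vector would be lost in the cardinality;
    coincidences are excluded by testing \<open>cindep\<close> with one or two nonzero
    coefficients.\<close>
  have inj_u: "i = j" if "u i = u j" "i < n" "j < n" for i j
  proof (rule ccontr)
    assume "i \<noteq> j"
    have "(\<Sum>k<n. ((if k = i then 1 else 0) - (if k = j then 1 else 0)) *\<^sub>R u k + 0 *\<^sub>R J (u k)) = 0"
      using that by (simp add: scaleR_diff_left sum_subtractf delta)
    from indD[OF this that(2)] show False using \<open>i \<noteq> j\<close> by simp
  qed
  have inj_J: "i = j" if "J (u i) = J (u j)" "i < n" "j < n" for i j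
  proof (rule ccontr)
    assume "i \<noteq> j"
    have "(\<Sum>k<n. 0 *\<^sub>R u k + ((if k = i then 1 else 0) - (if k = j then 1 else 0)) *\<^sub>R J (u k)) = 0"
      using that by (simp add: scaleR_diff_left sum_subtractf delta)
    from indD[OF this that(2)] show False using \<open>i \<noteq> j\<close> by simp
  qed
  have ne: "u i \<noteq> J (u j)" if "i < n" "j < n" for i j
  proof
    assume "u i = J (u j)"
    then have "(\<Sum>k<n. (if k = i then 1 else 0) *\<^sub>R u k + (if k = j then -1 else 0) *\<^sub>R J (u k)) = 0"
      using that by (simp only: sum.distrib delta) simp
    from indD[OF this that(1)] show False by simp
  qed
  have injs: "inj_on u I" "inj_on J (u ` I)" using I inj_u inj_J by (auto simp: inj_on_def subset_iff)
  have disj: "u ` I \<inter> J ` u ` I = {}" using ne I by (auto simp: subset_iff)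
  show "card (u ` I \<union> J ` u ` I) = 2 * card I"
    using fin by (subst card_Un_disjoint) (auto simp: disj card_image injs)
  have "c v = 0" if z: "(\<Sum>v\<in>u ` I \<union> J ` u ` I. c v *\<^sub>R v) = 0" and v: "v \<in> u ` I \<union> J ` u ` I" for c v
  proof -
    have "(\<Sum>v\<in>u ` I \<union> J ` u ` I. c v *\<^sub>R v) = (\<Sum>v\<in>u ` I. c v *\<^sub>R v) + (\<Sum>v\<in>J ` u ` I. c v *\<^sub>R v)"
      using fin disj by (intro sum.union_disjoint) auto
    also have "\<dots> = (\<Sum>i\<in>I. c (u i) *\<^sub>R u i + c (J (u i)) *\<^sub>R J (u i))"
      using injs by (simp add: sum.reindex sum.distrib)
    also have "\<dots> = (\<Sum>i<n. (if i \<in> I then c (u i) else 0) *\<^sub>R u i + (if i \<in> I then c (J (u i)) else 0) *\<^sub>R J (u i))"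
      using I by (intro sum.mono_neutral_cong_left) auto
    finally have "(\<Sum>i<n. (if i \<in> I then c (u i) else 0) *\<^sub>R u i + (if i \<in> I then c (J (u i)) else 0) *\<^sub>R J (u i)) = 0"
      using z by simp
    note d = indD[OF this]
    have "c (u i) = 0 \<and> c (J (u i)) = 0" if "i \<in> I" for i using d[of i] that I by auto
    then show ?thesis using v by auto
  qed
  then show "independent (u ` I \<union> J ` u ` I)"
    using fin by (subst dependent_finite) auto
qed

text \<open>The vectors and their \<open>J\<close> images are \<open>2 * card I\<close> independent
  real vectors in \<open>Z\<close>, while \<open>cdim J Z\<close> complex generators give at most
  twice as many real ones; so nothing of \<open>Z\<close> is left outside the span.\<close>

lemma cspan_eq_of_card_eq_cdim:
  fixes J :: "'a::real_vector \<Rightarrow> 'a"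
  assumes ind: "cindep J u n" and I: "I \<subseteq> {..<n}"
    and Z: "fin_dim Z" "\<And>z. z \<in> Z \<Longrightarrow> J z \<in> Z" and uZ: "u ` I \<subseteq> Z" and card: "card I = cdim J Z"
  shows "cspan J (u ` I) = Z"
proof -
  \<comment> \<open>The \<open>LEAST\<close> in \<open>cdim\<close> needs a witness: a finite real
    generating set of the \<open>J\<close>-invariant \<open>Z\<close> also generates it over the
    complex numbers.\<close>
  obtain B0 where B0: "finite B0" "span B0 = Z" using Z(1) by (auto simp: fin_dim_def)
  have subZ: "subspace Z" using B0(2) subspace_span by blast
  have "B0 \<union> J ` B0 \<subseteq> Z" using B0(2) Z(2) span_superset by blast
  then have "cspan J B0 \<subseteq> Z" unfolding cspan_def using subZ by (rule span_minimal)
  moreover have "Z \<subseteq> cspan J B0" unfolding cspan_def B0(2)[symmetric] by (intro span_mono) auto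
  ultimately have "cspan J B0 = Z" by simp
  then have "\<exists>k B. finite B \<and> card B = k \<and> cspan J B = Z" using B0(1) by blast
  then have "\<exists>B. finite B \<and> card B = cdim J Z \<and> cspan J B = Z" unfolding cdim_def by (rule LeastI_ex)
  then obtain B where B: "finite B" "card B = card I" "span (B \<union> J ` B) = Z" unfolding card cspan_def by blast
  let ?S = "u ` I \<union> J ` u ` I"
  have fin: "finite (B \<union> J ` B)" using B(1) by simp
  have cB: "card (B \<union> J ` B) \<le> 2 * card I"
    using card_Un_le[of B "J ` B"] card_image_le[OF B(1), of J] B(2) by linarith
  have SZ: "?S \<subseteq> Z" using uZ Z(2) by auto
  have finS: "finite ?S" using I finite_subset[OF I] by simp
  have "z \<in> span ?S" if z: "z \<in> Z" for z
  proof (rule ccontr)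
    assume nz: "z \<notin> span ?S"
    then have "independent (insert z ?S)" using cindep_independent(1)[OF ind I] by (simp add: independent_insert)
    then have "card (insert z ?S) \<le> card (B \<union> J ` B)"
      using independent_span_bound[OF fin] SZ z B(3) by (metis insert_subset)
    moreover have "z \<notin> ?S" using nz by (rule contrapos_nn) (rule span_base)
    ultimately show False using cB cindep_independent(2)[OF ind I] finS by simp
  qed
  moreover have "span ?S \<subseteq> Z" using SZ subZ by (rule span_minimal)
  ultimately show ?thesis unfolding cspan_def by (simp only: set_eq_subset subset_iff) simp
qed

subsection \<open>The eigenvectors and the decomposition\<close>

lemma zero_in_resolvent_ker_ran:
  assumes "self_adjoint J T" "zero_in_resolvent T"
  shows "op_ker T = {0}" "op_ran T = UNIV"
proof -
  have sub: "subspace (fst T)" and lin: "\<forall>x\<in>fst T. \<forall>y\<in>fst T. \<forall>c::real. snd T (x + c *\<^sub>R y) = snd T x + c *\<^sub>R snd T y"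
    using assms(1) by (auto simp: self_adjoint_def case_prod_beta)
  have z: "0 \<in> fst T" using sub by (rule subspace_0)
  have "snd T (0 + 1 *\<^sub>R 0) = snd T 0 + 1 *\<^sub>R snd T 0" using lin z by blast
  then have "snd T 0 = 0" by simp
  note z this
  moreover have "inj_on (snd T) (fst T)" "snd T ` fst T = UNIV"
    using assms(2) by (auto simp: zero_in_resolvent_def bij_betw_def)
  ultimately show "op_ker T = {0}" "op_ran T = UNIV"
    by (auto simp: op_ker_def op_ran_def inj_on_def)
qed

lemma cspan_image_Un: "cspan J (u ` (I \<union> I')) = {x + y | x y. x \<in> cspan J (u ` I) \<and> y \<in> cspan J (u ` I')}"
proof -
  have "u ` (I \<union> I') \<union> J ` u ` (I \<union> I') = (u ` I \<union> J ` u ` I) \<union> (u ` I' \<union> J ` u ` I')" by auto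
  then show ?thesis unfolding cspan_def by (simp only: span_Un)
qed

theorem theorem4p1:
  fixes J :: "'a::{real_inner, complete_space} \<Rightarrow> 'a"
    and T :: "real \<Rightarrow> 'a op"
    and E :: "real \<Rightarrow> real set \<Rightarrow> 'a \<Rightarrow> 'a"
    and \<alpha> \<beta> :: real and n :: nat and lam :: "nat \<Rightarrow> real" and u :: "nat \<Rightarrow> 'a"
  assumes J: "complex_structure J"
    and ab: "\<alpha> < \<beta>"
    (* (A1): self-adjoint, with spectral measure E l and form form_val (E l) *)
    and A1: "\<forall>l\<in>{\<alpha>..\<beta>}. self_adjoint J (T l)"
    and specE: "\<forall>l\<in>{\<alpha>..\<beta>}. spectral_measure_of (T l) (E l)"
    (* (A2) *)
    and A2: "\<forall>l\<in>{\<alpha>..\<beta>}. form_dom (E l) = form_dom (E \<alpha>)"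
    (* (A3) *)
    and A3_cont: "\<forall>x\<in>form_dom (E \<alpha>) - {0}. continuous_on {\<alpha>..\<beta>} (\<lambda>l. form_val (E l) x)"
    and A3_sign: "\<forall>x\<in>form_dom (E \<alpha>) - {0}. \<forall>l0\<in>{\<alpha>..\<beta>}. form_val (E l0) x = 0 \<longrightarrow>
                    (\<forall>l\<in>{\<alpha>..\<beta>}. (l < l0 \<longrightarrow> form_val (E l) x > 0) \<and>
                                   (l > l0 \<longrightarrow> form_val (E l) x < 0))"
    (* continuity in the norm resolvent sense *)
    and nrc: "\<forall>l0\<in>{\<alpha>..\<beta>}. ((\<lambda>l. onorm (\<lambda>y. resolvent_i J (T l) y - resolvent_i J (T l0) y))
                 \<longlongrightarrow> 0) (at l0 within {\<alpha>..\<beta>})"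
    and bdd: "\<forall>l\<in>{\<alpha>..\<beta>}. bounded_below (T l)"
    and rho_a: "zero_in_resolvent (T \<alpha>)" and rho_b: "zero_in_resolvent (T \<beta>)"
    (* \<sigma>(T) \<inter> (\<alpha>,\<beta>) = {l_1 \<le> ... \<le> l_n}, repeated with multiplicity, all in \<sigma>_dis(T) *)
    and sorted: "\<forall>i j. i \<le> j \<longrightarrow> j < n \<longrightarrow> lam i \<le> lam j"
    and spec: "\<forall>\<mu>\<in>{\<alpha><..<\<beta>}. \<not> zero_in_resolvent (T \<mu>) \<longleftrightarrow> (\<exists>j<n. lam j = \<mu>)"
    and in_range: "\<forall>j<n. lam j \<in> {\<alpha><..<\<beta>}"
    and dis: "\<forall>j<n. fredholm (T (lam j))"
    and mult: "\<forall>j<n. card {i. i < n \<and> lam i = lam j} = cdim J (op_ker (T (lam j)))"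
    (* eigenvectors *)
    and indep: "cindep J u n"
    and eig: "\<forall>j<n. u j \<in> op_ker (T (lam j))"
  shows "direct_sum3_UNIV (spec_subspace (E \<alpha>) {..<0}) (cspan J (u ` {..<n}))
           (spec_subspace (E \<beta>) {0<..})"
proof -
  have sop: "spectral_op J (T l) (E l)" if "l \<in> {\<alpha>..\<beta>}" for l
    using J A1 specE that by (simp add: spectral_op_def)
  have regular: "op_ker (T l) = {0}" "op_ran (T l) = UNIV"
    if "l \<in> {\<alpha>..\<beta>}" "\<not> (\<exists>j<n. lam j = l)" for l
  proof -
    have "zero_in_resolvent (T l)"
    proof (cases "l = \<alpha> \<or> l = \<beta>")
      case True
      then show ?thesis using rho_a rho_b by blast
    next
      case False
      then have "l \<in> {\<alpha><..<\<beta>}" using that(1) by auto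
      then show ?thesis using spec that(2) by blast
    qed
    then show "op_ker (T l) = {0}" "op_ran (T l) = UNIV"
      using zero_in_resolvent_ker_ran[of J "T l"] A1 that(1) by auto
  qed
  have "fin_dim {0 :: 'a}" unfolding fin_dim_def by (intro exI[of _ "{}"]) simp
  then have fred: "fin_dim (op_ker (T l)) \<and> closed (op_ran (T l))" if "l \<in> {\<alpha>..\<beta>}" for l
    using regular[OF that] dis by (cases "\<exists>j<n. lam j = l") (auto simp: fredholm_def)
  have ker_E: "op_ker (T l) = range (E l {0})" if "l \<in> {\<alpha>..\<beta>}" for l
    using spectral_op.kernel_eq_range[OF sop[OF that]] .
  have "\<exists>K g. gapped_op J (T l) (E l) K g" if l: "l \<in> {\<alpha>..\<beta>}" for l
  proof -
    interpret spectral_op J "T l" "E l" by (rule sop[OF l])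
    obtain K where K: "K > 0" "\<And>x. E l {..<-K} x = 0"
      using spectral_lower_bound bdd l by blast
    obtain g where g: "g > 0" "\<And>x. E l ({-g<..<g} - {0}) x = 0"
      using spectral_gap fred[OF l] by blast
    \<comment> \<open>The minimum secures \<open>g_le_K\<close>; a smaller gap is still a
      gap.\<close>
    have "gapped_op J (T l) (E l) K (min g K)"
    proof
      show "E l ({- min g K<..<min g K} - {0}) x = 0" for x
        by (rule E_null_subset[OF _ _ _ g(2)]) auto
    qed (use K g(1) in auto)
    then show ?thesis by blast
  qed
  then obtain K g where gop: "\<And>l. l \<in> {\<alpha>..\<beta>} \<Longrightarrow> gapped_op J (T l) (E l) (K l) (g l)" by metis
  interpret op_family J T E \<alpha> \<beta> K g
  proof (rule op_family.intro)
    show "fin_dim (range (E l {0}))" if "l \<in> {\<alpha>..\<beta>}" for l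
      using fred[OF that] ker_E[OF that] by simp
    show "form_dom (E l) = form_dom (E \<alpha>)" if "l \<in> {\<alpha>..\<beta>}" for l using A2 that by blast
    show "continuous_on {\<alpha>..\<beta>} (\<lambda>l. form_val (E l) x)" if "x \<in> form_dom (E \<alpha>)" "x \<noteq> 0" for x
      using A3_cont that by blast
    show "(l < l0 \<longrightarrow> form_val (E l) x > 0) \<and> (l > l0 \<longrightarrow> form_val (E l) x < 0)"
      if "x \<in> form_dom (E \<alpha>)" "x \<noteq> 0" "l0 \<in> {\<alpha>..\<beta>}" "form_val (E l0) x = 0" "l \<in> {\<alpha>..\<beta>}" for x l0 l
    proof -
      have "x \<in> form_dom (E \<alpha>) - {0}" using that by blast
      then show ?thesis using A3_sign that by blast
    qed
    show "((\<lambda>l. onorm (\<lambda>y. resolvent_i J (T l) y - resolvent_i J (T l0) y)) \<longlongrightarrow> 0) (at l0 within {\<alpha>..\<beta>})"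
      if "l0 \<in> {\<alpha>..\<beta>}" for l0 using nrc that by blast
  qed (rule gop)
  have ends: "\<alpha> \<in> {\<alpha>..\<beta>}" "\<beta> \<in> {\<alpha>..\<beta>}" using ab by auto
  interpret a: gapped_op J "T \<alpha>" "E \<alpha>" "K \<alpha>" "g \<alpha>" by (rule gop[OF ends(1)])
  interpret b: gapped_op J "T \<beta>" "E \<beta>" "K \<beta>" "g \<beta>" by (rule gop[OF ends(2)])
  have ker_regular: "E l {0} x = 0" if "l \<in> {\<alpha>..\<beta>}" "\<not> (\<exists>j<n. lam j = l)" for l x
    using regular(1)[OF that] ker_E[OF that(1)] by auto
  \<comment> \<open>At an eigenvalue the independent eigenvectors are as many as the multiplicity;
    elsewhere both sides are \<open>{0}\<close>.\<close>
  have eigenspace: "cspan J (u ` {j. j < n \<and> lam j = l}) = op_ker (T l)" if l: "l \<in> {\<alpha>..\<beta>}" for l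
  proof (cases "\<exists>j<n. lam j = l")
    case True
    interpret spectral_op J "T l" "E l" by (rule sop[OF l])
    show ?thesis
    proof (rule cspan_eq_of_card_eq_cdim[OF indep])
      show "J z \<in> op_ker (T l)" if "z \<in> op_ker (T l)" for z
        using that self_adjointD(3,4)[of z] linear_0[OF complex_structureD(1)] by (auto simp: op_ker_def)
    qed (use fred[OF l] eig mult True in auto)
  next
    case False
    then have e: "{j. j < n \<and> lam j = l} = {}" by auto
    show ?thesis unfolding regular(1)[OF l False] e by (simp add: cspan_def)
  qed
  define N where "N = range (E \<alpha> {..<0})"
  define V where "V l = cspan J (u ` {j. j < n \<and> lam j \<le> l})" for l
  define M where "M l = {a + b | a b. a \<in> N \<and> b \<in> V l}" for l
  have subN: "subspace N" by (simp add: N_def a.subspace_range_E)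
  have subV: "subspace (V l)" for l by (simp add: V_def cspan_def)
  have subM: "subspace (M l)" for l unfolding M_def by (rule subspace_sums[OF subN subV])
  \<comment> \<open>Break points: strictly between consecutive ones there is no spectrum. The end
    points anchor the induction and its conclusion.\<close>
  define \<Sigma> where "\<Sigma> = insert \<alpha> (insert \<beta> (lam ` {..<n}))"
  have \<Sigma>: "finite \<Sigma>" "\<And>l. l \<in> \<Sigma> \<Longrightarrow> l \<in> {\<alpha>..\<beta>}" using ab in_range by (auto simp: \<Sigma>_def less_imp_le)
  \<comment> \<open>Invariant of the sweep. Directness is recorded as \<open>a = 0\<close> alone,
    since \<open>a + b = 0\<close> then gives \<open>b = 0\<close>.\<close>
  define P where "P l \<longleftrightarrow> (\<forall>x\<in>M l. x \<in> D \<and> t l x \<le> 0) \<and> covers (M l) (range (E l {0<..}))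
      \<and> (\<forall>a\<in>N. \<forall>b\<in>V l. a + b = 0 \<longrightarrow> a = 0)" for l
  have base: "P \<alpha>"
  proof -
    have e: "{j. j < n \<and> lam j \<le> \<alpha>} = {}" using in_range by (force simp: not_le)
    have V: "V \<alpha> = {0}" unfolding V_def e by (simp add: cspan_def)
    then have M: "M \<alpha> = N" by (simp add: M_def)
    have "\<not> (\<exists>j<n. lam j = \<alpha>)" using in_range by force
    then have eq: "E \<alpha> {..0} = E \<alpha> {..<0}"
      using a.E_decomp(3) ker_regular[OF ends(1)] by (intro ext) simp
    have "x \<in> D \<and> t \<alpha> x \<le> 0" if "x \<in> N" for x
      using nonpos_range_cone[OF ends(1,1) order_refl, of x] that eq by (simp add: N_def)
    moreover have "covers N (range (E \<alpha> {0<..}))"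
      unfolding a.covers_pos_iff N_def eq by (metis rangeI)
    ultimately show ?thesis using V M by (simp add: P_def)
  qed
  have step: "P l'" if l: "l \<in> {\<alpha>..\<beta>}" "l' \<in> {\<alpha>..\<beta>}" "l < l'"
    and between: "\<And>s. s \<in> \<Sigma> \<Longrightarrow> \<not> (l < s \<and> s < l')" and Pl: "P l" for l l'
  proof -
    interpret l': gapped_op J "T l'" "E l'" "K l'" "g l'" by (rule gop[OF l(2)])
    have Dl': "form_dom (E l') = D" by (rule form_dom_const[OF l(2)])
    have "{j. j < n \<and> lam j \<le> l'} = {j. j < n \<and> lam j \<le> l} \<union> {j. j < n \<and> lam j = l'}"
    proof -
      have "lam j \<le> l" if "j < n" "lam j \<le> l'" "lam j \<noteq> l'" for j
        using between[of "lam j"] that by (auto simp: \<Sigma>_def)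
      then show ?thesis using l(3) by fastforce
    qed
    then have V': "V l' = {x + y | x y. x \<in> V l \<and> y \<in> op_ker (T l')}"
      unfolding V_def eigenspace[OF l(2), symmetric] by (simp only: cspan_image_Un)
    have yz: "t l' (y + z) = t l' y" if "y \<in> D" and z: "z \<in> op_ker (T l')" for y z
    proof -
      have "t l' z = 0" using l'.form_val_ker z by (auto simp: l'.kernel_eq_range)
      then show ?thesis using l'.form_val_add_dom[of z y] that Dl' by (simp add: op_ker_def)
    qed
    have inM: "x \<in> D" "t l x \<le> 0" if "x \<in> M l" for x using Pl that by (auto simp: P_def)
    have inM_after: "t l' x \<le> 0" if "x \<in> M l" for x
      using form_nonpos_mono[OF l(1,2) less_imp_le[OF l(3)]] inM[OF that] by blast
    have kerD: "z \<in> D" if "z \<in> op_ker (T l')" for z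
      using l'.dom_subset_form_dom[of z] that Dl' by (simp add: op_ker_def)
    have cone: "x \<in> D \<and> t l' x \<le> 0" if xM: "x \<in> M l'" for x
    proof -
      obtain a v z where x: "a \<in> N" "v \<in> V l" "z \<in> op_ker (T l')" "x = a + (v + z)"
        using xM unfolding M_def V' by blast
      have y: "a + v \<in> M l" using x by (auto simp: M_def)
      have "x = (a + v) + z" using x(4) by simp
      then show ?thesis
        using yz[OF inM(1)[OF y] x(3)] inM_after[OF y] l'.form_dom_add[of "a + v" z] inM(1)[OF y] kerD[OF x(3)] Dl' by simp
    qed
    have ker_between: "E s {0} x = 0" if s: "l < s" "s < l'" for s x
    proof (rule ker_regular)
      show "\<not> (\<exists>j<n. lam j = s)" using between[of s] s by (auto simp: \<Sigma>_def)
    qed (use s l in auto)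
    have "covers (M l) (range (E l' {0..}))"
    proof (rule covers_transfer[OF l subM])
      show "covers (range (E l {..0})) (range (E l' {0..}))"
        by (rule covers_regular_interval[OF l ker_between])
    qed (use Pl in \<open>auto simp: P_def\<close>)
    \<comment> \<open>Split the kernel of \<open>T l'\<close> off the nonnegative subspace and move
      it into \<open>V l'\<close>.\<close>
    then have cov: "covers (M l') (range (E l' {0<..}))"
      unfolding covers_def
    proof (intro allI)
      fix x assume "\<forall>x. \<exists>m\<in>M l. \<exists>r\<in>range (E l' {0..}). x = m + r"
      then obtain m w where mw: "m \<in> M l" "x = m + E l' {0..} w" by blast
      obtain a v where av: "a \<in> N" "v \<in> V l" "m = a + v" using mw(1) unfolding M_def by blast
      have "E l' {0} w \<in> op_ker (T l')" by (simp add: l'.kernel_eq_range)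
      then have "a + (v + E l' {0} w) \<in> M l'" using av unfolding M_def V' by blast
      moreover have "x = (a + (v + E l' {0} w)) + E l' {0<..} w"
        using mw(2) av(3) l'.E_decomp(2)[of w] by (simp add: algebra_simps)
      ultimately show "\<exists>m\<in>M l'. \<exists>r\<in>range (E l' {0<..}). x = m + r" by blast
    qed
    have "a = 0" if a: "a \<in> N" and b: "b \<in> V l'" and z0: "a + b = 0" for a b
    proof -
      obtain v z where vz: "v \<in> V l" "z \<in> op_ker (T l')" "b = v + z" using b unfolding V' by blast
      have y: "a + v \<in> M l" using a vz by (auto simp: M_def)
      have yz0: "(a + v) + z = 0" using z0 vz(3) by (simp add: add.assoc)
      \<comment> \<open>\<open>a + v = - z\<close> has zero form at \<open>l'\<close> but
        nonpositive form at the earlier \<open>l\<close>; strictness leaves only zero.\<close>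
      have "t l' (a + v) = 0" using yz[OF inM(1)[OF y] vz(2)] yz0 l'.form_val_0 by simp
      then have "a + v = 0" using form_neg_after[OF l inM(1)[OF y] _ inM(2)[OF y]] by fastforce
      then show ?thesis using Pl a vz(1) by (auto simp: P_def)
    qed
    then show ?thesis using cone cov by (auto simp: P_def)
  qed
  have "P l" if "l \<in> \<Sigma>" for l
    using that
  \<comment> \<open>Induction along the break points, measured by how many lie below
    \<open>l\<close>.\<close>
  proof (induction "card {s \<in> \<Sigma>. s < l}" arbitrary: l rule: less_induct)
    case less
    show ?case
    proof (cases "l = \<alpha>")
      case True
      then show ?thesis using base by simp
    next
      case False
      let ?S = "{s \<in> \<Sigma>. s < l}"
      have "\<alpha> \<in> ?S" using False \<Sigma>(2)[OF less.prems] by (auto simp: \<Sigma>_def)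
      then have ne: "?S \<noteq> {}" by blast
      have fin: "finite ?S" using \<Sigma>(1) by simp
      define l0 where "l0 = Max ?S"
      have l0: "l0 \<in> ?S" unfolding l0_def by (rule Max_in[OF fin ne])
      have mx: "s \<le> l0" if "s \<in> ?S" for s unfolding l0_def using Max_ge[OF fin that] .
      have "card {s \<in> \<Sigma>. s < l0} < card ?S" using l0 by (intro psubset_card_mono fin) auto
      then have "P l0" using less.hyps l0 by blast
      then show ?thesis
        by (rule step[rotated -1]) (use l0 \<Sigma>(2) less.prems mx in \<open>auto simp: not_less\<close>)
    qed
  qed
  then have "P \<beta>" by (simp add: \<Sigma>_def)
  moreover have V\<beta>: "V \<beta> = cspan J (u ` {..<n})"
  proof -
    have "{j. j < n \<and> lam j \<le> \<beta>} = {..<n}" using in_range by (auto simp: less_imp_le)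
    then show ?thesis by (simp add: V_def)
  qed
  ultimately have cone: "\<And>x. x \<in> M \<beta> \<Longrightarrow> x \<in> D \<and> t \<beta> x \<le> 0" and cov: "covers (M \<beta>) (range (E \<beta> {0<..}))"
    and dir: "\<And>a b. a \<in> N \<Longrightarrow> b \<in> V \<beta> \<Longrightarrow> a + b = 0 \<Longrightarrow> a = 0" by (auto simp: P_def)
  show ?thesis
    unfolding direct_sum3_UNIV_def spec_subspace_def N_def[symmetric] V\<beta>[symmetric]
  proof (intro conjI allI ballI impI)
    fix x
    obtain m c where mc: "m \<in> M \<beta>" "c \<in> range (E \<beta> {0<..})" "x = m + c" using cov unfolding covers_def by blast
    then show "\<exists>a\<in>N. \<exists>b\<in>V \<beta>. \<exists>c\<in>range (E \<beta> {0<..}). x = a + b + c" unfolding M_def by blast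
  next
    fix a b c assume abc: "a \<in> N" "b \<in> V \<beta>" "c \<in> range (E \<beta> {0<..})" "a + b + c = 0"
    have x: "a + b \<in> M \<beta>" using abc by (auto simp: M_def)
    \<comment> \<open>\<open>a + b = - c\<close> lies in the positive spectral subspace at
      \<open>\<beta>\<close> and in the nonpositive cone, so it is zero.\<close>
    have "E \<beta> {0<..} c = c" using abc(3) b.range_E_iff by simp
    moreover have "a + b = - c" using abc(4) by (simp add: add_eq_0_iff2)
    ultimately have "E \<beta> {0<..} (a + b) = a + b" by (simp add: linear_neg[OF b.E_linear])
    then have "g \<beta> * (norm (a + b))\<^sup>2 \<le> 0"
      using b.form_val_pos[of "a + b"] cone[OF x] form_dom_const[OF ends(2)] by simp
    then have z: "a + b = 0" using b.g_pos by (simp add: mult_le_0_iff)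
    have "a = 0" by (rule dir[OF abc(1,2) z])
    then show "a = 0" "b = 0" "c = 0" using z abc(4) by auto
  qed
qed

end
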